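(* Let $\Omega$ be a finite set of cardinality $d\ge 3$, let $F\le\mathrm{Sym}(\Omega)$ be $2$-transitive and assume that the point stabilizers $F_\omega$ $(\omega\in\Omega)$ are simple non-abelian. Let $k\in\mathbb{N}$ and let $\widetilde F\le\mathrm{Aut}(B_{d,k})$ satisfy condition (C) and $\pi\widetilde F=F$. Then $\mathrm{U}_k(\widetilde F)$ equals one of the following: $\mathrm{U}_2(\Gamma_1(F))$, for a group $\Gamma_1(F)$ associated with some involutive compatibility cocycle of $F$; $\mathrm{U}_2(\Delta(F))$, for some group $\Delta(F)$ of the form described in the context; or $\mathrm{U}_2(\Phi(F))=\mathrm{U}_1(F)$.
   Context: $T_d=(V,E)$ is the $d$-regular tree (Serre's convention: $E$ consists of oriented edges with inversion $e\mapsto\overline e$, $E(x)$ is the set of edges with origin $x$). A labelling of $T_d$ is a map $l:E\to\Omega$ such that for each $x\in V$ the restriction $l_x:E(x)\to\Omega$ is bijective, and $l(e)=l(\overline e)$ for all $e$. Fix a labelling. For $k\in\mathbb{N}=\{1,2,\dots\}$, $B_{d,k}$ is a fixed labelled tree isomorphic to a ball of radius $k$ in the labelled tree $T_d$, with center $b$; for $x\in V$ let $l_x^k:B(x,k)\to B_{d,k}$ be the unique label-respecting isomorphism. The $k$-local action of $g\in\mathrm{Aut}(T_d)$ at $x$ is $\sigma_k(g,x):=l_{gx}^k\circ g\circ(l_x^k)^{-1}\in\mathrm{Aut}(B_{d,k})$. For $F\le\mathrm{Aut}(B_{d,k})$, $$\mathrm{U}_k(F):=\{g\in\mathrm{Aut}(T_d)\mid\forall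 x\in V:\ \sigma_k(g,x)\in F\}.$$ $\mathrm{Aut}(B_{d,1})$ is identified with $\mathrm{Sym}(\Omega)$ via the labelling, and $\pi:\mathrm{Aut}(B_{d,k})\to\mathrm{Aut}(B_{d,1})=\mathrm{Sym}(\Omega)$ is restriction to the ball of radius $1$ around $b$. Let $b_\omega$ be the neighbour of $b$ along the edge labelled $\omega$; $a\in\mathrm{Aut}(B_{d,k})$ acts on $\Omega$ by $a b_\omega=b_{a\omega}$. Condition (C) on $F\le\mathrm{Aut}(B_{d,k})$: let $T_\omega\subseteq B_{d,k}$ be the subtree spanned by the vertices of $B_{d,k}$ at distance at most $k$ from $b_\omega$, and let $\iota_\omega$ be the unique non-trivial label-respecting automorphism of $T_\omega$ (it is an involution exchanging $b$ and $b_\omega$). Then (C) is: $$\forall a\in F\ \forall\omega\in\Omega\ \exists a_\omega\in F:\ a_\omega|_{T_\omega}=\iota_{a\omega}\circ a\circ\iota_\omega .$$ Realization of $\mathrm{Aut}(B_{d,2})$: an automorphism $\alpha$ of $B_{d,2}$ is identified with $(a,(a_\omega)_{\omega\in\Omega})$, where $a\in\mathrm{Sym}(\Omega)$ is its permutation of labels at $b$ and $a_\omega\in\mathrm{Sym}(\Omega)$ is its permutation of labels at $b_\omega$ (edges with origin $b_\omega$ and label $\omega'$ go to edges with label $a_\omega\omega'$). Thus $\mathrm{Aut}(B_{d,2})=\{(a,(a_\omega)_\omega)\mid a,a_\omega\in\mathrm{Sym}(\Omega),\ a_\omega\omega=a\omega\}$, with product $(a,(a_\omega)_\omega)(c,(c_\omega)_\omega)=(ac,(a_{c\omega}c_\omega)_\omega)$.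 Let $F\le\mathrm{Sym}(\Omega)$. A compatibility cocycle of $F$ is a map $z:F\times\Omega\to F$ with $z(a,\omega)\omega=a\omega$ and $z(ab,\omega)=z(a,b\omega)z(b,\omega)$ for all $a,b\in F$, $\omega\in\Omega$; it is involutive if moreover $z(z(a,\omega),\omega)=a$. - For an involutive compatibility cocycle $z$ of $F$: $\Gamma_1(F):=\{(a,(z(a,\omega))_\omega)\mid a\in F\}\le\mathrm{Aut}(B_{d,2})$. - Fix $\omega_0\in\Omega$. $\Delta(F)$ denotes any subgroup of $\mathrm{Aut}(B_{d,2})$ of the form $\{(a,(z(a,\omega)\alpha_\omega(a_0))_\omega)\mid a\in F,\ a_0\in F_{\omega_0}\}$, where $z$ is a compatibility cocycle of $F$ and $\alpha_\omega:F_{\omega_0}\to F_\omega$ $(\omega\in\Omega)$ are isomorphisms, which satisfies (C) and in which $\{(a,(z(a,\omega))_\omega)\mid a\in F\}$ and $\{(\mathrm{id},(\alpha_\omega(a_0))_\omega)\mid a_0\in F_{\omega_0}\}$ commute. - $\Phi(F):=\{(a,(a_\omega)_\omega)\mid a\in F,\ a_\omega\in F,\ a_\omega\omega=a\omega\ \forall\omega\in\Omega\}\le\mathrm{Aut}(B_{d,2})$. *)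

theory Defs
  imports "HOL-Algebra.SimpleGroups" "HOL-Algebra.Bij" "Graph_Theory.Graph_Theory"
begin

text \<open>
  A tree has no parallel edges, so its set of oriented edges may be taken to consist of the pairs
  (origin, terminus), with inversion \<^term>\<open>prod.swap\<close>. A graph in Serre's sense without loops and
  parallel edges is then a \<^locale>\<open>pair_bidirected_digraph\<close>, and a morphism is determined by its
  map on vertices. As in \<^const>\<open>Bij\<close>, maps between (sub)graphs are extensional functions on the
  vertex set, so that equality of maps and restriction to subgraphs are meaningful.
\<close>

section \<open>Regular trees, labellings and balls\<close>

text \<open>
  \<^const>\<open>pre_digraph.cycle\<close> also admits the walks along an edge and back, which are not circuits;
  without loops and parallel edges every circuit has length at least three. (For the same reason
  the library's \<^const>\<open>tree\<close> cannot be used: no symmetric graph with an edge satisfies it.)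
\<close>

definition regular_tree :: "nat \<Rightarrow> 'v pair_pre_digraph \<Rightarrow> bool" where
  "regular_tree d T \<longleftrightarrow>
     pair_bidirected_digraph T \<and>
     Digraph_Component.connected (with_proj T) \<and>
     (\<nexists>p. pre_digraph.cycle (with_proj T) p \<and> 3 \<le> length p) \<and>
     (\<forall>x\<in>pverts T. finite (out_arcs (with_proj T) x) \<and> out_degree (with_proj T) x = d)"

definition labelling :: "'v pair_pre_digraph \<Rightarrow> 'l set \<Rightarrow> ('v \<times> 'v \<Rightarrow> 'l) \<Rightarrow> bool" where
  "labelling T \<Omega> l \<longleftrightarrow>
     (\<forall>x\<in>pverts T. bij_betw l (out_arcs (with_proj T) x) \<Omega>) \<and>
     (\<forall>e\<in>parcs T. l (prod.swap e) = l e)"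

definition graph_dist :: "'v pair_pre_digraph \<Rightarrow> 'v \<Rightarrow> 'v \<Rightarrow> nat" where
  "graph_dist G x y = (LEAST n. \<exists>p. pre_digraph.awalk (with_proj G) x p y \<and> length p = n)"

definition graph_ball :: "'v pair_pre_digraph \<Rightarrow> 'v \<Rightarrow> nat \<Rightarrow> 'v pair_pre_digraph" where
  "graph_ball G x k =
     (let W = {y \<in> pverts G. graph_dist G x y \<le> k}
      in \<lparr>pverts = W, parcs = parcs G \<inter> W \<times> W\<rparr>)"

definition nbr :: "'v pair_pre_digraph \<Rightarrow> ('v \<times> 'v \<Rightarrow> 'l) \<Rightarrow> 'v \<Rightarrow> 'l \<Rightarrow> 'v" where
  "nbr T l x \<omega> = (THE y. (x, y) \<in> parcs T \<and> l (x, y) = \<omega>)"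

section \<open>Automorphisms\<close>

definition graph_isos :: "'v pair_pre_digraph \<Rightarrow> 'v pair_pre_digraph \<Rightarrow> ('v \<Rightarrow> 'v) set" where
  "graph_isos G H =
     {f \<in> extensional (pverts G). bij_betw f (pverts G) (pverts H) \<and>
        (\<forall>x\<in>pverts G. \<forall>y\<in>pverts G. (x, y) \<in> parcs G \<longleftrightarrow> (f x, f y) \<in> parcs H)}"

definition label_isos ::
  "('v \<times> 'v \<Rightarrow> 'l) \<Rightarrow> 'v pair_pre_digraph \<Rightarrow> 'v pair_pre_digraph \<Rightarrow> ('v \<Rightarrow> 'v) set" where
  "label_isos l G H =
     {f \<in> graph_isos G H. \<forall>x y. (x, y) \<in> parcs G \<longrightarrow> l (f x, f y) = l (x, y)}"

definition Aut :: "'v pair_pre_digraph \<Rightarrow> ('v \<Rightarrow> 'v) monoid" where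
  "Aut G = BijGroup (pverts G)\<lparr>carrier := graph_isos G G\<rparr>"

section \<open>Local actions and universal groups\<close>

text \<open>
  The fixed labelled tree \<open>B\<^sub>d\<^sub>,\<^sub>k\<close> is the ball of radius \<open>k\<close> around a base vertex \<open>b\<close> of the tree
  itself, with the induced labels; its centre is thus the same vertex \<open>b\<close> for all \<open>k\<close>, and
  \<open>B\<^sub>d\<^sub>,\<^sub>1\<close> is the ball of radius one around the centre of each \<open>B\<^sub>d\<^sub>,\<^sub>k\<close>.
\<close>

definition ball_label_iso ::
  "'v pair_pre_digraph \<Rightarrow> ('v \<times> 'v \<Rightarrow> 'l) \<Rightarrow> 'v \<Rightarrow> nat \<Rightarrow> 'v \<Rightarrow> 'v \<Rightarrow> 'v" where
  "ball_label_iso T l b k x = (THE f. f \<in> label_isos l (graph_ball T x k) (graph_ball T b k))"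

definition local_action ::
  "'v pair_pre_digraph \<Rightarrow> ('v \<times> 'v \<Rightarrow> 'l) \<Rightarrow> 'v \<Rightarrow> nat \<Rightarrow> ('v \<Rightarrow> 'v) \<Rightarrow> 'v \<Rightarrow> 'v \<Rightarrow> 'v" where
  "local_action T l b k g x =
     (\<lambda>y \<in> pverts (graph_ball T b k).
        ball_label_iso T l b k (g x)
          (g (inv_into (pverts (graph_ball T x k)) (ball_label_iso T l b k x) y)))"

definition univ_group ::
  "'v pair_pre_digraph \<Rightarrow> ('v \<times> 'v \<Rightarrow> 'l) \<Rightarrow> 'v \<Rightarrow> nat \<Rightarrow> ('v \<Rightarrow> 'v) set \<Rightarrow> ('v \<Rightarrow> 'v) set" where
  "univ_group T l b k F =
     {g \<in> carrier (Aut T). \<forall>x\<in>pverts T. local_action T l b k g x \<in> F}"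

text \<open>
  The permutation of labels of \<open>\<alpha>\<close> at a vertex \<open>x\<close> all of whose neighbours lie in the domain of
  \<open>\<alpha>\<close>: the edge with origin \<open>x\<close> and label \<open>\<omega>\<close> goes to an edge with label \<open>perm_at T l \<Omega> \<alpha> x \<omega>\<close>. For
  \<open>x = b\<close> this is the action on \<open>\<Omega>\<close> given by \<open>\<alpha> b\<^sub>\<omega> = b\<^sub>\<alpha>\<^sub>\<omega>\<close>.
\<close>

definition perm_at ::
  "'v pair_pre_digraph \<Rightarrow> ('v \<times> 'v \<Rightarrow> 'l) \<Rightarrow> 'l set \<Rightarrow> ('v \<Rightarrow> 'v) \<Rightarrow> 'v \<Rightarrow> 'l \<Rightarrow> 'l" where
  "perm_at T l \<Omega> \<alpha> x = (\<lambda>\<omega>\<in>\<Omega>. l (\<alpha> x, \<alpha> (nbr T l x \<omega>)))"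

definition restr_perm ::
  "'v pair_pre_digraph \<Rightarrow> ('v \<times> 'v \<Rightarrow> 'l) \<Rightarrow> 'l set \<Rightarrow> 'v \<Rightarrow> ('v \<Rightarrow> 'v) \<Rightarrow> 'l \<Rightarrow> 'l" where
  "restr_perm T l \<Omega> b \<alpha> = perm_at T l \<Omega> (restrict \<alpha> (pverts (graph_ball T b 1))) b"

text \<open>The set of automorphisms of \<open>B\<^sub>d\<^sub>,\<^sub>1\<close> that is identified with a set \<open>F\<close> of permutations of \<open>\<Omega>\<close>.\<close>

definition of_perms ::
  "'v pair_pre_digraph \<Rightarrow> ('v \<times> 'v \<Rightarrow> 'l) \<Rightarrow> 'l set \<Rightarrow> 'v \<Rightarrow> ('l \<Rightarrow> 'l) set \<Rightarrow> ('v \<Rightarrow> 'v) set" where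
  "of_perms T l \<Omega> b F = {\<alpha> \<in> carrier (Aut (graph_ball T b 1)). perm_at T l \<Omega> \<alpha> b \<in> F}"

section \<open>The compatibility condition\<close>

definition edge_tree ::
  "'v pair_pre_digraph \<Rightarrow> ('v \<times> 'v \<Rightarrow> 'l) \<Rightarrow> 'v \<Rightarrow> nat \<Rightarrow> 'l \<Rightarrow> 'v pair_pre_digraph" where
  "edge_tree T l b k \<omega> = graph_ball (graph_ball T b k) (nbr T l b \<omega>) k"

definition edge_flip ::
  "'v pair_pre_digraph \<Rightarrow> ('v \<times> 'v \<Rightarrow> 'l) \<Rightarrow> 'v \<Rightarrow> nat \<Rightarrow> 'l \<Rightarrow> 'v \<Rightarrow> 'v" where
  "edge_flip T l b k \<omega> =
     (THE f. f \<in> label_isos l (edge_tree T l b k \<omega>) (edge_tree T l b k \<omega>) \<and>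
             f \<noteq> (\<lambda>x \<in> pverts (edge_tree T l b k \<omega>). x))"

definition condition_C ::
  "'v pair_pre_digraph \<Rightarrow> ('v \<times> 'v \<Rightarrow> 'l) \<Rightarrow> 'l set \<Rightarrow> 'v \<Rightarrow> nat \<Rightarrow> ('v \<Rightarrow> 'v) set \<Rightarrow> bool" where
  "condition_C T l \<Omega> b k F \<longleftrightarrow>
     (\<forall>a\<in>F. \<forall>\<omega>\<in>\<Omega>. \<exists>a'\<in>F.
        restrict a' (pverts (edge_tree T l b k \<omega>)) =
        (\<lambda>x \<in> pverts (edge_tree T l b k \<omega>).
           edge_flip T l b k (perm_at T l \<Omega> a b \<omega>) (a (edge_flip T l b k \<omega> x))))"

section \<open>Permutation groups and cocycles\<close>

definition perm_group :: "'l set \<Rightarrow> ('l \<Rightarrow> 'l) set \<Rightarrow> ('l \<Rightarrow> 'l) monoid" where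
  "perm_group \<Omega> F = BijGroup \<Omega>\<lparr>carrier := F\<rparr>"

definition two_transitive :: "'l set \<Rightarrow> ('l \<Rightarrow> 'l) set \<Rightarrow> bool" where
  "two_transitive \<Omega> F \<longleftrightarrow>
     (\<forall>x\<in>\<Omega>. \<forall>y\<in>\<Omega>. \<forall>x'\<in>\<Omega>. \<forall>y'\<in>\<Omega>. x \<noteq> y \<longrightarrow> x' \<noteq> y' \<longrightarrow> (\<exists>a\<in>F. a x = x' \<and> a y = y'))"

definition point_stab :: "('l \<Rightarrow> 'l) set \<Rightarrow> 'l \<Rightarrow> ('l \<Rightarrow> 'l) set" where
  "point_stab F \<omega> = {a \<in> F. a \<omega> = \<omega>}"

definition compat_cocycle ::
  "'l set \<Rightarrow> ('l \<Rightarrow> 'l) set \<Rightarrow> (('l \<Rightarrow> 'l) \<Rightarrow> 'l \<Rightarrow> 'l \<Rightarrow> 'l) \<Rightarrow> bool" where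
  "compat_cocycle \<Omega> F z \<longleftrightarrow>
     (\<forall>a\<in>F. \<forall>\<omega>\<in>\<Omega>. z a \<omega> \<in> F \<and> z a \<omega> \<omega> = a \<omega>) \<and>
     (\<forall>a\<in>F. \<forall>c\<in>F. \<forall>\<omega>\<in>\<Omega>. z (compose \<Omega> a c) \<omega> = compose \<Omega> (z a (c \<omega>)) (z c \<omega>))"

definition involutive_cocycle ::
  "'l set \<Rightarrow> ('l \<Rightarrow> 'l) set \<Rightarrow> (('l \<Rightarrow> 'l) \<Rightarrow> 'l \<Rightarrow> 'l \<Rightarrow> 'l) \<Rightarrow> bool" where
  "involutive_cocycle \<Omega> F z \<longleftrightarrow>
     compat_cocycle \<Omega> F z \<and> (\<forall>a\<in>F. \<forall>\<omega>\<in>\<Omega>. z (z a \<omega>) \<omega> = a)"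

section \<open>Subgroups of the automorphism group of the ball of radius two\<close>

definition realization ::
  "'v pair_pre_digraph \<Rightarrow> ('v \<times> 'v \<Rightarrow> 'l) \<Rightarrow> 'l set \<Rightarrow> 'v \<Rightarrow> ('v \<Rightarrow> 'v)
     \<Rightarrow> ('l \<Rightarrow> 'l) \<times> ('l \<Rightarrow> 'l \<Rightarrow> 'l)" where
  "realization T l \<Omega> b \<alpha> =
     (perm_at T l \<Omega> \<alpha> b, \<lambda>\<omega>\<in>\<Omega>. perm_at T l \<Omega> \<alpha> (nbr T l b \<omega>))"

text \<open>
  The set of automorphisms of \<open>B\<^sub>d\<^sub>,\<^sub>2\<close> that is identified with a set \<open>S\<close> of pairs
  \<open>(a, (a\<^sub>\<omega>)\<^sub>\<omega>)\<close>. The sets \<open>S\<close> used below consist of pairs with \<open>a\<^sub>\<omega> \<omega> = a \<omega>\<close>, all of which are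
  realized by automorphisms.
\<close>

definition of_pairs ::
  "'v pair_pre_digraph \<Rightarrow> ('v \<times> 'v \<Rightarrow> 'l) \<Rightarrow> 'l set \<Rightarrow> 'v \<Rightarrow> (('l \<Rightarrow> 'l) \<times> ('l \<Rightarrow> 'l \<Rightarrow> 'l)) set
     \<Rightarrow> ('v \<Rightarrow> 'v) set" where
  "of_pairs T l \<Omega> b S = {\<alpha> \<in> carrier (Aut (graph_ball T b 2)). realization T l \<Omega> b \<alpha> \<in> S}"

definition Gamma1 ::
  "'v pair_pre_digraph \<Rightarrow> ('v \<times> 'v \<Rightarrow> 'l) \<Rightarrow> 'l set \<Rightarrow> 'v \<Rightarrow> ('l \<Rightarrow> 'l) set
     \<Rightarrow> (('l \<Rightarrow> 'l) \<Rightarrow> 'l \<Rightarrow> 'l \<Rightarrow> 'l) \<Rightarrow> ('v \<Rightarrow> 'v) set" where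
  "Gamma1 T l \<Omega> b F z = of_pairs T l \<Omega> b {(a, \<lambda>\<omega>\<in>\<Omega>. z a \<omega>) | a. a \<in> F}"

definition Phi ::
  "'v pair_pre_digraph \<Rightarrow> ('v \<times> 'v \<Rightarrow> 'l) \<Rightarrow> 'l set \<Rightarrow> 'v \<Rightarrow> ('l \<Rightarrow> 'l) set \<Rightarrow> ('v \<Rightarrow> 'v) set" where
  "Phi T l \<Omega> b F =
     of_pairs T l \<Omega> b {(a, \<lambda>\<omega>\<in>\<Omega>. s \<omega>) | a s. a \<in> F \<and> (\<forall>\<omega>\<in>\<Omega>. s \<omega> \<in> F \<and> s \<omega> \<omega> = a \<omega>)}"

definition is_Delta ::
  "'v pair_pre_digraph \<Rightarrow> ('v \<times> 'v \<Rightarrow> 'l) \<Rightarrow> 'l set \<Rightarrow> 'v \<Rightarrow> 'l \<Rightarrow> ('l \<Rightarrow> 'l) set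
     \<Rightarrow> ('v \<Rightarrow> 'v) set \<Rightarrow> bool" where
  "is_Delta T l \<Omega> b \<omega>\<^sub>0 F D \<longleftrightarrow>
     subgroup D (Aut (graph_ball T b 2)) \<and>
     condition_C T l \<Omega> b 2 D \<and>
     (\<exists>z \<alpha>. compat_cocycle \<Omega> F z \<and>
        (\<forall>\<omega>\<in>\<Omega>. \<alpha> \<omega> \<in> iso (perm_group \<Omega> (point_stab F \<omega>\<^sub>0)) (perm_group \<Omega> (point_stab F \<omega>))) \<and>
        D = of_pairs T l \<Omega> b
              {(a, \<lambda>\<omega>\<in>\<Omega>. compose \<Omega> (z a \<omega>) (\<alpha> \<omega> a\<^sub>0)) | a a\<^sub>0. a \<in> F \<and> a\<^sub>0 \<in> point_stab F \<omega>\<^sub>0} \<and>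
        (\<forall>\<beta> \<in> of_pairs T l \<Omega> b {(a, \<lambda>\<omega>\<in>\<Omega>. z a \<omega>) | a. a \<in> F}.
         \<forall>\<gamma> \<in> of_pairs T l \<Omega> b {(\<lambda>\<omega>\<in>\<Omega>. \<omega>, \<lambda>\<omega>\<in>\<Omega>. \<alpha> \<omega> a\<^sub>0) | a\<^sub>0. a\<^sub>0 \<in> point_stab F \<omega>\<^sub>0}.
           \<beta> \<otimes>\<^bsub>Aut (graph_ball T b 2)\<^esub> \<gamma> = \<gamma> \<otimes>\<^bsub>Aut (graph_ball T b 2)\<^esub> \<beta>))"

end

theory Submission
  imports Defs
begin

text \<open>
  The tree is a Cayley graph: its vertices are the reduced words in the labels, and for any two vertices
  there is exactly one label-preserving automorphism, a translation, that takes one to the other. An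
  automorphism \<open>g\<close> has a local permutation \<open>\<sigma> g x\<close> of the labels at each vertex \<open>x\<close>; these satisfy the
  chain rule \<open>\<sigma> (g \<cdot> h) x = \<sigma> g (h x) \<star> \<sigma> h x\<close> and, with the image of one vertex, they determine \<open>g\<close>.
  The label-preserving isomorphisms of balls and the flips of edges are restrictions of translations, so
  that local actions are obtained by composing with translations on both sides and restricting to a ball.

  Condition (C) implies that each element of \<open>Ft\<close> is the local action at \<open>b\<close> of an element of the
  universal group \<open>G\<close> (\<open>extend_local_action\<close>). So \<open>G\<close> is a group that contains the translations, has
  local permutations in \<open>F\<close>, with all of \<open>F\<close> occurring at \<open>b\<close>, and is determined by its action on balls
  of radius \<open>k\<close>. The classification is derived from these properties. Let \<open>K\<close> be the subgroup of \<open>G\<close> that fixes \<open>b\<close>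
  and its neighbours \<open>b\<^sub>\<omega>\<close>. The local permutations of \<open>K\<close> at \<open>b\<^sub>\<omega>\<close> form a normal subgroup of the simple
  group \<open>F\<^sub>\<omega>\<close>, because the stabilizer of the edge from \<open>b\<close> to \<open>b\<^sub>\<omega>\<close> acts at \<open>b\<^sub>\<omega>\<close> as \<open>F\<^sub>\<omega>\<close>; since \<open>F\<close> is
  transitive, they are trivial for all \<open>\<omega>\<close>, or all of \<open>F\<^sub>\<omega>\<close> for all \<open>\<omega>\<close> (\<open>K_onto\<close>). There are three cases.

  If \<open>K\<close> acts trivially at the neighbours, then the local permutation of \<open>g\<close> at \<open>b\<^sub>\<omega>\<close> is a function of
  that at \<open>b\<close>. This function is the cocycle, and flipping edges makes it involutive.

  Suppose that \<open>K\<close> is onto all \<open>F\<^sub>\<omega>\<close> and that, for some pair of distinct labels, the action of \<open>K\<close> at one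
  of the two neighbours determines the action at the other. By 2-transitivity this holds for all pairs,
  so \<open>K\<close> acts as a diagonal subgroup of the product of the \<open>F\<^sub>\<omega>\<close>. A lift of an element of \<open>F\<^sub>\<omega>\<close> can be
  multiplied by an element of \<open>K\<close> so that it becomes trivial around \<open>b\<^sub>\<omega>\<close>, and then it commutes with \<open>K\<close>
  around \<open>b\<^sub>\<omega>\<close>, hence everywhere. As each element of \<open>F\<close> is a product of two elements of point stabilizers,
  the centralizer of \<open>K\<close> maps onto \<open>F\<close>; it meets \<open>K\<close> trivially because \<open>F\<^sub>\<omega>\<close> has trivial centre. The
  2-local actions therefore form a group \<open>\<Delta>(F)\<close> (\<open>D2_is_Delta\<close>).

  In both of these cases an automorphism that fixes a ball of radius two and agrees with elements of \<open>G\<close>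
  on all balls of radius two is trivial, so \<open>G\<close> is determined by its 2-local actions
  (\<open>rigid_two_closed\<close>).

  If no such pair exists, then Goursat's lemma shows that \<open>K\<close> maps onto the product of the \<open>F\<^sub>\<omega>\<close>. By
  induction on the radius the same holds for the subgroup fixing any ball and the local permutations on
  its sphere (\<open>full_Suc\<close>): in each step Goursat's lemma is applied first to the union of the balls around
  the two ends of an edge, and then to the ball of the next radius. Hence \<open>G\<close> contains all automorphisms
  with local permutations in \<open>F\<close> (\<open>full_contains\<close>).
\<close>

section \<open>Reduced words as vertices of a labelled regular tree\<close>

locale labelled_regular_tree =
  fixes T :: "'v pair_pre_digraph" and l :: "'v \<times> 'v \<Rightarrow> 'l" and \<Omega> :: "'l set" and d :: nat
  assumes fin: "finite \<Omega>" and card_labels: "card \<Omega> = d" and d3: "d \<ge> 3"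
    and tree: "regular_tree d T" and lab: "labelling T \<Omega> l"
begin

abbreviation V where "V \<equiv> pverts T"
abbreviation nb where "nb \<equiv> nbr T l"
abbreviation walk where "walk \<equiv> foldl nb"

sublocale pair_bidirected_digraph T
  using tree by (simp add: regular_tree_def)

lemma label_bij: "x \<in> V \<Longrightarrow> bij_betw l {e \<in> parcs T. fst e = x} \<Omega>"
  using lab unfolding labelling_def out_arcs_def by simp

lemma label_swap: "(x, y) \<in> parcs T \<Longrightarrow> l (y, x) = l (x, y)"
  using lab unfolding labelling_def by (metis swap_simp)

lemma label_in: "(x, y) \<in> parcs T \<Longrightarrow> l (x, y) \<in> \<Omega>"
  using label_bij[of x] in_arcsD1[of x y] by (auto simp: bij_betw_def)

lemma ex1_nb: assumes "x \<in> V" "\<omega> \<in> \<Omega>" shows "\<exists>!y. (x, y) \<in> parcs T \<and> l (x, y) = \<omega>"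
proof -
  have bij: "bij_betw l {e \<in> parcs T. fst e = x} \<Omega>" using assms label_bij by blast
  then obtain e where "e \<in> parcs T" "fst e = x" "l e = \<omega>"
    using assms(2) unfolding bij_betw_def by blast
  then have "(x, snd e) \<in> parcs T \<and> l (x, snd e) = \<omega>" by auto
  moreover have "y = y'" if "(x, y) \<in> parcs T \<and> l (x, y) = \<omega>" "(x, y') \<in> parcs T \<and> l (x, y') = \<omega>"
    for y y'
    using bij that unfolding bij_betw_def inj_on_def by force
  ultimately show ?thesis by blast
qed

lemma nb_arc: "x \<in> V \<Longrightarrow> \<omega> \<in> \<Omega> \<Longrightarrow> (x, nb x \<omega>) \<in> parcs T \<and> l (x, nb x \<omega>) = \<omega>"
  unfolding nbr_def using theI'[OF ex1_nb] by blast

lemma nb_label: "(x, y) \<in> parcs T \<Longrightarrow> nb x (l (x, y)) = y"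
  using ex1_nb[of x "l (x, y)"] nb_arc[of x "l (x,y)"] label_in in_arcsD1 by metis

lemma label_nb [simp]: "x \<in> V \<Longrightarrow> \<omega> \<in> \<Omega> \<Longrightarrow> l (x, nb x \<omega>) = \<omega>"
  using nb_arc by blast

lemma nb_in [simp]: "x \<in> V \<Longrightarrow> \<omega> \<in> \<Omega> \<Longrightarrow> nb x \<omega> \<in> V"
  using nb_arc in_arcsD2 by blast

lemma nb_nb [simp]: "x \<in> V \<Longrightarrow> \<omega> \<in> \<Omega> \<Longrightarrow> nb (nb x \<omega>) \<omega> = x"
  using nb_arc[of x \<omega>] label_swap[of x "nb x \<omega>"] nb_label[of "nb x \<omega>" x] arcs_symmetric by metis

lemma nb_inj: "nb x \<omega> = nb x \<omega>' \<Longrightarrow> x \<in> V \<Longrightarrow> \<omega> \<in> \<Omega> \<Longrightarrow> \<omega>' \<in> \<Omega> \<Longrightarrow> \<omega> = \<omega>'"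
  using label_nb by metis

lemma nb_ne [simp]: "x \<in> V \<Longrightarrow> \<omega> \<in> \<Omega> \<Longrightarrow> nb x \<omega> \<noteq> x"
  using nb_arc pair_no_loops by fastforce

lemma arc_iff: "(x, y) \<in> parcs T \<longleftrightarrow> x \<in> V \<and> (\<exists>\<omega>\<in>\<Omega>. y = nb x \<omega>)"
  by (metis in_arcsD1 label_in nb_arc nb_label)

lemma walk_in [simp]: "x \<in> V \<Longrightarrow> set w \<subseteq> \<Omega> \<Longrightarrow> walk x w \<in> V"
  by (induct w rule: rev_induct) auto

lemma walk_rev: "x \<in> V \<Longrightarrow> set w \<subseteq> \<Omega> \<Longrightarrow> walk (walk x w) (rev w) = x"
  by (induct w rule: rev_induct) auto

text \<open>
  Arc walks and words describe the same walks. Induced subgraphs are admitted because distances inside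
  balls are needed as well, and the visited vertices are recorded so that a closed walk without
  repetitions can be recognized as a cycle.
\<close>

lemma awalk_of_walk:
  assumes G: "W \<subseteq> V" and "x \<in> V" "set w \<subseteq> \<Omega>" "\<And>i. i \<le> length w \<Longrightarrow> walk x (take i w) \<in> W"
  shows "\<exists>p. pre_digraph.awalk (with_proj \<lparr>pverts = W, parcs = parcs T \<inter> W \<times> W\<rparr>) x p (walk x w) \<and>
             length p = length w \<and> map snd p = map (\<lambda>i. walk x (take (Suc i) w)) [0..<length w]"
  using assms(2-)
proof (induct w arbitrary: x)
  case Nil
  then show ?case by (auto simp: pre_digraph.awalk_def pre_digraph.cas.simps)
next
  case (Cons \<omega> w)
  let ?G = "with_proj \<lparr>pverts = W, parcs = parcs T \<inter> W \<times> W\<rparr>"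
  have x: "x \<in> W" "nb x \<omega> \<in> W" using Cons(4)[of 0] Cons(4)[of 1] by auto
  have "walk (nb x \<omega>) (take i w) \<in> W" if "i \<le> length w" for i using Cons(4)[of "Suc i"] that by simp
  then obtain p where p: "pre_digraph.awalk ?G (nb x \<omega>) p (walk (nb x \<omega>) w)" "length p = length w"
    "map snd p = map (\<lambda>i. walk (nb x \<omega>) (take (Suc i) w)) [0..<length w]"
    using Cons(1)[of "nb x \<omega>"] Cons(2,3) by auto
  have "pre_digraph.awalk ?G x ((x, nb x \<omega>) # p) (walk x (\<omega> # w))"
    using p(1) x Cons(2,3) nb_arc[of x \<omega>] by (auto simp: pre_digraph.awalk_def pre_digraph.cas.simps)
  moreover have "map snd ((x, nb x \<omega>) # p) = map (\<lambda>i. walk x (take (Suc i) (\<omega> # w))) [0..<length (\<omega> # w)]"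
    unfolding list.map p(3) by (simp add: map_upt_Suc del: upt_Suc)
  ultimately show ?case using p(2) by (metis length_Cons)
qed

lemma walk_of_awalk:
  assumes "pre_digraph.awalk (with_proj \<lparr>pverts = W, parcs = parcs T \<inter> W'\<rparr>) x p y" "W \<subseteq> V"
  shows "\<exists>w. set w \<subseteq> \<Omega> \<and> length w = length p \<and> walk x w = y"
  using assms
proof (induct p arbitrary: x)
  case Nil
  then show ?case by (auto simp: pre_digraph.awalk_def pre_digraph.cas.simps)
next
  case (Cons e p)
  from Cons(2) have e: "e \<in> parcs T" "fst e = x"
    and p: "set p \<subseteq> parcs T \<inter> W'" "pre_digraph.cas (with_proj \<lparr>pverts = W, parcs = parcs T \<inter> W'\<rparr>) (snd e) p y"
    by (auto simp: pre_digraph.awalk_def pre_digraph.cas.simps)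
  let ?H = "with_proj \<lparr>pverts = V, parcs = parcs T \<inter> W'\<rparr>"
  have "\<exists>w. set w \<subseteq> \<Omega> \<and> length w = length p \<and> walk z w = y"
    if "set p \<subseteq> parcs T" "z \<in> V" "pcas z p y" for z
    using that
  proof (induct p arbitrary: z)
    case Nil then show ?case by auto
  next
    case (Cons e p)
    then have "(z, snd e) \<in> parcs T" by (cases e) auto
    then obtain \<omega> where \<omega>: "\<omega> \<in> \<Omega>" "snd e = nb z \<omega>" "snd e \<in> V" using arc_iff in_arcsD2 by blast
    obtain w where "set w \<subseteq> \<Omega> \<and> length w = length p \<and> walk (snd e) w = y"
      using Cons \<omega> by fastforce
    then show ?case using \<omega> by (intro exI[of _ "\<omega> # w"]) auto
  qed
  from this[of "snd e"] p e obtain w where w: "set w \<subseteq> \<Omega> \<and> length w = length p \<and> walk (snd e) w = y"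
    using arc_snd_in_verts by (auto simp: cas_with_proj_eq)
  obtain \<omega> where "\<omega> \<in> \<Omega>" "snd e = nb x \<omega>" using e arc_iff[of x "snd e"] by (cases e) auto
  then show ?case using w by (intro exI[of _ "\<omega> # w"]) auto
qed

lemma no_long_cycle: "pre_digraph.cycle (with_proj T) p \<Longrightarrow> length p < 3"
  using tree unfolding regular_tree_def by (meson not_less)

text \<open>
  A nonempty closed reduced walk that is as short as possible visits its vertices only once, and having
  no backtracking it has length at least three, so it would be a circuit.
\<close>

lemma reduced_walk_not_closed:
  assumes "x \<in> V" "set w \<subseteq> \<Omega>" "distinct_adj w" "w \<noteq> []"
  shows "walk x w \<noteq> x"
  using assms
proof (induct w arbitrary: x rule: length_induct)
  case (1 w)
  let ?n = "length w" and ?f = "\<lambda>i. walk x (take (Suc i) w)"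
  show ?case
  proof
    assume closed: "walk x w = x"
    have inj: "inj_on ?f {0..<?n}"
    proof (rule linorder_inj_onI)
      fix i j assume ij: "i < j" "i \<in> {0..<?n}" "j \<in> {0..<?n}"
      let ?u = "drop (Suc i) (take (Suc j) w)"
      have eq: "take (Suc j) w = take (Suc i) w @ ?u"
        using ij by (metis Suc_le_mono append_take_drop_id less_imp_le_nat min.absorb1 take_take)
      have "distinct_adj (take (Suc j) w)" "set (take (Suc j) w) \<subseteq> \<Omega>"
        using 1(3,4) distinct_adj_appendD1[of "take (Suc j) w" "drop (Suc j) w"] set_take_subset[of "Suc j" w] by auto
      then have "distinct_adj ?u" "set ?u \<subseteq> \<Omega>"
        using distinct_adj_appendD2[of "take (Suc i) w" ?u] eq set_drop_subset[of "Suc i" "take (Suc j) w"] by auto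
      moreover have "length ?u < length w" "?u \<noteq> []" using ij by auto
      moreover have "?f i \<in> V" using 1(2,3) set_take_subset[of "Suc i" w] by (intro walk_in) auto
      ultimately have "walk (?f i) ?u \<noteq> ?f i" using 1(1) by blast
      moreover have "?f j = walk (?f i) ?u" by (metis eq foldl_append)
      ultimately show "?f i \<noteq> ?f j" by metis
    qed auto
    obtain p where p: "pre_digraph.awalk (with_proj T) x p (walk x w)" "length p = ?n"
      "map snd p = map ?f [0..<?n]"
    proof -
      have "parcs T \<inter> V \<times> V = parcs T" using in_arcsD1 in_arcsD2 by auto
      then have "\<lparr>pverts = V, parcs = parcs T \<inter> V \<times> V\<rparr> = T" by simp
      moreover have "walk x (take i w) \<in> V" for i using 1(2,3) set_take_subset[of i w] by (intro walk_in) auto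
      ultimately show ?thesis using that awalk_of_walk[of V x w] 1(2,3) by auto
    qed
    have "distinct (map snd p)" using inj unfolding p(3) by (simp add: distinct_map)
    moreover have "tl (awalk_verts x p) = map snd p"
      using p(1) awalk_verts_conv'[of x p x] closed by auto
    ultimately have "pre_digraph.cycle (with_proj T) p"
      unfolding pre_digraph.cycle_def using p 1(5) closed awalk_verts_with_proj_eq by (metis length_0_conv)
    then have "?n < 3" using no_long_cycle p(2) by metis
    moreover have "?n \<noteq> 0" using 1 by simp
    ultimately have "?n = 1 \<or> ?n = 2" by linarith
    then show False
    proof
      assume "?n = 1"
      then obtain \<omega> where "w = [\<omega>]" by (metis One_nat_def length_0_conv length_Suc_conv)
      then show False using closed 1 by auto
    next
      assume "?n = 2"
      then obtain \<omega> \<omega>' where w: "w = [\<omega>, \<omega>']" by (metis length_0_conv length_Suc_conv numeral_2_eq_2)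
      then have "nb (nb x \<omega>) \<omega>' = nb (nb x \<omega>) \<omega>" using closed 1 by auto
      then have "\<omega>' = \<omega>" using nb_inj[of "nb x \<omega>"] w 1 by (metis list.set_intros nb_in set_subset_Cons subsetD)
      then show False using w 1 by simp
    qed
  qed
qed

text \<open>
  Either the last steps of the two walks agree and can be removed, or the first walk followed by the
  reverse of the second is reduced and closed.
\<close>

lemma reduced_walk_inj:
  assumes "x \<in> V" "set w \<subseteq> \<Omega>" "distinct_adj w" "set w' \<subseteq> \<Omega>" "distinct_adj w'" "walk x w = walk x w'"
  shows "w = w'"
  using assms(2-)
proof (induct w arbitrary: w' rule: rev_induct)
  case Nil
  then show ?case using reduced_walk_not_closed[of x w'] assms(1) by auto
next
  case (snoc \<omega> w)
  show ?case
  proof (cases w' rule: rev_cases)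
    case Nil
    then show ?thesis using reduced_walk_not_closed[of x "w @ [\<omega>]"] assms(1) snoc by auto
  next
    case (snoc v \<omega>')
    note w' = this
    show ?thesis
    proof (cases "\<omega> = \<omega>'")
      case True
      have "nb (walk x w) \<omega> = nb (walk x v) \<omega>" using w' snoc.prems True by simp
      then have "walk x w = walk x v"
        using nb_nb[of "walk x w" \<omega>] nb_nb[of "walk x v" \<omega>] snoc.prems w' True assms(1) by auto
      then show ?thesis using snoc.hyps[of v] snoc.prems w' True by (auto simp: distinct_adj_append_iff)
    next
      case False
      let ?u = "(w @ [\<omega>]) @ rev w'"
      have "distinct_adj (rev w')" "hd (rev w') = \<omega>'" using snoc.prems w' by (simp_all only: distinct_adj_rev) simp
      then have "distinct_adj ?u" unfolding distinct_adj_append_iff[of "w @ [\<omega>]"]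
        using snoc.prems False by (metis last_snoc)
      moreover have "walk x ?u = x"
        unfolding foldl_append snoc.prems(5)[unfolded foldl_append] using walk_rev[of x w'] snoc.prems assms(1) by simp
      ultimately show ?thesis using reduced_walk_not_closed[of x ?u] assms(1) snoc.prems by auto
    qed
  qed
qed

definition words where "words = {w. set w \<subseteq> \<Omega> \<and> distinct_adj w}"

lemma words_Nil [simp]: "[] \<in> words" by (simp add: words_def)
lemma words_Cons: "\<omega> # w \<in> words \<longleftrightarrow> \<omega> \<in> \<Omega> \<and> w \<in> words \<and> (w = [] \<or> hd w \<noteq> \<omega>)"
  by (auto simp: words_def distinct_adj_Cons)
lemma words_snoc: "w @ [\<omega>] \<in> words \<longleftrightarrow> \<omega> \<in> \<Omega> \<and> w \<in> words \<and> (w = [] \<or> last w \<noteq> \<omega>)"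
  by (auto simp: words_def distinct_adj_append_iff)
lemma words_append:
  "u @ w \<in> words \<longleftrightarrow> u \<in> words \<and> w \<in> words \<and> (u = [] \<or> w = [] \<or> last u \<noteq> hd w)"
  by (auto simp: words_def distinct_adj_append_iff)
lemma words_subset: "w \<in> words \<Longrightarrow> set w \<subseteq> \<Omega>" by (simp add: words_def)
lemma words_take: "w \<in> words \<Longrightarrow> take i w \<in> words"
  using words_append[of "take i w" "drop i w"] by simp

text \<open>
  Free reduction does not depend on the base point; this is what makes label-preserving translations
  well defined.
\<close>

lemma reduce_walk:
  assumes "set w \<subseteq> \<Omega>"
  shows "\<exists>r\<in>words. length r \<le> length w \<and> (\<forall>x\<in>V. walk x w = walk x r)"
  using assms
proof (induct w rule: rev_induct)
  case Nil
  then show ?case by (intro bexI[of _ "[]"]) auto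
next
  case (snoc \<omega> w)
  then obtain r where r: "r \<in> words" "length r \<le> length w" "\<forall>x\<in>V. walk x w = walk x r" by auto
  show ?case
  proof (cases "r \<noteq> [] \<and> last r = \<omega>")
    case True
    then obtain u where u: "r = u @ [\<omega>]" by (metis append_butlast_last_id)
    then have "u \<in> words" using r words_append by blast
    moreover have "walk x (w @ [\<omega>]) = walk x u" if "x \<in> V" for x
      using that r u snoc.prems words_subset[OF \<open>u \<in> words\<close>] by simp
    ultimately show ?thesis using r u by (intro bexI[of _ u]) auto
  next
    case False
    then have "r @ [\<omega>] \<in> words" using r snoc.prems by (auto simp: words_snoc)
    then show ?thesis using r by (intro bexI[of _ "r @ [\<omega>]"]) auto
  qed
qed

lemma connected_walk:
  assumes "x \<in> V" "y \<in> V" shows "\<exists>w. set w \<subseteq> \<Omega> \<and> walk x w = y"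
proof -
  have "strongly_connected (with_proj (mk_symmetric (with_proj T)))"
    using tree unfolding regular_tree_def Digraph_Component.connected_def by auto
  moreover have "parcs (mk_symmetric (with_proj T)) = parcs T"
    using arcs_symmetric unfolding mk_symmetric_def by auto
  moreover have "pverts (mk_symmetric (with_proj T)) = V" unfolding mk_symmetric_def by simp
  ultimately have "reachable (with_proj T) x y"
    using assms unfolding strongly_connected_def reachable_def by simp
  then obtain p where "awalk x p y" using reachable_awalk by blast
  then have *: "pre_digraph.awalk (with_proj T) x p y" .
  have "T = \<lparr>pverts = V, parcs = parcs T \<inter> parcs T\<rparr>" by simp
  then show ?thesis using walk_of_awalk[of V "parcs T" x p y] * by (metis order_refl)
qed

lemma ex1_word: "x \<in> V \<Longrightarrow> y \<in> V \<Longrightarrow> \<exists>!w. w \<in> words \<and> walk x w = y"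
  using connected_walk[of x y] reduce_walk reduced_walk_inj[of x] unfolding words_def by fastforce

definition word where "word x y = (THE w. w \<in> words \<and> walk x w = y)"

lemma word_in [simp]: "x \<in> V \<Longrightarrow> y \<in> V \<Longrightarrow> word x y \<in> words"
  and walk_word [simp]: "x \<in> V \<Longrightarrow> y \<in> V \<Longrightarrow> walk x (word x y) = y"
  unfolding word_def using theI'[OF ex1_word] by blast+

lemma word_walk [simp]: "x \<in> V \<Longrightarrow> w \<in> words \<Longrightarrow> word x (walk x w) = w"
  using ex1_word[of x "walk x w"] word_in[of x "walk x w"] walk_word[of x "walk x w"] words_subset
  by (metis walk_in)

lemma walk_in' [simp]: "x \<in> V \<Longrightarrow> w \<in> words \<Longrightarrow> walk x w \<in> V"
  using words_subset walk_in by blast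

lemma word_eqI: "x \<in> V \<Longrightarrow> w \<in> words \<Longrightarrow> walk x w = y \<Longrightarrow> word x y = w"
  using word_walk by blast

lemma word_self [simp]: "x \<in> V \<Longrightarrow> word x x = []"
  by (rule word_eqI) auto

lemma word_Nil_iff: "x \<in> V \<Longrightarrow> y \<in> V \<Longrightarrow> word x y = [] \<longleftrightarrow> x = y"
  by (metis foldl_Nil walk_word word_self)

lemma word_subset: "x \<in> V \<Longrightarrow> y \<in> V \<Longrightarrow> set (word x y) \<subseteq> \<Omega>"
  using word_in words_subset by blast

lemma word_length_le: "x \<in> V \<Longrightarrow> set w \<subseteq> \<Omega> \<Longrightarrow> length (word x (walk x w)) \<le> length w"
  using reduce_walk[of w] word_walk by metis

lemma word_snoc:
  assumes "x \<in> V" "y \<in> V" "\<omega> \<in> \<Omega>"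
  shows "word x (nb y \<omega>) =
    (if word x y \<noteq> [] \<and> last (word x y) = \<omega> then butlast (word x y) else word x y @ [\<omega>])"
proof (cases "word x y \<noteq> [] \<and> last (word x y) = \<omega>")
  case True
  then obtain u where u: "word x y = u @ [\<omega>]" by (metis append_butlast_last_id)
  have uw: "u \<in> words" using u assms word_in words_append by metis
  have "walk x u = nb y \<omega>" using u walk_word[of x y] assms uw nb_nb[of "walk x u" \<omega>] by auto
  then show ?thesis using u uw assms by (auto intro: word_eqI)
next
  case False
  then have "word x y @ [\<omega>] \<in> words" using assms by (auto simp: words_snoc)
  moreover have "walk x (word x y @ [\<omega>]) = nb y \<omega>" using assms by simp
  ultimately have "word x (nb y \<omega>) = word x y @ [\<omega>]" using assms word_eqI by blast
  then show ?thesis using False by auto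
qed

lemma word_Cons:
  assumes "x \<in> V" "y \<in> V" "\<omega> \<in> \<Omega>"
  shows "word (nb x \<omega>) y =
    (if word x y \<noteq> [] \<and> hd (word x y) = \<omega> then tl (word x y) else \<omega> # word x y)"
proof (cases "word x y \<noteq> [] \<and> hd (word x y) = \<omega>")
  case True
  then obtain u where u: "word x y = \<omega> # u" by (metis list.collapse)
  then show ?thesis using assms word_in[of x y] walk_word[of x y]
    by (auto intro!: word_eqI simp: words_Cons)
next
  case False
  then have "\<omega> # word x y \<in> words" using assms by (auto simp: words_Cons)
  moreover have "walk (nb x \<omega>) (\<omega> # word x y) = y" using assms by simp
  ultimately have "word (nb x \<omega>) y = \<omega> # word x y" using assms word_eqI nb_in by blast
  then show ?thesis using False by auto
qed

lemma word_nb [simp]: "x \<in> V \<Longrightarrow> \<omega> \<in> \<Omega> \<Longrightarrow> word x (nb x \<omega>) = [\<omega>]"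
  by (simp add: word_snoc)

subsection \<open>Distances and balls\<close>

definition B where "B x k = {y \<in> V. length (word x y) \<le> k}"

text \<open>
  Reduced walks are geodesics: every walk between the same ends reduces to them and is at least as long.
\<close>

lemma graph_dist_induced:
  assumes "x \<in> V" "y \<in> V" "W \<subseteq> V" "\<And>i. walk x (take i (word x y)) \<in> W"
  shows "graph_dist \<lparr>pverts = W, parcs = parcs T \<inter> W \<times> W\<rparr> x y = length (word x y)"
  unfolding graph_dist_def
proof (rule Least_equality)
  show "\<exists>p. pre_digraph.awalk (with_proj \<lparr>pverts = W, parcs = parcs T \<inter> W \<times> W\<rparr>) x p y \<and> length p = length (word x y)"
    using awalk_of_walk[OF assms(3,1), of "word x y"] assms word_subset walk_word by metis
  show "length (word x y) \<le> n"
    if "\<exists>p. pre_digraph.awalk (with_proj \<lparr>pverts = W, parcs = parcs T \<inter> W \<times> W\<rparr>) x p y \<and> length p = n" for n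
    using that walk_of_awalk[OF _ assms(3)] word_length_le[OF assms(1)] by metis
qed

lemma induced_V: "\<lparr>pverts = V, parcs = parcs T \<inter> V \<times> V\<rparr> = T"
proof -
  have "parcs T \<inter> V \<times> V = parcs T" using in_arcsD1 in_arcsD2 by auto
  then show ?thesis by simp
qed

lemma graph_dist_eq: "x \<in> V \<Longrightarrow> y \<in> V \<Longrightarrow> graph_dist T x y = length (word x y)"
  using graph_dist_induced[of x y V] induced_V words_take by simp

lemma graph_ball_eq: "x \<in> V \<Longrightarrow> graph_ball T x k = \<lparr>pverts = B x k, parcs = parcs T \<inter> B x k \<times> B x k\<rparr>"
proof -
  assume "x \<in> V"
  then have "{y \<in> V. graph_dist T x y \<le> k} = B x k" unfolding B_def using graph_dist_eq by auto
  then show ?thesis unfolding graph_ball_def by (simp add: Let_def)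
qed

lemma pverts_ball [simp]: "x \<in> V \<Longrightarrow> pverts (graph_ball T x k) = B x k"
  by (simp add: graph_ball_eq)
lemma parcs_ball [simp]: "x \<in> V \<Longrightarrow> parcs (graph_ball T x k) = parcs T \<inter> B x k \<times> B x k"
  by (simp add: graph_ball_eq)

lemma B_V: "B x k \<subseteq> V" by (auto simp: B_def)
lemma B_inV: "y \<in> B x k \<Longrightarrow> y \<in> V" by (auto simp: B_def)
lemma B_self [simp]: "x \<in> V \<Longrightarrow> x \<in> B x k" by (auto simp: B_def)
lemma B_mono: "j \<le> k \<Longrightarrow> B x j \<subseteq> B x k" by (auto simp: B_def)

lemma walk_in_B: "x \<in> V \<Longrightarrow> set w \<subseteq> \<Omega> \<Longrightarrow> length w \<le> k \<Longrightarrow> walk x w \<in> B x k"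
  unfolding B_def using word_length_le[of x w] by auto

lemma B_nb: "x \<in> V \<Longrightarrow> y \<in> B x k \<Longrightarrow> \<omega> \<in> \<Omega> \<Longrightarrow> nb y \<omega> \<in> B x (Suc k)"
  unfolding B_def by (auto simp: word_snoc)

lemma B_nb_center: "x \<in> V \<Longrightarrow> \<omega> \<in> \<Omega> \<Longrightarrow> y \<in> B (nb x \<omega>) k \<Longrightarrow> y \<in> B x (Suc k)"
  unfolding B_def by (auto simp: word_Cons split: if_splits)

text \<open>The vertex set of the subtree \<open>T\<^sub>\<omega>\<close> of the ball of radius \<open>k\<close> around \<open>x\<close>.\<close>

definition E where "E x k \<omega> = B x k \<inter> B (nb x \<omega>) k"

lemma path_in_ball: "x \<in> V \<Longrightarrow> y \<in> B x k \<Longrightarrow> walk x (take i (word x y)) \<in> B x k"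
  using walk_in_B[of x "take i (word x y)" k] words_subset[OF words_take[of "word x y" i]] word_in[of x y]
  unfolding B_def by auto

text \<open>
  The geodesic from a neighbour of the centre either follows the geodesic from the centre or first steps
  back to the centre, so it stays in the ball. Hence distances measured inside the ball are those of the
  tree.
\<close>

lemma path_from_nb_in_ball:
  assumes "x \<in> V" "\<omega> \<in> \<Omega>" "k \<ge> 1" and y: "y \<in> B x k"
  shows "walk (nb x \<omega>) (take i (word (nb x \<omega>) y)) \<in> B x k"
proof (cases "word x y \<noteq> [] \<and> hd (word x y) = \<omega>")
  case True
  then obtain u where u: "word x y = \<omega> # u" by (metis list.collapse)
  have "walk (nb x \<omega>) (take i u) = walk x (take (Suc i) (word x y))" using u by simp
  then show ?thesis using u assms(1,2) word_Cons[of x y \<omega>] B_inV[OF y] path_in_ball[OF assms(1) y, of "Suc i"] by auto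
next
  case False
  then have w: "word (nb x \<omega>) y = \<omega> # word x y"
    using assms(1,2) B_inV[OF y] word_Cons[of x y \<omega>] by metis
  show ?thesis
  proof (cases i)
    case 0 then show ?thesis using assms walk_in_B[of x "[\<omega>]" k] by simp
  next
    case (Suc j)
    then have "walk (nb x \<omega>) (take i (word (nb x \<omega>) y)) = walk x (take j (word x y))"
      using w assms by simp
    then show ?thesis using path_in_ball[OF assms(1) y] by simp
  qed
qed

lemma edge_tree_eq:
  assumes "x \<in> V" "\<omega> \<in> \<Omega>" "k \<ge> 1"
  shows "edge_tree T l x k \<omega> = \<lparr>pverts = E x k \<omega>, parcs = parcs T \<inter> E x k \<omega> \<times> E x k \<omega>\<rparr>"
proof -
  have *: "graph_dist (graph_ball T x k) (nb x \<omega>) y = length (word (nb x \<omega>) y)" if y: "y \<in> B x k" for y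
    using graph_dist_induced[of "nb x \<omega>" y "B x k"] path_from_nb_in_ball[OF assms y] assms B_inV[OF y] B_V
    by (simp add: graph_ball_eq)
  have "{y \<in> B x k. graph_dist (graph_ball T x k) (nb x \<omega>) y \<le> k} = E x k \<omega>"
    unfolding E_def using * B_inV by (auto simp: B_def[of "nb x \<omega>"])
  then show ?thesis unfolding edge_tree_def graph_ball_def[of "graph_ball T x k"]
    using assms by (auto simp: Let_def E_def)
qed

end

section \<open>Automorphisms and their local permutations\<close>

lemma graph_isos_Bij: "f \<in> graph_isos G G \<Longrightarrow> f \<in> Bij (pverts G)"
  by (simp add: graph_isos_def Bij_def)

lemma group_Aut: "group (Aut G)"
proof -
  let ?S = "pverts G"
  interpret S: group "BijGroup ?S" by (rule group_BijGroup)
  have "subgroup (graph_isos G G) (BijGroup ?S)"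
  proof (rule S.subgroupI)
    show "graph_isos G G \<subseteq> carrier (BijGroup ?S)"
      using graph_isos_Bij by (auto simp: BijGroup_def)
    have "(\<lambda>x\<in>?S. x) \<in> graph_isos G G" by (auto simp: graph_isos_def bij_betw_def inj_on_def)
    then show "graph_isos G G \<noteq> {}" by blast
  next
    fix f assume f: "f \<in> graph_isos G G"
    then have B: "f \<in> Bij ?S" by (rule graph_isos_Bij)
    let ?g = "\<lambda>x\<in>?S. inv_into ?S f x"
    have g: "?g \<in> Bij ?S" using B restrict_inv_into_Bij by blast
    have eq: "f (?g x) = x" "?g x \<in> ?S" if "x \<in> ?S" for x
      using that B Bij_inv_into_mem[OF B that] by (auto simp: Bij_def bij_betw_def f_inv_into_f)
    have "(x, y) \<in> parcs G \<longleftrightarrow> (?g x, ?g y) \<in> parcs G" if "x \<in> ?S" "y \<in> ?S" for x y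
      using f eq[OF that(1)] eq[OF that(2)] unfolding graph_isos_def by auto
    then have "?g \<in> graph_isos G G" using g unfolding graph_isos_def Bij_def by blast
    then show "inv\<^bsub>BijGroup ?S\<^esub> f \<in> graph_isos G G" by (simp add: inv_BijGroup[OF B])
  next
    fix f g assume fg: "f \<in> graph_isos G G" "g \<in> graph_isos G G"
    then have B: "f \<in> Bij ?S" "g \<in> Bij ?S" by (auto dest: graph_isos_Bij)
    have "g x \<in> ?S" if "x \<in> ?S" for x using B(2) that by (auto simp: Bij_def bij_betw_def)
    then have "compose ?S f g \<in> graph_isos G G"
      using fg compose_Bij[OF B] unfolding graph_isos_def Bij_def by (auto simp: compose_eq)
    then show "f \<otimes>\<^bsub>BijGroup ?S\<^esub> g \<in> graph_isos G G" using B by (simp add: BijGroup_def)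
  qed
  then show ?thesis unfolding Aut_def by (rule S.subgroup_imp_group)
qed

lemma Aut_carrier: "carrier (Aut G) = graph_isos G G" by (simp add: Aut_def)

lemma Aut_mult:
  "f \<in> carrier (Aut G) \<Longrightarrow> g \<in> carrier (Aut G) \<Longrightarrow> f \<otimes>\<^bsub>Aut G\<^esub> g = compose (pverts G) f g"
  by (simp add: Aut_def BijGroup_def graph_isos_Bij)

lemma Aut_one: "\<one>\<^bsub>Aut G\<^esub> = (\<lambda>x\<in>pverts G. x)"
  by (simp add: Aut_def BijGroup_def)

lemma Bij_in: "f \<in> Bij S \<Longrightarrow> x \<in> S \<Longrightarrow> f x \<in> S"
  by (auto simp: Bij_def bij_betw_def)

lemma Bij_inj: "f \<in> Bij S \<Longrightarrow> x \<in> S \<Longrightarrow> y \<in> S \<Longrightarrow> f x = f y \<longleftrightarrow> x = y"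
  by (auto simp: Bij_def bij_betw_def inj_on_eq_iff)

lemma Bij_eqI: "f \<in> Bij S \<Longrightarrow> g \<in> Bij S \<Longrightarrow> (\<And>x. x \<in> S \<Longrightarrow> f x = g x) \<Longrightarrow> f = g"
  by (rule extensionalityI[of _ S]) (auto simp: Bij_def)

context labelled_regular_tree
begin

abbreviation A where "A \<equiv> Aut T"
abbreviation \<sigma> where "\<sigma> \<equiv> perm_at T l \<Omega>"
abbreviation P where "P \<equiv> BijGroup \<Omega>"
abbreviation idA where "idA \<equiv> \<one>\<^bsub>A\<^esub>"
abbreviation idP where "idP \<equiv> \<one>\<^bsub>P\<^esub>"
abbreviation A_mult (infixl "\<cdot>" 70) where "g \<cdot> h \<equiv> g \<otimes>\<^bsub>A\<^esub> h"
abbreviation P_mult (infixl "\<star>" 70) where "a \<star> c \<equiv> a \<otimes>\<^bsub>P\<^esub> c"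

sublocale A: group "Aut T" by (rule group_Aut)
sublocale P: group "BijGroup \<Omega>" by (rule group_BijGroup)

lemma carrier_P: "carrier P = Bij \<Omega>" by (simp add: BijGroup_def)
lemma P_one: "idP = (\<lambda>\<omega>\<in>\<Omega>. \<omega>)" by (simp add: BijGroup_def)
lemma P_mult_compose: "a \<in> carrier P \<Longrightarrow> c \<in> carrier P \<Longrightarrow> a \<star> c = compose \<Omega> a c"
  by (simp add: BijGroup_def)
lemma P_mult_apply [simp]:
  "a \<in> carrier P \<Longrightarrow> c \<in> carrier P \<Longrightarrow> \<omega> \<in> \<Omega> \<Longrightarrow> (a \<star> c) \<omega> = a (c \<omega>)"
  by (simp add: P_mult_compose compose_eq)
lemma P_one_apply [simp]: "\<omega> \<in> \<Omega> \<Longrightarrow> idP \<omega> = \<omega>" by (simp add: P_one)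
lemma P_in [simp]: "a \<in> carrier P \<Longrightarrow> \<omega> \<in> \<Omega> \<Longrightarrow> a \<omega> \<in> \<Omega>" by (simp add: carrier_P Bij_in)
lemma P_inj: "a \<in> carrier P \<Longrightarrow> \<omega> \<in> \<Omega> \<Longrightarrow> \<omega>' \<in> \<Omega> \<Longrightarrow> a \<omega> = a \<omega>' \<longleftrightarrow> \<omega> = \<omega>'"
  by (simp add: carrier_P Bij_inj)
lemma P_eqI: "a \<in> carrier P \<Longrightarrow> c \<in> carrier P \<Longrightarrow> (\<And>\<omega>. \<omega> \<in> \<Omega> \<Longrightarrow> a \<omega> = c \<omega>) \<Longrightarrow> a = c"
  by (simp add: carrier_P Bij_eqI)
lemma P_inv_apply [simp]: "a \<in> carrier P \<Longrightarrow> \<omega> \<in> \<Omega> \<Longrightarrow> (inv\<^bsub>P\<^esub> a) (a \<omega>) = \<omega>"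
  using P_mult_apply[of "inv\<^bsub>P\<^esub> a" a \<omega>] by simp
lemma P_apply_inv [simp]: "a \<in> carrier P \<Longrightarrow> \<omega> \<in> \<Omega> \<Longrightarrow> a ((inv\<^bsub>P\<^esub> a) \<omega>) = \<omega>"
  using P_mult_apply[of a "inv\<^bsub>P\<^esub> a" \<omega>] by simp

lemma aut_Bij: "g \<in> carrier A \<Longrightarrow> g \<in> Bij V" by (simp add: Aut_carrier graph_isos_Bij)
lemma aut_in [simp]: "g \<in> carrier A \<Longrightarrow> x \<in> V \<Longrightarrow> g x \<in> V" by (rule Bij_in[OF aut_Bij])
lemma aut_inj: "g \<in> carrier A \<Longrightarrow> x \<in> V \<Longrightarrow> y \<in> V \<Longrightarrow> g x = g y \<longleftrightarrow> x = y"
  using aut_Bij Bij_inj by metis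
lemma aut_eqI: "g \<in> carrier A \<Longrightarrow> h \<in> carrier A \<Longrightarrow> (\<And>x. x \<in> V \<Longrightarrow> g x = h x) \<Longrightarrow> g = h"
  using aut_Bij Bij_eqI by metis
lemma A_mult_apply [simp]: "g \<in> carrier A \<Longrightarrow> h \<in> carrier A \<Longrightarrow> x \<in> V \<Longrightarrow> (g \<cdot> h) x = g (h x)"
  by (simp add: Aut_mult compose_eq)
lemma A_one_apply [simp]: "x \<in> V \<Longrightarrow> idA x = x" by (simp add: Aut_one)
lemma A_inv_apply [simp]: "g \<in> carrier A \<Longrightarrow> x \<in> V \<Longrightarrow> (inv\<^bsub>A\<^esub> g) (g x) = x"
  using A_mult_apply[of "inv\<^bsub>A\<^esub> g" g x] by simp
lemma A_apply_inv [simp]: "g \<in> carrier A \<Longrightarrow> x \<in> V \<Longrightarrow> g ((inv\<^bsub>A\<^esub> g) x) = x"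
  using A_mult_apply[of g "inv\<^bsub>A\<^esub> g" x] by simp

lemma aut_arc: "g \<in> carrier A \<Longrightarrow> (x, y) \<in> parcs T \<Longrightarrow> (g x, g y) \<in> parcs T"
  unfolding Aut_carrier graph_isos_def using in_arcsD1 in_arcsD2 by blast

lemma sigma_in [simp]: "g \<in> carrier A \<Longrightarrow> x \<in> V \<Longrightarrow> \<omega> \<in> \<Omega> \<Longrightarrow> \<sigma> g x \<omega> \<in> \<Omega>"
  unfolding perm_at_def using aut_arc nb_arc label_in by auto

lemma aut_nb: "g \<in> carrier A \<Longrightarrow> x \<in> V \<Longrightarrow> \<omega> \<in> \<Omega> \<Longrightarrow> g (nb x \<omega>) = nb (g x) (\<sigma> g x \<omega>)"
  unfolding perm_at_def using aut_arc nb_arc nb_label by (metis restrict_apply')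

lemma sigma_P [simp]: "g \<in> carrier A \<Longrightarrow> x \<in> V \<Longrightarrow> \<sigma> g x \<in> carrier P"
proof -
  assume g: "g \<in> carrier A" "x \<in> V"
  have "inj_on (\<sigma> g x) \<Omega>"
  proof (rule inj_onI)
    fix \<omega> \<omega>' assume "\<omega> \<in> \<Omega>" "\<omega>' \<in> \<Omega>" "\<sigma> g x \<omega> = \<sigma> g x \<omega>'"
    then have "g (nb x \<omega>) = g (nb x \<omega>')" using g aut_nb by metis
    then show "\<omega> = \<omega>'" using aut_inj g nb_inj \<open>\<omega> \<in> \<Omega>\<close> \<open>\<omega>' \<in> \<Omega>\<close> nb_in by metis
  qed
  moreover have "\<sigma> g x ` \<Omega> \<subseteq> \<Omega>" using g sigma_in by auto
  ultimately have "bij_betw (\<sigma> g x) \<Omega> \<Omega>" using fin by (simp add: bij_betw_def endo_inj_surj)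
  then show ?thesis unfolding carrier_P Bij_def by (simp add: perm_at_def)
qed

lemma sigma_nb: "g \<in> carrier A \<Longrightarrow> x \<in> V \<Longrightarrow> \<omega> \<in> \<Omega> \<Longrightarrow> \<sigma> g (nb x \<omega>) \<omega> = \<sigma> g x \<omega>"
  using aut_arc[of g x "nb x \<omega>"] nb_arc[of x \<omega>] label_swap[of "g x" "g (nb x \<omega>)"]
  by (simp add: perm_at_def)

lemma sigma_mult:
  assumes "g \<in> carrier A" "h \<in> carrier A" "x \<in> V"
  shows "\<sigma> (g \<cdot> h) x = \<sigma> g (h x) \<star> \<sigma> h x"
proof (rule P_eqI)
  fix \<omega> assume "\<omega> \<in> \<Omega>"
  then have "nb (g (h x)) (\<sigma> (g \<cdot> h) x \<omega>) = nb (g (h x)) (\<sigma> g (h x) (\<sigma> h x \<omega>))"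
    using assms aut_nb[of "g \<cdot> h" x \<omega>] aut_nb[of h x \<omega>] aut_nb[of g "h x" "\<sigma> h x \<omega>"]
      A_mult_apply[of g h x] A_mult_apply[of g h "nb x \<omega>"] by (metis A.m_closed aut_in nb_in sigma_in)
  then show "\<sigma> (g \<cdot> h) x \<omega> = (\<sigma> g (h x) \<star> \<sigma> h x) \<omega>"
    using \<open>\<omega> \<in> \<Omega>\<close> assms nb_inj[of "g (h x)"] by simp
qed (use assms in auto)

lemma sigma_one: "x \<in> V \<Longrightarrow> \<sigma> idA x = idP"
  by (rule P_eqI[OF sigma_P]) (auto simp: perm_at_def)

lemma sigma_inv: "g \<in> carrier A \<Longrightarrow> x \<in> V \<Longrightarrow> \<sigma> (inv\<^bsub>A\<^esub> g) (g x) = inv\<^bsub>P\<^esub> (\<sigma> g x)"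
  using sigma_mult[of "inv\<^bsub>A\<^esub> g" g x] sigma_one[of x] by (simp add: P.inv_equality)

text \<open>
  A map that permutes labels locally has no backtracking, so it sends reduced walks to reduced walks.
\<close>

lemma local_perm_walk:
  assumes f: "\<And>x. x \<in> V \<Longrightarrow> f x \<in> V" and s: "\<And>x. x \<in> V \<Longrightarrow> s x \<in> carrier P"
    and fs: "\<And>x \<omega>. x \<in> V \<Longrightarrow> \<omega> \<in> \<Omega> \<Longrightarrow> f (nb x \<omega>) = nb (f x) (s x \<omega>)"
    and x: "x \<in> V" and w: "w \<in> words"
  shows "\<exists>w'\<in>words. length w' = length w \<and> f (walk x w) = walk (f x) w'"
proof -
  have inv_step: "s (nb x \<omega>) \<omega> = s x \<omega>" if "x \<in> V" "\<omega> \<in> \<Omega>" for x \<omega>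
  proof -
    have "nb (nb (f x) (s x \<omega>)) (s (nb x \<omega>) \<omega>) = nb (nb (f x) (s x \<omega>)) (s x \<omega>)"
      using fs[of "nb x \<omega>" \<omega>] fs[of x \<omega>] that f s by simp
    then show ?thesis using nb_inj[of "nb (f x) (s x \<omega>)"] that f s nb_in P_in by blast
  qed
  have "\<exists>w'\<in>words. length w' = length w \<and> f (walk x w) = walk (f x) w' \<and>
           (w \<noteq> [] \<longrightarrow> last w' = s (walk x w) (last w))"
    using w
  proof (induct w rule: rev_induct)
    case Nil
    then show ?case by (intro bexI[of _ "[]"]) auto
  next
    case (snoc \<omega> w)
    then have w: "w \<in> words" "\<omega> \<in> \<Omega>" "w = [] \<or> last w \<noteq> \<omega>" by (auto simp: words_snoc)
    then obtain w' where w': "w' \<in> words" "length w' = length w" "f (walk x w) = walk (f x) w'"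
      "w \<noteq> [] \<longrightarrow> last w' = s (walk x w) (last w)" using snoc by blast
    let ?w = "w' @ [s (walk x w) \<omega>]"
    have v: "walk x w \<in> V" using w x by simp
    have "last w \<in> \<Omega>" if "w \<noteq> []" using that w(1) words_subset last_in_set by blast
    then have "w' = [] \<or> last w' \<noteq> s (walk x w) \<omega>"
      using w w'(2,4) P_inj[OF s[OF v]] by (cases "w = []") auto
    then have "?w \<in> words" using w' w s[OF v] by (simp add: words_snoc)
    moreover have "f (walk x (w @ [\<omega>])) = walk (f x) ?w" using fs v w w' by simp
    moreover have "last ?w = s (walk x (w @ [\<omega>])) \<omega>" using inv_step v w by simp
    ultimately show ?case using w' by (intro bexI[of _ ?w]) auto
  qed
  then show ?thesis by blast
qed

text \<open>
  Local permutations suffice for being an automorphism: nonempty reduced walks have nonempty reduced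
  images, which gives injectivity, and by connectedness local surjectivity implies surjectivity.
\<close>

lemma autI:
  assumes f: "\<And>x. x \<in> V \<Longrightarrow> f x \<in> V" and s: "\<And>x. x \<in> V \<Longrightarrow> s x \<in> carrier P"
    and fs: "\<And>x \<omega>. x \<in> V \<Longrightarrow> \<omega> \<in> \<Omega> \<Longrightarrow> f (nb x \<omega>) = nb (f x) (s x \<omega>)"
    and ext: "f \<in> extensional V"
  shows "f \<in> carrier A" and "\<And>x. x \<in> V \<Longrightarrow> \<sigma> f x = s x"
proof -
  have inj: "inj_on f V"
  proof (rule inj_onI, rule ccontr)
    fix x y assume xy: "x \<in> V" "y \<in> V" "f x = f y" "x \<noteq> y"
    then obtain w' where w': "w' \<in> words" "length w' = length (word x y)" "f y = walk (f x) w'"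
      using local_perm_walk[OF f s fs, of x "word x y"] by auto
    then have "w' = []" using word_eqI[of "f x" w' "f y"] word_self[of "f x"] f xy by auto
    then show False using w' xy word_Nil_iff by auto
  qed
  have surj: "f ` V = V"
  proof (cases "V = {}")
    case False
    then obtain b where b: "b \<in> V" by blast
    have "walk (f b) w \<in> f ` V" if "w \<in> words" for w
      using that
    proof (induct w rule: rev_induct)
      case (snoc \<omega> w)
      then obtain x where x: "x \<in> V" "walk (f b) w = f x" by (auto simp: words_snoc)
      have "\<omega> \<in> \<Omega>" using snoc by (simp add: words_snoc)
      then have "\<omega> = s x ((inv\<^bsub>P\<^esub> (s x)) \<omega>)" "(inv\<^bsub>P\<^esub> (s x)) \<omega> \<in> \<Omega>"
        using s[OF x(1)] by (auto simp del: P_in intro: P_in)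
      then have "walk (f b) (w @ [\<omega>]) = f (nb x ((inv\<^bsub>P\<^esub> (s x)) \<omega>))" using fs x by simp
      then show ?case using x \<open>(inv\<^bsub>P\<^esub> (s x)) \<omega> \<in> \<Omega>\<close> by (metis imageI nb_in)
    qed (use b in auto)
    then have "V \<subseteq> f ` V" using walk_word[of "f b"] word_in[of "f b"] f b by (metis subsetI)
    then show ?thesis using f by (intro equalityI image_subsetI)
  qed auto
  have "(x, y) \<in> parcs T \<longleftrightarrow> (f x, f y) \<in> parcs T" if xy: "x \<in> V" "y \<in> V" for x y
  proof
    assume "(x, y) \<in> parcs T"
    then show "(f x, f y) \<in> parcs T" unfolding arc_iff using fs f xy s P_in by blast
  next
    assume "(f x, f y) \<in> parcs T"
    then obtain \<omega> where \<omega>: "\<omega> \<in> \<Omega>" "f y = nb (f x) \<omega>" unfolding arc_iff by blast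
    then have "f y = f (nb x ((inv\<^bsub>P\<^esub> (s x)) \<omega>))" "(inv\<^bsub>P\<^esub> (s x)) \<omega> \<in> \<Omega>"
      using fs[of x "(inv\<^bsub>P\<^esub> (s x)) \<omega>"] s[OF xy(1)] xy by auto
    then show "(x, y) \<in> parcs T" using inj xy unfolding arc_iff by (metis inj_onD nb_in)
  qed
  then show *: "f \<in> carrier A"
    unfolding Aut_carrier graph_isos_def using inj surj ext by (auto simp: bij_betw_def)
  fix x assume x: "x \<in> V"
  show "\<sigma> f x = s x"
    by (rule P_eqI[OF sigma_P[OF * x] s[OF x]]) (use x s f fs in \<open>auto simp: perm_at_def\<close>)
qed

lemma length_word_aut:
  assumes "g \<in> carrier A" "x \<in> V" "y \<in> V"
  shows "length (word (g x) (g y)) = length (word x y)"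
proof -
  obtain w' where "w' \<in> words" "length w' = length (word x y)" "g y = walk (g x) w'"
    using local_perm_walk[of g "\<sigma> g" x "word x y"] assms aut_nb by auto
  then show ?thesis using assms by simp
qed

lemma aut_B: "g \<in> carrier A \<Longrightarrow> x \<in> V \<Longrightarrow> y \<in> V \<Longrightarrow> g y \<in> B (g x) k \<longleftrightarrow> y \<in> B x k"
  by (simp add: B_def length_word_aut)

lemma aut_B_fix: "g \<in> carrier A \<Longrightarrow> x \<in> V \<Longrightarrow> g x = x \<Longrightarrow> y \<in> V \<Longrightarrow> g y \<in> B x k \<longleftrightarrow> y \<in> B x k"
  using aut_B[of g x y k] by simp

lemma agree_sigma:
  assumes "x \<in> V" "\<And>y. y \<in> B x (Suc k) \<Longrightarrow> g y = h y" "y \<in> B x k"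
  shows "\<sigma> g y = \<sigma> h y"
  unfolding perm_at_def using assms B_nb[of x y k] B_mono[of k "Suc k" x] by (intro restrict_ext) auto

text \<open>
  The image of a walk is computed step by step from the image of its origin and the local permutations
  along it.
\<close>

lemma agree_extend:
  assumes "g \<in> carrier A" "h \<in> carrier A" "x \<in> V" "g x = h x"
    and \<sigma>: "\<And>y. y \<in> B x k \<Longrightarrow> \<sigma> g y = \<sigma> h y" and y: "y \<in> B x (Suc k)"
  shows "g y = h y"
proof -
  have "g (walk x w) = h (walk x w)" if "w \<in> words" "length w \<le> Suc k" for w
    using that
  proof (induct w rule: rev_induct)
    case (snoc \<omega> w)
    then have "w \<in> words" "\<omega> \<in> \<Omega>" "length w \<le> k" by (auto simp: words_snoc)
    moreover then have "walk x w \<in> B x k" using assms(3) words_subset by (intro walk_in_B) auto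
    ultimately show ?case using snoc \<sigma> assms by (simp add: aut_nb)
  qed (use assms in auto)
  from this[of "word x y"] show ?thesis using y assms(3) unfolding B_def by simp
qed

lemma fix_sigma: "x \<in> V \<Longrightarrow> \<omega> \<in> \<Omega> \<Longrightarrow> g x = x \<Longrightarrow> g (nb x \<omega>) = nb x \<omega> \<Longrightarrow> \<sigma> g x \<omega> = \<omega>"
  by (simp add: perm_at_def)

section \<open>Label-preserving translations\<close>

text \<open>
  The tree is a Cayley graph of a free product of groups of order two, one for each label; these are its
  left translations.
\<close>

definition tr where "tr x y = (\<lambda>v\<in>V. walk y (word x v))"

lemma tr_walk: "x \<in> V \<Longrightarrow> y \<in> V \<Longrightarrow> set w \<subseteq> \<Omega> \<Longrightarrow> tr x y (walk x w) = walk y w"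
proof -
  assume x: "x \<in> V" "y \<in> V" "set w \<subseteq> \<Omega>"
  obtain r where r: "r \<in> words" "\<forall>x\<in>V. walk x w = walk x r" using reduce_walk[OF x(3)] by blast
  then show ?thesis using x by (simp add: tr_def)
qed

lemma tr_in [simp]: "x \<in> V \<Longrightarrow> y \<in> V \<Longrightarrow> v \<in> V \<Longrightarrow> tr x y v \<in> V"
  by (simp add: tr_def)

lemma tr_nb [simp]:
  assumes "x \<in> V" "y \<in> V" "v \<in> V" "\<omega> \<in> \<Omega>"
  shows "tr x y (nb v \<omega>) = nb (tr x y v) \<omega>"
  using tr_walk[of x y "word x v @ [\<omega>]"] assms word_subset[of x v] by (simp add: tr_def)

lemma tr_base [simp]: "x \<in> V \<Longrightarrow> y \<in> V \<Longrightarrow> tr x y x = y"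
  by (simp add: tr_def)

lemma
  assumes "x \<in> V" "y \<in> V"
  shows tr_aut [simp]: "tr x y \<in> carrier A"
    and sigma_tr [simp]: "v \<in> V \<Longrightarrow> \<sigma> (tr x y) v = idP"
proof -
  have "tr x y \<in> extensional V" by (simp add: tr_def)
  then show "tr x y \<in> carrier A" "v \<in> V \<Longrightarrow> \<sigma> (tr x y) v = idP"
    using autI[of "tr x y" "\<lambda>_. idP"] assms by auto
qed

lemma tr_walk_gen:
  assumes "x \<in> V" "y \<in> V" "v \<in> V" "set w \<subseteq> \<Omega>"
  shows "tr x y (walk v w) = walk (tr x y v) w"
  using assms(4) by (induct w rule: rev_induct) (use assms in auto)

lemma tr_unique:
  assumes "x \<in> V" "f x \<in> V" "\<And>v \<omega>. v \<in> V \<Longrightarrow> \<omega> \<in> \<Omega> \<Longrightarrow> f (nb v \<omega>) = nb (f v) \<omega>" "v \<in> V"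
  shows "f v = tr x (f x) v"
proof -
  have "f (walk x w) = walk (f x) w" if "set w \<subseteq> \<Omega>" for w
    using that by (induct w rule: rev_induct) (use assms in auto)
  from this[OF word_subset[OF assms(1,4)]] show ?thesis using assms by (simp add: tr_def)
qed

lemma tr_tr [simp]: "x \<in> V \<Longrightarrow> y \<in> V \<Longrightarrow> z \<in> V \<Longrightarrow> v \<in> V \<Longrightarrow> tr y z (tr x y v) = tr x z v"
  using tr_unique[of x "\<lambda>v. tr y z (tr x y v)" v] by simp

lemma tr_self [simp]: "x \<in> V \<Longrightarrow> v \<in> V \<Longrightarrow> tr x x v = v"
  by (simp add: tr_def)

lemma tr_change_base: "x \<in> V \<Longrightarrow> y \<in> V \<Longrightarrow> z \<in> V \<Longrightarrow> v \<in> V \<Longrightarrow> tr z (tr x y z) v = tr x y v"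
  using tr_unique[of z "tr x y" v] by simp

lemma word_tr: "x \<in> V \<Longrightarrow> y \<in> V \<Longrightarrow> u \<in> V \<Longrightarrow> v \<in> V \<Longrightarrow> word (tr x y u) (tr x y v) = word u v"
  using tr_walk_gen[of x y u "word u v"] by (intro word_eqI) (auto simp: word_subset)

lemma tr_B: "x \<in> V \<Longrightarrow> y \<in> V \<Longrightarrow> v \<in> V \<Longrightarrow> tr x y v \<in> B y k \<longleftrightarrow> v \<in> B x k"
  using word_tr[of x y x v] by (simp add: B_def)

text \<open>The generators of the free product have order two.\<close>

lemma tr_flip [simp]: "x \<in> V \<Longrightarrow> \<omega> \<in> \<Omega> \<Longrightarrow> v \<in> V \<Longrightarrow> tr x (nb x \<omega>) (tr x (nb x \<omega>) v) = v"
  using tr_change_base[of x "nb x \<omega>" "nb x \<omega>" "tr x (nb x \<omega>) v"] tr_tr[of x "nb x \<omega>" x v] by simp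

lemma exists_label: "\<exists>\<omega>\<in>\<Omega>. \<omega> \<noteq> a \<and> \<omega> \<noteq> c"
proof (rule ccontr)
  assume "\<not> ?thesis"
  then have "\<Omega> \<subseteq> {a, c}" by blast
  then have "card \<Omega> \<le> card {a, c}" by (intro card_mono) auto
  also have "\<dots> \<le> 2" by (simp add: card_insert_if)
  finally show False using d3 card_labels by simp
qed

text \<open>
  A path can be prolonged without backtracking by any number of steps; this shows that certain maps
  would leave a ball.
\<close>

lemma exists_word: "\<exists>w\<in>words. length w = n \<and> (w = [] \<or> hd w \<noteq> a)"
proof (induct n arbitrary: a)
  case 0 then show ?case by (intro bexI[of _ "[]"]) auto
next
  case (Suc n)
  obtain \<omega> where \<omega>: "\<omega> \<in> \<Omega>" "\<omega> \<noteq> a" using exists_label by blast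
  obtain w where "w \<in> words" "length w = n" "w = [] \<or> hd w \<noteq> \<omega>" using Suc by blast
  then show ?case using \<omega> by (intro bexI[of _ "\<omega> # w"]) (auto simp: words_Cons)
qed

end

section \<open>Local actions and edge flips as restricted translations\<close>

context labelled_regular_tree
begin

abbreviation ind where "ind W \<equiv> \<lparr>pverts = W, parcs = parcs T \<inter> W \<times> W\<rparr>"

lemma restrict_tr_label_iso:
  assumes "x \<in> V" "y \<in> V" "W \<subseteq> V" "W' \<subseteq> V" and inv: "\<And>v. v \<in> V \<Longrightarrow> tr x y v \<in> W' \<longleftrightarrow> v \<in> W"
  shows "restrict (tr x y) W \<in> label_isos l (ind W) (ind W')"
proof -
  have t: "tr x y \<in> graph_isos T T" using assms tr_aut Aut_carrier by metis
  have "inj_on (tr x y) W" using t assms(3) unfolding graph_isos_def bij_betw_def by (auto intro: inj_on_subset)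
  moreover have "tr x y ` W = W'"
  proof (intro equalityI subsetI)
    fix v assume v: "v \<in> W'"
    then have "v \<in> V" using assms by blast
    then have "tr x y (tr y x v) = v" "tr y x v \<in> V" using assms by auto
    then show "v \<in> tr x y ` W" using inv v by (metis imageI)
  next
    fix v assume "v \<in> tr x y ` W"
    then show "v \<in> W'" using inv assms(3) by blast
  qed
  ultimately have bij: "bij_betw (restrict (tr x y) W) W W'" by (simp add: bij_betw_def inj_on_restrict_eq)
  have "(u, v) \<in> parcs T \<inter> W \<times> W \<longleftrightarrow> (tr x y u, tr x y v) \<in> parcs T \<inter> W' \<times> W'" if "u \<in> W" "v \<in> W" for u v
  proof -
    have uv: "u \<in> V" "v \<in> V" using that assms(3) by auto
    have "\<forall>u\<in>V. \<forall>v\<in>V. (u, v) \<in> parcs T \<longleftrightarrow> (tr x y u, tr x y v) \<in> parcs T"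
      using t unfolding graph_isos_def by simp
    moreover have "tr x y u \<in> W'" "tr x y v \<in> W'" using inv[OF uv(1)] inv[OF uv(2)] that by auto
    ultimately show ?thesis using that uv by simp
  qed
  moreover have "l (tr x y u, tr x y v) = l (u, v)" if "(u, v) \<in> parcs T" "u \<in> W" "v \<in> W" for u v
  proof -
    obtain \<omega> where "\<omega> \<in> \<Omega>" "v = nb u \<omega>" "u \<in> V" using \<open>(u, v) \<in> parcs T\<close> unfolding arc_iff by blast
    then show ?thesis using assms by simp
  qed
  ultimately show ?thesis using bij unfolding label_isos_def graph_isos_def by auto
qed

text \<open>
  A label-preserving map follows paths label by label. If the subgraph contains the paths from \<open>x\<close>, the
  map is therefore the translation given by the image of \<open>x\<close>.
\<close>

lemma label_iso_is_tr:
  assumes x: "x \<in> W" and W: "W \<subseteq> V" "W' \<subseteq> V"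
    and path: "\<And>i. walk x (take i (word x y)) \<in> W"
    and f: "f \<in> label_isos l (ind W) (ind W')" and y: "y \<in> W"
  shows "f y = tr x (f x) y"
proof -
  have fW: "f v \<in> W'" if "v \<in> W" for v
    using f that unfolding label_isos_def graph_isos_def by (auto simp: bij_betw_def)
  let ?w = "word x y"
  have "f (walk x (take i ?w)) = walk (f x) (take i ?w)" if "i \<le> length ?w" for i
    using that
  proof (induct i)
    case (Suc i)
    let ?v = "walk x (take i ?w)"
    have \<omega>: "?w ! i \<in> \<Omega>" using Suc(2) x y W word_subset[of x y] nth_mem[of i ?w] by (meson Suc_le_lessD subsetD)
    have step: "take (Suc i) ?w = take i ?w @ [?w ! i]" using Suc(2) by (simp add: take_Suc_conv_app_nth)
    have v: "?v \<in> W" "nb ?v (?w ! i) \<in> W" "?v \<in> V" using path[of i] path[of "Suc i"] step W by auto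
    then have arc: "(?v, nb ?v (?w ! i)) \<in> parcs (ind W)" using \<omega> nb_arc by auto
    then have "(f ?v, f (nb ?v (?w ! i))) \<in> parcs T" "l (f ?v, f (nb ?v (?w ! i))) = ?w ! i"
      using f v \<omega> unfolding label_isos_def graph_isos_def by auto
    then have "f (nb ?v (?w ! i)) = nb (f ?v) (?w ! i)" using nb_label by metis
    then show ?case using Suc step by simp
  qed simp
  from this[of "length ?w"] show ?thesis using x y W by (auto simp: tr_def)
qed

text \<open>
  A label-preserving map between balls that moved the centre off centre would send some path from the
  centre to the rim out of the ball.
\<close>

lemma ball_label_iso_eq:
  assumes "x \<in> V" "b \<in> V"
  shows "ball_label_iso T l b k x = restrict (tr x b) (B x k)"
  unfolding ball_label_iso_def
proof (rule the_equality)
  show "restrict (tr x b) (B x k) \<in> label_isos l (graph_ball T x k) (graph_ball T b k)"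
    using restrict_tr_label_iso[of x b "B x k" "B b k"] assms B_V tr_B by (simp add: graph_ball_eq)
next
  fix f assume "f \<in> label_isos l (graph_ball T x k) (graph_ball T b k)"
  then have f: "f \<in> label_isos l (ind (B x k)) (ind (B b k))" using assms by (simp add: graph_ball_eq)
  have fB: "f v \<in> B b k" if "v \<in> B x k" for v
    using f that unfolding label_isos_def graph_isos_def by (auto simp: bij_betw_def)
  have ft: "f y = tr x (f x) y" if "y \<in> B x k" for y
    using label_iso_is_tr[OF _ B_V B_V _ f that] path_in_ball[OF assms(1) that] assms by simp
  have fx: "f x \<in> V" using fB[of x] assms B_inV by auto
  have "f x = b"
  proof (rule ccontr)
    let ?u = "word b (f x)"
    assume "f x \<noteq> b"
    then have u: "?u \<noteq> []" "?u \<in> words" using word_Nil_iff assms fx by auto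
    obtain w where w: "w \<in> words" "length w = k" "w = [] \<or> hd w \<noteq> last ?u" using exists_word by blast
    have y: "walk x w \<in> B x k" using w assms words_subset walk_in_B by simp
    then have "f (walk x w) = walk (f x) w"
      using ft[OF y] tr_walk[OF assms(1) fx words_subset[OF w(1)]] by simp
    then have "f (walk x w) = walk b (?u @ w)" using fx assms by simp
    moreover have "?u @ w \<in> words" using u w by (auto simp: words_append)
    ultimately have "word b (f (walk x w)) = ?u @ w" using assms by (simp del: foldl_append)
    then show False using fB[OF y] u w unfolding B_def by auto
  qed
  then show "f = restrict (tr x b) (B x k)"
    using ft f unfolding label_isos_def graph_isos_def by (intro extensionalityI[of _ "B x k"]) auto
qed

text \<open>
  The automorphism \<open>g\<close> as it is seen at \<open>x\<close>, moved by translations so that it fixes \<open>b\<close>. Its restriction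
  to the ball of radius \<open>k\<close> around \<open>b\<close> is the \<open>k\<close>-local action of \<open>g\<close> at \<open>x\<close>.
\<close>

definition locaut where "locaut b g x = tr (g x) b \<cdot> (g \<cdot> tr b x)"

lemma locaut_aut [simp]: "b \<in> V \<Longrightarrow> g \<in> carrier A \<Longrightarrow> x \<in> V \<Longrightarrow> locaut b g x \<in> carrier A"
  by (simp add: locaut_def)

lemma locaut_apply:
  "b \<in> V \<Longrightarrow> g \<in> carrier A \<Longrightarrow> x \<in> V \<Longrightarrow> v \<in> V \<Longrightarrow> locaut b g x v = tr (g x) b (g (tr b x v))"
  by (simp add: locaut_def)

lemma locaut_base [simp]: "b \<in> V \<Longrightarrow> g \<in> carrier A \<Longrightarrow> x \<in> V \<Longrightarrow> locaut b g x b = b"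
  by (simp add: locaut_apply)

lemma sigma_locaut:
  "b \<in> V \<Longrightarrow> g \<in> carrier A \<Longrightarrow> x \<in> V \<Longrightarrow> v \<in> V \<Longrightarrow> \<sigma> (locaut b g x) v = \<sigma> g (tr b x v)"
  by (simp add: locaut_def sigma_mult)

lemma local_action_eq:
  assumes "x \<in> V" "b \<in> V" "g \<in> carrier A"
  shows "local_action T l b k g x = restrict (locaut b g x) (B b k)"
proof -
  have "ball_label_iso T l b k (g x) (g (inv_into (B x k) (ball_label_iso T l b k x) y)) = locaut b g x y"
    if y: "y \<in> B b k" for y
  proof -
    have yV: "y \<in> V" using y B_inV by blast
    have y': "tr b x y \<in> B x k" using y yV assms tr_B by simp
    have "inj_on (restrict (tr x b) (B x k)) (B x k)"
      using aut_inj[of "tr x b"] assms B_inV by (auto simp: inj_on_def)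
    moreover have "restrict (tr x b) (B x k) (tr b x y) = y" using y' assms yV by simp
    ultimately have "inv_into (B x k) (restrict (tr x b) (B x k)) y = tr b x y"
      using inv_into_f_eq y' by metis
    moreover have "g (tr b x y) \<in> B (g x) k" using aut_B assms y' B_inV by blast
    ultimately show ?thesis using assms yV by (simp add: ball_label_iso_eq locaut_apply)
  qed
  then show ?thesis unfolding local_action_def using assms by (auto intro!: restrict_ext)
qed

lemma univ_group_iff:
  "b \<in> V \<Longrightarrow> g \<in> univ_group T l b k S \<longleftrightarrow> g \<in> carrier A \<and> (\<forall>x\<in>V. restrict (locaut b g x) (B b k) \<in> S)"
  unfolding univ_group_def using local_action_eq by auto

lemma E_V: "E x k \<omega> \<subseteq> V" by (auto simp: E_def B_def)

lemma E_flip: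
  assumes "x \<in> V" "\<omega> \<in> \<Omega>" "v \<in> V" shows "tr x (nb x \<omega>) v \<in> E x k \<omega> \<longleftrightarrow> v \<in> E x k \<omega>"
  using word_tr[of x "nb x \<omega>" x v] word_tr[of x "nb x \<omega>" "nb x \<omega>" v] assms by (auto simp: E_def B_def)

lemma path_in_E: "x \<in> V \<Longrightarrow> \<omega> \<in> \<Omega> \<Longrightarrow> y \<in> E x k \<omega> \<Longrightarrow> walk x (take i (word x y)) \<in> E x k \<omega>"
proof -
  assume x: "x \<in> V" "\<omega> \<in> \<Omega>" "y \<in> E x k \<omega>"
  then have yV: "y \<in> V" by (auto simp: E_def B_def)
  define p where "p = take i (word x y)"
  have p: "p \<in> words" using yV x words_take by (simp add: p_def)
  have V: "walk x p \<in> V" and wp: "word x (walk x p) = p" using p x by auto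
  have len: "length p \<le> length (word x y)" and hd: "p \<noteq> [] \<Longrightarrow> word x y \<noteq> [] \<and> hd (word x y) = hd p"
    by (auto simp: p_def hd_take)
  have "length (word x y) \<le> k"
    "length (if word x y \<noteq> [] \<and> hd (word x y) = \<omega> then tl (word x y) else \<omega> # word x y) \<le> k"
    using x yV word_Cons[of x y \<omega>] by (auto simp: E_def B_def)
  then have "length p \<le> k" "length (if p \<noteq> [] \<and> hd p = \<omega> then tl p else \<omega> # p) \<le> k"
    using len hd by (cases "word x y"; cases "p = []"; auto split: if_splits)+
  then show ?thesis using V wp x word_Cons[of x "walk x p" \<omega>] unfolding p_def[symmetric] E_def B_def by auto
qed

lemma edge_flip_eq:
  assumes "b \<in> V" "\<omega> \<in> \<Omega>" "k \<ge> 1"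
  shows "edge_flip T l b k \<omega> = restrict (tr b (nb b \<omega>)) (E b k \<omega>)"
proof -
  let ?E = "E b k \<omega>"
  have bE: "b \<in> ?E" using assms by (auto simp: E_def B_def word_Cons)
  show ?thesis
    unfolding edge_flip_def edge_tree_eq[OF assms] pair_pre_digraph.select_convs
  proof (rule the_equality)
    have "restrict (tr b (nb b \<omega>)) ?E \<in> label_isos l (ind ?E) (ind ?E)"
      using restrict_tr_label_iso[of b "nb b \<omega>" ?E ?E] assms E_V E_flip by simp
    moreover have "restrict (tr b (nb b \<omega>)) ?E b \<noteq> (\<lambda>x\<in>?E. x) b" using bE assms by simp
    ultimately show "restrict (tr b (nb b \<omega>)) ?E \<in> label_isos l (ind ?E) (ind ?E) \<and>
        restrict (tr b (nb b \<omega>)) ?E \<noteq> (\<lambda>x\<in>?E. x)" by metis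
  next
    fix f assume *: "f \<in> label_isos l (ind ?E) (ind ?E) \<and> f \<noteq> (\<lambda>x\<in>?E. x)"
    then have f: "f \<in> label_isos l (ind ?E) (ind ?E)" by blast
    have fE: "f v \<in> ?E" if "v \<in> ?E" for v
      using f that unfolding label_isos_def graph_isos_def by (auto simp: bij_betw_def)
    have ft: "f y = tr b (f b) y" if "y \<in> ?E" for y
      using label_iso_is_tr[OF bE E_V E_V _ f that] path_in_E[OF assms(1,2) that] by simp
    have ext: "f \<in> extensional ?E" using f unfolding label_isos_def graph_isos_def by auto
    have fb: "f b \<in> V" using fE[OF bE] E_V by blast
    have "f b \<noteq> b"
    proof
      assume "f b = b"
      then have "f = (\<lambda>x\<in>?E. x)"
        using ft ext assms E_V by (intro extensionalityI[of _ ?E]) (auto simp: subset_iff)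
      then show False using * by blast
    qed
    \<comment> \<open>A longest path from \<open>b\<close> inside the tree leaves no room for any other image of \<open>b\<close>.\<close>
    let ?u = "word b (f b)"
    have u: "?u \<noteq> []" "?u \<in> words" using word_Nil_iff assms fb \<open>f b \<noteq> b\<close> by auto
    obtain w where w: "w \<in> words" "length w = k - 1" "w = [] \<or> hd w \<noteq> last ?u" using exists_word by blast
    have wb: "walk b w \<in> V" using w assms by simp
    have y: "walk b w \<in> ?E" using w assms wb by (auto simp: E_def B_def word_Cons)
    then have "f (walk b w) = walk (f b) w" using ft tr_walk[of b "f b" w] assms fb w words_subset by simp
    then have "f (walk b w) = walk b (?u @ w)" using fb assms by simp
    moreover have uw: "?u @ w \<in> words" using u w by (auto simp: words_append)
    ultimately have "walk b (?u @ w) \<in> ?E" using fE[OF y] by metis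
    then have "length (?u @ w) \<le> k" "length (if hd ?u = \<omega> then tl (?u @ w) else \<omega> # ?u @ w) \<le> k"
      using uw u assms word_Cons[of b "walk b (?u @ w)" \<omega>] unfolding E_def B_def
      by (auto simp del: foldl_append split: if_splits)
    then have "length ?u = 1" "hd ?u = \<omega>" using w(2) u assms by (cases ?u; auto split: if_splits)+
    then have "?u = [\<omega>]" by (cases ?u) auto
    then have "f b = nb b \<omega>" using walk_word[of b "f b"] assms fb by simp
    then show "f = restrict (tr b (nb b \<omega>)) ?E"
      using ft ext by (intro extensionalityI[of _ ?E]) auto
  qed
qed

section \<open>Automorphisms of balls\<close>

lemma ball_iso_in: "a \<in> carrier (Aut (graph_ball T b k)) \<Longrightarrow> b \<in> V \<Longrightarrow> y \<in> B b k \<Longrightarrow> a y \<in> B b k"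
  unfolding Aut_carrier using Bij_in[OF graph_isos_Bij, of a "graph_ball T b k" y] by simp

lemma ball_iso_walk:
  assumes a: "a \<in> carrier (Aut (graph_ball T b k))" and b: "b \<in> V" and u: "u \<in> V"
    and w: "w \<in> words" and path: "\<And>i. walk u (take i w) \<in> B b k"
  shows "length (word (a u) (a (walk u w))) \<le> length w"
proof -
  have "\<exists>w'. set w' \<subseteq> \<Omega> \<and> length w' = i \<and> a (walk u (take i w)) = walk (a u) w'" if "i \<le> length w" for i
    using that
  proof (induct i)
    case (Suc i)
    let ?v = "walk u (take i w)"
    obtain w' where w': "set w' \<subseteq> \<Omega>" "length w' = i" "a ?v = walk (a u) w'" using Suc by auto
    have \<omega>: "w ! i \<in> \<Omega>" using Suc(2) words_subset[OF w] nth_mem[of i w] by auto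
    have step: "take (Suc i) w = take i w @ [w ! i]" using Suc(2) by (simp add: take_Suc_conv_app_nth)
    have "?v \<in> B b k" "nb ?v (w ! i) \<in> B b k" using path[of i] path[of "Suc i"] step by auto
    moreover then have "(?v, nb ?v (w ! i)) \<in> parcs T" using \<omega> nb_arc B_inV by blast
    ultimately have "(a ?v, a (nb ?v (w ! i))) \<in> parcs T"
      using a b unfolding Aut_carrier graph_isos_def by auto
    then obtain \<omega>' where "\<omega>' \<in> \<Omega>" "a (nb ?v (w ! i)) = nb (a ?v) \<omega>'" using arc_iff by blast
    then show ?case using w' step by (intro exI[of _ "w' @ [\<omega>']"]) simp
  qed (auto intro: exI[of _ "[]"])
  from this[of "length w"] obtain w' where "set w' \<subseteq> \<Omega>" "length w' = length w" "a (walk u w) = walk (a u) w'"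
    by auto
  moreover have "a u \<in> V" using ball_iso_in[OF a b] path[of 0] B_inV by auto
  ultimately show ?thesis using word_length_le[of "a u" w'] by simp
qed

text \<open>The centre is the only vertex of a ball of radius \<open>k\<close> from which all others are within \<open>k\<close>.\<close>

lemma ball_iso_center:
  assumes a: "a \<in> carrier (Aut (graph_ball T b k))" and b: "b \<in> V"
  shows "a b = b"
proof (rule ccontr)
  let ?u = "word b (a b)"
  have ab: "a b \<in> V" using ball_iso_in[OF a b, of b] B_inV b by simp
  assume "a b \<noteq> b"
  then have u: "?u \<noteq> []" "?u \<in> words" using word_Nil_iff b ab by auto
  obtain w where w: "w \<in> words" "length w = k" "w = [] \<or> hd w \<noteq> hd ?u" using exists_word by blast
  have y: "walk b w \<in> B b k" using w b words_subset walk_in_B by simp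
  have "a ` B b k = B b k" using a b unfolding Aut_carrier graph_isos_def by (auto simp: bij_betw_def)
  then obtain z where z: "z \<in> B b k" "a z = walk b w" using y by (metis imageE)
  then have "length (word (a b) (walk b w)) \<le> length (word b z)"
    using ball_iso_walk[OF a b b, of "word b z"] path_in_ball[OF b z(1)] b B_inV by auto
  also have "\<dots> \<le> k" using z unfolding B_def by auto
  finally have le: "length (word (a b) (walk b w)) \<le> k" .
  have "rev ?u \<in> words" using u by (simp add: words_def)
  then have "rev ?u @ w \<in> words" using w u by (auto simp: words_append last_rev)
  moreover have "walk (a b) (rev ?u @ w) = walk b w"
    using walk_rev[of b ?u] b ab word_subset by simp
  ultimately have "word (a b) (walk b w) = rev ?u @ w" using ab word_eqI by blast
  then show False using le u w by simp
qed

lemma ball_iso_nb: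
  assumes a: "a \<in> carrier (Aut (graph_ball T b k))" and b: "b \<in> V" and k: "k \<ge> 1" and \<omega>: "\<omega> \<in> \<Omega>"
  shows "a (nb b \<omega>) = nb b (perm_at T l \<Omega> a b \<omega>)" and "perm_at T l \<Omega> a b \<omega> \<in> \<Omega>"
proof -
  have nbB: "nb b \<omega> \<in> B b k" using walk_in_B[of b "[\<omega>]" k] b \<omega> k by simp
  have "(b, nb b \<omega>) \<in> parcs T" using b \<omega> nb_arc by blast
  then have "(a b, a (nb b \<omega>)) \<in> parcs T"
    using a b nbB unfolding Aut_carrier graph_isos_def by auto
  then have arc: "(b, a (nb b \<omega>)) \<in> parcs T" using ball_iso_center[OF a b] by simp
  have p: "perm_at T l \<Omega> a b \<omega> = l (b, a (nb b \<omega>))"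
    using \<omega> ball_iso_center[OF a b] by (simp add: perm_at_def)
  show "a (nb b \<omega>) = nb b (perm_at T l \<Omega> a b \<omega>)" using nb_label[OF arc] p by simp
  show "perm_at T l \<Omega> a b \<omega> \<in> \<Omega>" using label_in[OF arc] p by simp
qed

lemma ball_iso_perm:
  assumes a: "a \<in> carrier (Aut (graph_ball T b k))" and b: "b \<in> V" and k: "k \<ge> 1"
  shows "perm_at T l \<Omega> a b \<in> carrier P"
proof -
  let ?p = "perm_at T l \<Omega> a b"
  have "inj_on ?p \<Omega>"
  proof (rule inj_onI)
    fix \<omega> \<omega>' assume o: "\<omega> \<in> \<Omega>" "\<omega>' \<in> \<Omega>" "?p \<omega> = ?p \<omega>'"
    then have eq: "a (nb b \<omega>) = a (nb b \<omega>')" using ball_iso_nb[OF a b k] by simp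
    have "nb b \<omega> \<in> B b k" "nb b \<omega>' \<in> B b k" using walk_in_B[of b "[_]" k] b o k by auto
    moreover have "inj_on a (B b k)" using a b unfolding Aut_carrier graph_isos_def by (auto simp: bij_betw_def)
    ultimately have "nb b \<omega> = nb b \<omega>'" using eq by (meson inj_onD)
    then show "\<omega> = \<omega>'" using nb_inj o b by blast
  qed
  moreover have "?p ` \<Omega> \<subseteq> \<Omega>" using ball_iso_nb(2)[OF a b k] by auto
  ultimately have "bij_betw ?p \<Omega> \<Omega>" using fin by (simp add: bij_betw_def endo_inj_surj)
  then show ?thesis unfolding carrier_P Bij_def by (simp add: perm_at_def)
qed

lemma restrict_aut_ball:
  assumes g: "g \<in> carrier A" "g b = b" and b: "b \<in> V"
  shows "restrict g (B b k) \<in> carrier (Aut (graph_ball T b k))"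
proof -
  have inv: "g y \<in> B b k \<longleftrightarrow> y \<in> B b k" if "y \<in> V" for y using aut_B_fix g b that by simp
  have "inj_on g (B b k)" using aut_inj g B_inV by (meson inj_onI)
  moreover have "g ` B b k = B b k"
  proof (intro equalityI subsetI)
    fix y assume y: "y \<in> B b k"
    then have "g ((inv\<^bsub>A\<^esub> g) y) = y" "(inv\<^bsub>A\<^esub> g) y \<in> V" using g B_inV by auto
    then show "y \<in> g ` B b k" using inv y by (metis imageI)
  qed (use inv B_inV in blast)
  moreover have "(u, v) \<in> parcs T \<longleftrightarrow> (g u, g v) \<in> parcs T" if "u \<in> V" "v \<in> V" for u v
    using g that unfolding Aut_carrier graph_isos_def by blast
  ultimately show ?thesis using b inv B_inV unfolding Aut_carrier graph_isos_def
    by (auto simp: bij_betw_def inj_on_restrict_eq)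
qed

lemma restrict_mult_ball:
  assumes "g \<in> carrier A" "g b = b" "h \<in> carrier A" "h b = b" and b: "b \<in> V"
  shows "restrict (g \<cdot> h) (B b k) = restrict g (B b k) \<otimes>\<^bsub>Aut (graph_ball T b k)\<^esub> restrict h (B b k)"
proof -
  have "restrict (g \<cdot> h) (B b k) = compose (B b k) (restrict g (B b k)) (restrict h (B b k))"
    using assms aut_B_fix[of h b _ k] B_inV by (auto simp: compose_def intro!: restrict_ext)
  then show ?thesis
    using Aut_mult[OF restrict_aut_ball[of g b k] restrict_aut_ball[of h b k]] assms by simp
qed

lemma restrict_one_ball: "b \<in> V \<Longrightarrow> restrict idA (B b k) = \<one>\<^bsub>Aut (graph_ball T b k)\<^esub>"
  using B_inV by (auto simp: Aut_one intro!: restrict_ext)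

lemma inv_base: "g \<in> carrier A \<Longrightarrow> b \<in> V \<Longrightarrow> g b = b \<Longrightarrow> (inv\<^bsub>A\<^esub> g) b = b"
  using A_inv_apply by metis

lemma restrict_inv_ball:
  assumes g: "g \<in> carrier A" "g b = b" and b: "b \<in> V"
  shows "restrict (inv\<^bsub>A\<^esub> g) (B b k) = inv\<^bsub>Aut (graph_ball T b k)\<^esub> (restrict g (B b k))"
proof -
  interpret Q: group "Aut (graph_ball T b k)" by (rule group_Aut)
  have i: "(inv\<^bsub>A\<^esub> g) b = b" using inv_base g b by blast
  have "restrict (inv\<^bsub>A\<^esub> g) (B b k) \<otimes>\<^bsub>Aut (graph_ball T b k)\<^esub> restrict g (B b k) = \<one>\<^bsub>Aut (graph_ball T b k)\<^esub>"
    using restrict_mult_ball[of "inv\<^bsub>A\<^esub> g" b g k] restrict_one_ball[OF b, of k] i g b by simp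
  then show ?thesis using Q.inv_equality restrict_aut_ball g i b by (metis A.inv_closed)
qed

lemma perm_restrict:
  assumes "x \<in> V" "v \<in> B x k" "k < n" shows "perm_at T l \<Omega> (restrict g (B x n)) v = \<sigma> g v"
proof -
  have "v \<in> B x n" "\<And>\<omega>. \<omega> \<in> \<Omega> \<Longrightarrow> nb v \<omega> \<in> B x n"
    using B_nb[OF assms(1,2)] assms B_mono[of k n x] B_mono[of "Suc k" n x] by auto
  then show ?thesis unfolding perm_at_def by (intro restrict_ext) simp
qed

section \<open>Universal groups\<close>

lemma locaut_mult:
  assumes "b \<in> V" "x \<in> V" "g \<in> carrier A" "h \<in> carrier A"
  shows "locaut b (g \<cdot> h) x = locaut b g (h x) \<cdot> locaut b h x"
  by (rule aut_eqI) (use assms in \<open>auto simp: locaut_apply\<close>)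

lemma locaut_inv:
  assumes "b \<in> V" "x \<in> V" "g \<in> carrier A"
  shows "locaut b (inv\<^bsub>A\<^esub> g) x = inv\<^bsub>A\<^esub> (locaut b g ((inv\<^bsub>A\<^esub> g) x))"
proof -
  have "locaut b (inv\<^bsub>A\<^esub> g) x \<cdot> locaut b g ((inv\<^bsub>A\<^esub> g) x) = idA"
    by (rule aut_eqI) (use assms in \<open>auto simp: locaut_apply\<close>)
  then show ?thesis using assms A.inv_equality by (metis A.inv_closed aut_in locaut_aut)
qed

lemma locaut_tr: "b \<in> V \<Longrightarrow> x \<in> V \<Longrightarrow> u \<in> V \<Longrightarrow> v \<in> V \<Longrightarrow> locaut b (tr u v) x = idA"
    using tr_unique[of b "\<lambda>y. tr u v (tr b x y)"] by (intro aut_eqI) (auto simp: locaut_apply)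

lemma univ_group_subgroup:
  assumes b: "b \<in> V" and S: "subgroup S (Aut (graph_ball T b k))"
  shows "subgroup (univ_group T l b k S) A"
proof (rule A.subgroupI)
  interpret S: subgroup S "Aut (graph_ball T b k)" by (rule S)
  show "univ_group T l b k S \<subseteq> carrier A" using b univ_group_iff by blast
  have "locaut b idA x = idA" if "x \<in> V" for x
    by (rule aut_eqI) (use b that in \<open>auto simp: locaut_apply\<close>)
  then have "idA \<in> univ_group T l b k S" using b restrict_one_ball by (simp add: univ_group_iff)
  then show "univ_group T l b k S \<noteq> {}" by blast
  show "inv\<^bsub>A\<^esub> g \<in> univ_group T l b k S" if "g \<in> univ_group T l b k S" for g
    using that b by (auto simp: univ_group_iff locaut_inv restrict_inv_ball)
  show "g \<cdot> h \<in> univ_group T l b k S" if "g \<in> univ_group T l b k S" "h \<in> univ_group T l b k S" for g h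
    using that b by (auto simp: univ_group_iff locaut_mult restrict_mult_ball)
qed

lemma tr_in_univ_group:
  assumes "b \<in> V" "subgroup S (Aut (graph_ball T b k))" "u \<in> V" "v \<in> V"
  shows "tr u v \<in> univ_group T l b k S"
  using assms locaut_tr restrict_one_ball[of b k] subgroup.one_closed[OF assms(2)] by (simp add: univ_group_iff)

end

context labelled_regular_tree
begin

section \<open>Extending elements of a group with the compatibility condition\<close>

lemma ball_iso_E:
  assumes a: "a \<in> carrier (Aut (graph_ball T b k))" and b: "b \<in> V" and k: "k \<ge> 1" and \<omega>: "\<omega> \<in> \<Omega>"
    and y: "y \<in> E b k \<omega>"
  shows "a y \<in> E b k (perm_at T l \<Omega> a b \<omega>)"
proof -
  have yB: "y \<in> B b k" and yV: "y \<in> V" using y by (auto simp: E_def B_def)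
  have "length (word (a (nb b \<omega>)) (a y)) \<le> length (word (nb b \<omega>) y)"
    using ball_iso_walk[OF a b, of "nb b \<omega>" "word (nb b \<omega>) y"] path_from_nb_in_ball[OF b \<omega> k yB] b \<omega> yV by simp
  then show ?thesis using y ball_iso_nb[OF a b k \<omega>] ball_iso_in[OF a b yB] unfolding E_def B_def by auto
qed

text \<open>
  Both flips are restrictions of translations, and \<open>a\<close> carries \<open>T\<^sub>\<omega>\<close> into \<open>T\<^sub>a\<^sub>\<omega>\<close>, so no flip is applied
  outside its domain.
\<close>

lemma condition_C_iff:
  assumes S: "S \<subseteq> carrier (Aut (graph_ball T b k))" and b: "b \<in> V" and k: "k \<ge> 1"
  shows "condition_C T l \<Omega> b k S \<longleftrightarrow>
    (\<forall>a\<in>S. \<forall>\<omega>\<in>\<Omega>. \<exists>a'\<in>S. \<forall>y\<in>E b k \<omega>.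
       a' y = tr b (nb b (perm_at T l \<Omega> a b \<omega>)) (a (tr b (nb b \<omega>) y)))"
proof -
  have "restrict a' (pverts (edge_tree T l b k \<omega>)) = (\<lambda>x \<in> pverts (edge_tree T l b k \<omega>).
           edge_flip T l b k (perm_at T l \<Omega> a b \<omega>) (a (edge_flip T l b k \<omega> x))) \<longleftrightarrow>
     (\<forall>y\<in>E b k \<omega>. a' y = tr b (nb b (perm_at T l \<Omega> a b \<omega>)) (a (tr b (nb b \<omega>) y)))"
    if a: "a \<in> S" and \<omega>: "\<omega> \<in> \<Omega>" for a a' \<omega>
  proof -
    have aut: "a \<in> carrier (Aut (graph_ball T b k))" using a S by blast
    have "edge_flip T l b k (perm_at T l \<Omega> a b \<omega>) (a (edge_flip T l b k \<omega> y)) =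
        tr b (nb b (perm_at T l \<Omega> a b \<omega>)) (a (tr b (nb b \<omega>) y))" if y: "y \<in> E b k \<omega>" for y
    proof -
      have "tr b (nb b \<omega>) y \<in> E b k \<omega>" using E_flip[OF b \<omega>] y E_V by blast
      then have "a (tr b (nb b \<omega>) y) \<in> E b k (perm_at T l \<Omega> a b \<omega>)" using ball_iso_E[OF aut b k \<omega>] by blast
      then show ?thesis using y edge_flip_eq[OF b _ k] ball_iso_nb(2)[OF aut b k \<omega>] \<omega> by simp
    qed
    then show ?thesis
      unfolding edge_tree_eq[OF b \<omega> k] pair_pre_digraph.select_convs restrict_def fun_eq_iff by auto
  qed
  then show ?thesis unfolding condition_C_def by blast
qed

text \<open>
  Of the two orientations of an edge, one leads away from \<open>b\<close>.
\<close>

lemma symmetric_edge_relation: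
  assumes b: "b \<in> V" and x: "x \<in> V" and \<omega>: "\<omega> \<in> \<Omega>"
    and child: "\<And>x \<omega>. x \<in> V \<Longrightarrow> \<omega> \<in> \<Omega> \<Longrightarrow> word b (nb x \<omega>) = word b x @ [\<omega>] \<Longrightarrow> R x (nb x \<omega>)"
    and sym: "\<And>x y. R x y \<Longrightarrow> R y x"
  shows "R x (nb x \<omega>)"
proof (cases "word b x \<noteq> [] \<and> last (word b x) = \<omega>")
  case True
  then obtain u where u: "word b x = u @ [\<omega>]" by (metis append_butlast_last_id)
  then have "word b (nb x \<omega>) = u" using word_snoc[OF b x \<omega>] by simp
  then have "R (nb x \<omega>) (nb (nb x \<omega>) \<omega>)" using child[of "nb x \<omega>" \<omega>] u x \<omega> by simp
  then show ?thesis using sym x \<omega> by simp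
next
  case False
  then show ?thesis using child[OF x \<omega>] word_snoc[OF b x \<omega>] by auto
qed

text \<open>
  Condition (C) lets one choose local actions vertex by vertex, moving away from the centre; the local
  actions at two adjacent vertices then agree on the intersection of their balls, and so they glue to
  an automorphism of the tree.
\<close>

theorem extend_local_action:
  assumes b: "b \<in> V" and k: "k \<ge> 1" and S: "S \<subseteq> carrier (Aut (graph_ball T b k))"
    and C: "condition_C T l \<Omega> b k S" and a0: "a0 \<in> S"
  shows "\<exists>g\<in>univ_group T l b k S. g b = b \<and> restrict g (B b k) = a0"
proof -
  let ?p = "\<lambda>a. perm_at T l \<Omega> a b"
  obtain nx where nx: "\<And>a \<omega>. a \<in> S \<Longrightarrow> \<omega> \<in> \<Omega> \<Longrightarrow> nx a \<omega> \<in> S"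
    "\<And>a \<omega> y. a \<in> S \<Longrightarrow> \<omega> \<in> \<Omega> \<Longrightarrow> y \<in> E b k \<omega> \<Longrightarrow> nx a \<omega> y = tr b (nb b (?p a \<omega>)) (a (tr b (nb b \<omega>) y))"
    using C unfolding condition_C_iff[OF S b k] by metis
  have pP: "?p a \<in> carrier P" if "a \<in> S" for a using that S ball_iso_perm[OF _ b k] by blast
  \<comment> \<open>The state reached along a word: the local action at the current vertex, and the image of that vertex.\<close>
  define st where "st = foldl (\<lambda>(a, v) \<omega>. (nx a \<omega>, nb v (?p a \<omega>))) (a0, b)"
  define c where "c x = fst (st (word b x))" for x
  define f where "f x = snd (st (word b x))" for x
  have st: "fst (st w) \<in> S \<and> snd (st w) \<in> V" if "set w \<subseteq> \<Omega>" for w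
    using that
  proof (induct w rule: rev_induct)
    case Nil then show ?case using a0 b by (simp add: st_def)
  next
    case (snoc \<omega> w)
    then show ?case using nx(1) pP by (auto simp: st_def case_prod_beta)
  qed
  have cS: "c x \<in> S" and fV: "f x \<in> V" if "x \<in> V" for x
    using st word_subset b that by (auto simp: c_def f_def)
  have c_aut: "c x \<in> carrier (Aut (graph_ball T b k))" if "x \<in> V" for x using cS that S by blast
  have cb: "c b = a0" "f b = b" using b by (auto simp: c_def f_def st_def)
  have child: "c (nb x \<omega>) = nx (c x) \<omega>" "f (nb x \<omega>) = nb (f x) (?p (c x) \<omega>)"
    if "word b (nb x \<omega>) = word b x @ [\<omega>]" for x \<omega>
    using that by (auto simp: c_def f_def st_def case_prod_beta)
  \<comment> \<open>The automorphism that the local action at \<open>x\<close> prescribes on the ball around \<open>x\<close>.\<close>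
  define h where "h x y = tr b (f x) (c x (tr x b y))" for x y
  have "\<forall>y \<in> B x k \<inter> B (nb x \<omega>) k. h x y = h (nb x \<omega>) y" if "x \<in> V" "\<omega> \<in> \<Omega>" for x \<omega>
  proof (rule symmetric_edge_relation[where R = "\<lambda>u v. \<forall>y \<in> B u k \<inter> B v k. h u y = h v y", OF b that])
    fix x \<omega> assume x: "x \<in> V" "\<omega> \<in> \<Omega>" and w: "word b (nb x \<omega>) = word b x @ [\<omega>]"
    show "\<forall>y \<in> B x k \<inter> B (nb x \<omega>) k. h x y = h (nb x \<omega>) y"
    proof
      fix y assume y: "y \<in> B x k \<inter> B (nb x \<omega>) k"
      have yV: "y \<in> V" using y B_inV by blast
      define z where "z = tr x b y"
      have z: "z \<in> V" "z \<in> B b k" using yV x b y tr_B by (auto simp: z_def)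
      have "tr x b (nb x \<omega>) = nb b \<omega>" using x b by simp
      then have "word (nb b \<omega>) z = word (nb x \<omega>) y" using word_tr[of x b "nb x \<omega>" y] x b yV z_def by simp
      then have zE: "z \<in> E b k \<omega>" using z y unfolding E_def B_def by auto
      define z' where "z' = tr b (nb b \<omega>) z"
      have z': "z' \<in> E b k \<omega>" "tr b (nb b \<omega>) z' = z"
        using E_flip[OF b x(2) z(1)] zE b x z by (auto simp: z'_def)
      have "tr (nb x \<omega>) b y = z'"
        using tr_unique[of "nb x \<omega>" "\<lambda>y. tr b (nb b \<omega>) (tr x b y)" y] b x yV by (simp add: z'_def z_def)
      then have "h (nb x \<omega>) y = tr b (f (nb x \<omega>)) (tr b (nb b (?p (c x) \<omega>)) (c x z))"
        using nx(2)[OF cS[OF x(1)] x(2) z'(1)] child[OF w] z'(2) by (simp add: h_def)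
      also have "\<dots> = tr b (f x) (c x z)"
      proof -
        let ?c = "?p (c x) \<omega>"
        have c: "?c \<in> \<Omega>" using pP cS x by simp
        have cz: "c x z \<in> V" using ball_iso_in[OF c_aut[OF x(1)] b z(2)] B_inV by blast
        have fx: "f (nb x \<omega>) \<in> V" "f (nb x \<omega>) = nb (f x) ?c" "f x \<in> V"
          using fV[of "nb x \<omega>"] fV[of x] x child[OF w] nb_in by metis+
        show ?thesis
          using tr_unique[of b "\<lambda>y. tr b (f (nb x \<omega>)) (tr b (nb b ?c) y)" "c x z"] b fx(1,3) c cz
          by (simp add: fx(2))
      qed
      finally show "h x y = h (nb x \<omega>) y" by (simp add: h_def z_def)
    qed
  next
    fix u v assume "\<forall>y \<in> B u k \<inter> B v k. h u y = h v y"
    then show "\<forall>y \<in> B v k \<inter> B u k. h v y = h u y" by (metis Int_commute)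
  qed
  then have glue: "h (nb x \<omega>) y = h x y" if "x \<in> V" "\<omega> \<in> \<Omega>" "y \<in> B x k" "y \<in> B (nb x \<omega>) k" for x \<omega> y
    using that by (metis IntI)
  have "h x (walk x w) = f (walk x w)" if "x \<in> V" "set w \<subseteq> \<Omega>" "length w \<le> k" for x w
    using that
  proof (induct w arbitrary: x)
    case Nil
    then show ?case using ball_iso_center[OF c_aut b] b fV by (simp add: h_def)
  next
    case (Cons \<omega> w)
    have "walk x (\<omega> # w) \<in> B x k" "walk (nb x \<omega>) w \<in> B (nb x \<omega>) k"
      using Cons walk_in_B[of x "\<omega> # w" k] walk_in_B[of "nb x \<omega>" w k] by auto
    then show ?case using Cons.hyps[of "nb x \<omega>"] Cons.prems glue[of x \<omega> "walk (nb x \<omega>) w"] by simp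
  qed
  then have hf: "h x y = f y" if "x \<in> V" "y \<in> B x k" for x y
    using that B_inV[OF that(2)] walk_word[of x y] word_subset[of x y] unfolding B_def by (metis (lifting) mem_Collect_eq)
  define g where "g = restrict f V"
  have step: "g (nb x \<omega>) = nb (g x) (?p (c x) \<omega>)" if x: "x \<in> V" "\<omega> \<in> \<Omega>" for x \<omega>
  proof -
    have "f (nb x \<omega>) = h x (nb x \<omega>)" using hf walk_in_B[of x "[\<omega>]" k] x k by simp
    also have "\<dots> = nb (f x) (?p (c x) \<omega>)"
      using x b fV ball_iso_nb[OF c_aut[OF x(1)] b k x(2)] by (simp add: h_def)
    finally show ?thesis using x by (simp add: g_def)
  qed
  have g: "g \<in> carrier A"
    using autI(1)[of g "\<lambda>x. ?p (c x)"] step fV pP cS by (auto simp: g_def)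
  have "restrict (locaut b g x) (B b k) = c x" if x: "x \<in> V" for x
  proof (rule extensionalityI[of _ "B b k"])
    show "c x \<in> extensional (B b k)" using c_aut[OF x] b unfolding Aut_carrier graph_isos_def by simp
    fix y assume y: "y \<in> B b k"
    then have yV: "y \<in> V" by (rule B_inV)
    have "f (tr b x y) = h x (tr b x y)" using hf[OF x, of "tr b x y"] tr_B[OF b x yV] y by simp
    also have "\<dots> = tr b (f x) (c x y)" using x b yV by (simp add: h_def)
    finally have "locaut b g x y = tr (f x) b (tr b (f x) (c x y))"
      using locaut_apply[OF b g x yV] x b yV by (simp add: g_def)
    also have "\<dots> = c x y" using fV[OF x] b B_inV[OF ball_iso_in[OF c_aut[OF x] b y]] by simp
    finally show "restrict (locaut b g x) (B b k) y = c x y" using y by simp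
  qed simp
  then have loc: "\<forall>x\<in>V. restrict (locaut b g x) (B b k) = c x" by blast
  then have "g \<in> univ_group T l b k S" using univ_group_iff[OF b] g cS by simp
  moreover have "g b = b" using cb b by (simp add: g_def)
  moreover have "restrict g (B b k) = a0"
  proof -
    have "restrict g (B b k) = restrict (locaut b g b) (B b k)"
      using locaut_apply[OF b g b] \<open>g b = b\<close> b g B_inV by (intro restrict_ext) simp
    then show ?thesis using loc cb b by simp
  qed
  ultimately show ?thesis by blast
qed

end

section \<open>Subgroups of products of simple groups\<close>

lemma (in simple_group) normal_nontrivial:
  "N \<lhd> G \<Longrightarrow> n \<in> N \<Longrightarrow> n \<noteq> \<one> \<Longrightarrow> N = carrier G"
  using no_real_normal_subgroup by blast

text \<open>The centre is a normal subgroup.\<close>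

lemma (in simple_group) centre_trivial:
  assumes nonab: "\<not> comm_group G" and c: "c \<in> carrier G" "\<And>x. x \<in> carrier G \<Longrightarrow> c \<otimes> x = x \<otimes> c"
  shows "c = \<one>"
proof (rule ccontr)
  assume "c \<noteq> \<one>"
  let ?Z = "{z \<in> carrier G. \<forall>x\<in>carrier G. z \<otimes> x = x \<otimes> z}"
  have Z: "z \<in> carrier G" "\<And>x. x \<in> carrier G \<Longrightarrow> z \<otimes> x = x \<otimes> z" if "z \<in> ?Z" for z using that by auto
  have "subgroup ?Z G"
  proof (rule subgroupI)
    show "?Z \<noteq> {}" using c by blast
    show "inv z \<in> ?Z" if z: "z \<in> ?Z" for z
    proof -
      have "inv z \<otimes> x = x \<otimes> inv z" if x: "x \<in> carrier G" for x
      proof -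
        have "inv z \<otimes> x = inv z \<otimes> (x \<otimes> z) \<otimes> inv z" using Z[OF z] x by (simp add: m_assoc)
        also have "\<dots> = inv z \<otimes> (z \<otimes> x) \<otimes> inv z" using Z(2)[OF z x] by simp
        also have "\<dots> = x \<otimes> inv z" using Z(1)[OF z] x by (simp flip: m_assoc)
        finally show ?thesis .
      qed
      then show ?thesis using Z[OF z] by simp
    qed
    show "y \<otimes> z \<in> ?Z" if y: "y \<in> ?Z" and z: "z \<in> ?Z" for y z
    proof -
      have "y \<otimes> z \<otimes> x = x \<otimes> (y \<otimes> z)" if x: "x \<in> carrier G" for x
        using Z(1)[OF y] Z(1)[OF z] Z(2)[OF y x] Z(2)[OF z x] x by (metis m_assoc)
      then show ?thesis using Z(1)[OF y] Z(1)[OF z] by simp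
    qed
  qed auto
  moreover have "x \<otimes> z \<otimes> inv x \<in> ?Z" if x: "x \<in> carrier G" and z: "z \<in> ?Z" for x z
  proof -
    have "x \<otimes> z \<otimes> inv x = z" using Z(1)[OF z] Z(2)[OF z x] x by (metis inv_closed m_assoc r_inv r_one)
    then show ?thesis using z by simp
  qed
  ultimately have "?Z \<lhd> G" by (simp add: normal_inv_iff)
  then have "?Z = carrier G" using normal_nontrivial[of ?Z c] c \<open>c \<noteq> \<one>\<close> by blast
  then have "comm_group G" by (intro group_comm_groupI) blast
  then show False using nonab by blast
qed

text \<open>
  Goursat's lemma for simple non-abelian factors. If \<open>p i\<close> and \<open>p j\<close> have incomparable kernels for \<open>i \<noteq> j\<close>,
  then already the common kernel of all \<open>p j\<close> with \<open>j \<noteq> i\<close> is mapped onto the \<open>i\<close>-th factor: a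
  commutator of an element of one kernel with an element of another lies in both kernels, and the
  factors are not abelian.
\<close>

theorem onto_product_of_simple_groups:
  assumes H: "group H" and fin: "finite I"
    and simple: "\<And>i. i \<in> I \<Longrightarrow> simple_group (S i)" and nonab: "\<And>i. i \<in> I \<Longrightarrow> \<not> comm_group (S i)"
    and hom: "\<And>i. i \<in> I \<Longrightarrow> p i \<in> hom H (S i)"
    and surj: "\<And>i. i \<in> I \<Longrightarrow> p i ` carrier H = carrier (S i)"
    and sep: "\<And>i j. i \<in> I \<Longrightarrow> j \<in> I \<Longrightarrow> i \<noteq> j \<Longrightarrow>
                \<exists>h\<in>carrier H. p j h = \<one>\<^bsub>S j\<^esub> \<and> p i h \<noteq> \<one>\<^bsub>S i\<^esub>"
    and s: "\<And>i. i \<in> I \<Longrightarrow> s i \<in> carrier (S i)"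
  shows "\<exists>h\<in>carrier H. \<forall>i\<in>I. p i h = s i"
proof -
  interpret H: group H by (rule H)
  define K where "K J = {h \<in> carrier H. \<forall>j\<in>J. p j h = \<one>\<^bsub>S j\<^esub>}" for J
  have gh: "group_hom H (S i) (p i)" if "i \<in> I" for i
    using hom[OF that] simple[OF that] H by (simp add: group_hom_def group_hom_axioms_def simple_group_def)
  have normal: "K J \<lhd> H" if J: "J \<subseteq> I" for J
    unfolding H.normal_inv_iff
  proof (intro conjI ballI)
    have p: "p j \<one>\<^bsub>H\<^esub> = \<one>\<^bsub>S j\<^esub>"
      "x \<in> carrier H \<Longrightarrow> p j x \<in> carrier (S j)"
      "x \<in> carrier H \<Longrightarrow> p j (inv\<^bsub>H\<^esub> x) = inv\<^bsub>S j\<^esub> (p j x)"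
      "x \<in> carrier H \<Longrightarrow> y \<in> carrier H \<Longrightarrow> p j (x \<otimes>\<^bsub>H\<^esub> y) = p j x \<otimes>\<^bsub>S j\<^esub> p j y"
      "group (S j)" if "j \<in> J" for j x y
    proof -
      interpret group_hom H "S j" "p j" using gh J that by blast
      show "p j \<one>\<^bsub>H\<^esub> = \<one>\<^bsub>S j\<^esub>" "x \<in> carrier H \<Longrightarrow> p j x \<in> carrier (S j)"
        "x \<in> carrier H \<Longrightarrow> p j (inv\<^bsub>H\<^esub> x) = inv\<^bsub>S j\<^esub> (p j x)"
        "x \<in> carrier H \<Longrightarrow> y \<in> carrier H \<Longrightarrow> p j (x \<otimes>\<^bsub>H\<^esub> y) = p j x \<otimes>\<^bsub>S j\<^esub> p j y"
        "group (S j)" by (auto simp: H.is_group)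
    qed
    show "subgroup (K J) H"
    proof (rule H.subgroupI)
      show "K J \<noteq> {}" using p(1) H.one_closed by (auto simp: K_def)
    next
      fix a assume "a \<in> K J"
      then show "inv\<^bsub>H\<^esub> a \<in> K J" using p by (auto simp: K_def group.is_monoid monoid.inv_one)
    next
      fix a c assume "a \<in> K J" "c \<in> K J"
      then show "a \<otimes>\<^bsub>H\<^esub> c \<in> K J"
        using p by (auto simp: K_def group.is_monoid monoid.l_one monoid.one_closed)
    qed (auto simp: K_def)
    fix x h assume "x \<in> carrier H" "h \<in> K J"
    then show "x \<otimes>\<^bsub>H\<^esub> h \<otimes>\<^bsub>H\<^esub> inv\<^bsub>H\<^esub> x \<in> K J"
      using p by (auto simp: K_def group.is_monoid monoid.r_one group.r_inv)
  qed
  have onto: "p i ` K J = carrier (S i)"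
    if "i \<in> I" "J \<subseteq> I" "h \<in> K J" "p i h \<noteq> \<one>\<^bsub>S i\<^esub>" for i J h
  proof -
    interpret N: normal "K J" H using normal that by blast
    have "p i ` K J \<lhd> S i" using N.surj_hom_normal_subgroup gh surj that by blast
    then show ?thesis using simple_group.normal_nontrivial simple that by (metis imageI)
  qed
  have step: "p i ` K J = carrier (S i)" if "finite J" "i \<in> I" "J \<subseteq> I - {i}" for i J
    using that
  proof (induct J)
    case empty
    then show ?case using surj by (simp add: K_def)
  next
    case (insert j J)
    interpret p: group_hom H "S i" "p i" using gh insert by blast
    have j: "j \<in> I" "j \<noteq> i" "J \<subseteq> I" using insert by auto
    obtain h0 where "h0 \<in> K {j}" "p i h0 \<noteq> \<one>\<^bsub>S i\<^esub>" using sep[of i j] insert j by (auto simp: K_def)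
    then have Kj: "p i ` K {j} = carrier (S i)" using onto[of i "{j}" h0] insert(4) j by simp
    obtain a c where ac: "a \<in> carrier (S i)" "c \<in> carrier (S i)" "a \<otimes>\<^bsub>S i\<^esub> c \<noteq> c \<otimes>\<^bsub>S i\<^esub> a"
      using nonab[OF insert(4)] p.H.group_comm_groupI by blast
    have "a \<in> p i ` K J" "c \<in> p i ` K {j}" using ac Kj insert j by auto
    then obtain h h' where h: "h \<in> K J" "p i h = a" "h' \<in> K {j}" "p i h' = c" by blast
    have hH: "h \<in> carrier H" "h' \<in> carrier H" using h by (auto simp: K_def)
    let ?x = "h \<otimes>\<^bsub>H\<^esub> h' \<otimes>\<^bsub>H\<^esub> inv\<^bsub>H\<^esub> h \<otimes>\<^bsub>H\<^esub> inv\<^bsub>H\<^esub> h'"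
    interpret KJ: normal "K J" H using normal j by blast
    interpret Kj: normal "K {j}" H using normal j by blast
    have "?x = h \<otimes>\<^bsub>H\<^esub> (h' \<otimes>\<^bsub>H\<^esub> inv\<^bsub>H\<^esub> h \<otimes>\<^bsub>H\<^esub> inv\<^bsub>H\<^esub> h')" using hH by (simp add: H.m_assoc)
    moreover have "h' \<otimes>\<^bsub>H\<^esub> inv\<^bsub>H\<^esub> h \<otimes>\<^bsub>H\<^esub> inv\<^bsub>H\<^esub> h' \<in> K J"
      by (rule KJ.inv_op_closed2[OF hH(2) KJ.m_inv_closed[OF h(1)]])
    ultimately have "?x \<in> K J" using KJ.m_closed[OF h(1)] by metis
    moreover have "?x \<in> K {j}"
      by (rule Kj.m_closed[OF Kj.inv_op_closed2[OF hH(1) h(3)] Kj.m_inv_closed[OF h(3)]])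
    ultimately have x: "?x \<in> K (insert j J)" unfolding K_def by blast
    have "p i ?x \<noteq> \<one>\<^bsub>S i\<^esub>"
    proof
      assume "p i ?x = \<one>\<^bsub>S i\<^esub>"
      then have "a \<otimes>\<^bsub>S i\<^esub> c \<otimes>\<^bsub>S i\<^esub> inv\<^bsub>S i\<^esub> (c \<otimes>\<^bsub>S i\<^esub> a) = \<one>\<^bsub>S i\<^esub>"
        using h hH ac by (simp add: p.H.inv_mult_group p.H.m_assoc)
      moreover have "a \<otimes>\<^bsub>S i\<^esub> c \<otimes>\<^bsub>S i\<^esub> inv\<^bsub>S i\<^esub> (c \<otimes>\<^bsub>S i\<^esub> a) \<otimes>\<^bsub>S i\<^esub> (c \<otimes>\<^bsub>S i\<^esub> a) = a \<otimes>\<^bsub>S i\<^esub> c"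
        using ac(1,2) by (simp add: p.H.m_assoc)
      ultimately have "\<one>\<^bsub>S i\<^esub> \<otimes>\<^bsub>S i\<^esub> (c \<otimes>\<^bsub>S i\<^esub> a) = a \<otimes>\<^bsub>S i\<^esub> c" by (simp only:)
      then show False using ac p.H.l_one[of "c \<otimes>\<^bsub>S i\<^esub> a"] by simp
    qed
    then show ?case using onto[OF insert(4) _ x] j by blast
  qed
  have "\<exists>h\<in>carrier H. \<forall>i\<in>J. p i h = s i" if "J \<subseteq> I" for J
    using finite_subset[OF that fin] that
  proof (induct J)
    case (insert i J)
    then obtain h where h: "h \<in> carrier H" "\<forall>j\<in>J. p j h = s j" by auto
    interpret p: group_hom H "S i" "p i" using gh insert by blast
    have i: "i \<in> I" "J \<subseteq> I - {i}" using insert by auto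
    have "inv\<^bsub>S i\<^esub> (p i h) \<otimes>\<^bsub>S i\<^esub> s i \<in> p i ` K J" using step[OF insert(1) i] h s[OF i(1)] by simp
    then obtain h' where h': "h' \<in> K J" "p i h' = inv\<^bsub>S i\<^esub> (p i h) \<otimes>\<^bsub>S i\<^esub> s i" by (metis imageE)
    have h'H: "h' \<in> carrier H" using h' by (simp add: K_def)
    have "p j (h \<otimes>\<^bsub>H\<^esub> h') = s j" if "j \<in> J" for j
    proof -
      interpret q: group_hom H "S j" "p j" using gh i that by blast
      have "p j h' = \<one>\<^bsub>S j\<^esub>" using h' that by (simp add: K_def)
      then show ?thesis using h h'H that s[of j] i by auto
    qed
    moreover have "p i (h \<otimes>\<^bsub>H\<^esub> h') = s i" using h h' h'H s[OF i(1)] by (simp flip: p.H.m_assoc)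
    ultimately show ?case using h h'H by (intro bexI[of _ "h \<otimes>\<^bsub>H\<^esub> h'"]) auto
  qed (use H.one_closed in auto)
  then show ?thesis by blast
qed

section \<open>Groups determined by their local actions\<close>

context labelled_regular_tree
begin

lemma B_1: "x \<in> V \<Longrightarrow> y \<in> B x (Suc 0) \<longleftrightarrow> y = x \<or> (\<exists>\<omega>\<in>\<Omega>. y = nb x \<omega>)"
proof
  assume x: "x \<in> V" and y: "y \<in> B x (Suc 0)"
  then have w: "walk x (word x y) = y" "set (word x y) \<subseteq> \<Omega>" "length (word x y) \<le> 1"
    using B_inV[OF y] word_subset by (auto simp: B_def)
  then show "y = x \<or> (\<exists>\<omega>\<in>\<Omega>. y = nb x \<omega>)" by (cases "word x y") auto
qed (auto simp: B_def)

lemma agree_two: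
  assumes "g \<in> carrier A" "h \<in> carrier A" "x \<in> V" "g x = h x" "\<sigma> g x = \<sigma> h x"
    and "\<And>\<omega>. \<omega> \<in> \<Omega> \<Longrightarrow> \<sigma> g (nb x \<omega>) = \<sigma> h (nb x \<omega>)" and "y \<in> B x 2"
  shows "g y = h y"
  using agree_extend[OF assms(1-4), of "Suc 0" y] assms B_1 by (auto simp: numeral_2_eq_2)

lemma sigma_conj:
  assumes "g \<in> carrier A" "h \<in> carrier A" "x \<in> V" "h x = x"
  shows "\<sigma> (g \<cdot> h \<cdot> inv\<^bsub>A\<^esub> g) (g x) = \<sigma> g x \<star> \<sigma> h x \<star> inv\<^bsub>P\<^esub> (\<sigma> g x)"
  using assms by (simp add: sigma_mult sigma_inv)

end

text \<open>
  The properties of a universal group on which the classification rests: it contains the translations,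
  its local permutations at a vertex form the group \<open>F\<close>, and membership is decided on balls of radius
  \<open>k\<close>.
\<close>

locale locally_closed_group = labelled_regular_tree +
  fixes b :: 'a and F :: "('b \<Rightarrow> 'b) set" and G :: "('a \<Rightarrow> 'a) set" and k :: nat
  assumes b_in [simp]: "b \<in> V" and F_subgroup: "subgroup F P" and two_trans: "two_transitive \<Omega> F"
    and simple: "\<And>\<omega>. \<omega> \<in> \<Omega> \<Longrightarrow> simple_group (perm_group \<Omega> (point_stab F \<omega>))"
    and nonab: "\<And>\<omega>. \<omega> \<in> \<Omega> \<Longrightarrow> \<not> comm_group (perm_group \<Omega> (point_stab F \<omega>))"
    and G_subgroup: "subgroup G A" and tr_G [simp]: "\<And>u v. u \<in> V \<Longrightarrow> v \<in> V \<Longrightarrow> tr u v \<in> G"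
    and sigma_F [simp]: "\<And>g x. g \<in> G \<Longrightarrow> x \<in> V \<Longrightarrow> \<sigma> g x \<in> F"
    and lift: "\<And>a. a \<in> F \<Longrightarrow> \<exists>g\<in>G. g b = b \<and> \<sigma> g b = a"
    and closed: "\<And>g. g \<in> carrier A \<Longrightarrow> (\<And>x. x \<in> V \<Longrightarrow> \<exists>h\<in>G. \<forall>y\<in>B x k. h y = g y) \<Longrightarrow> g \<in> G"
begin

abbreviation St where "St \<equiv> point_stab F"
abbreviation S where "S \<omega> \<equiv> perm_group \<Omega> (St \<omega>)"

sublocale G: subgroup G "Aut T" by (rule G_subgroup)
sublocale F: subgroup F "BijGroup \<Omega>" by (rule F_subgroup)

lemma G_A [simp]: "g \<in> G \<Longrightarrow> g \<in> carrier A" by (rule G.mem_carrier)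
lemma F_P [simp]: "a \<in> F \<Longrightarrow> a \<in> carrier P" by (rule F.mem_carrier)
lemma St_F: "a \<in> St \<omega> \<Longrightarrow> a \<in> F" by (simp add: point_stab_def)
lemma St_P: "a \<in> St \<omega> \<Longrightarrow> a \<in> carrier P" by (simp add: point_stab_def)
lemma St_fix: "a \<in> St \<omega> \<Longrightarrow> a \<omega> = \<omega>" by (simp add: point_stab_def)
lemma StI: "a \<in> F \<Longrightarrow> a \<omega> = \<omega> \<Longrightarrow> a \<in> St \<omega>" by (simp add: point_stab_def)

lemma G_closed [simp]:
  "g \<in> G \<Longrightarrow> h \<in> G \<Longrightarrow> g \<cdot> h \<in> G" "g \<in> G \<Longrightarrow> inv\<^bsub>A\<^esub> g \<in> G" "idA \<in> G"
  by (auto intro: G.m_closed G.m_inv_closed G.one_closed)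

lemma St_subgroup: "\<omega> \<in> \<Omega> \<Longrightarrow> subgroup (St \<omega>) P"
proof (rule P.subgroupI)
  show "St \<omega> \<subseteq> carrier P" using St_P by blast
  assume \<omega>: "\<omega> \<in> \<Omega>"
  have "idP \<in> St \<omega>" using \<omega> F.one_closed by (intro StI) auto
  then show "St \<omega> \<noteq> {}" by blast
  show "inv\<^bsub>P\<^esub> a \<in> St \<omega>" if a: "a \<in> St \<omega>" for a
    using P_inv_apply[of a \<omega>] \<omega> St_P[OF a] St_fix[OF a] F.m_inv_closed[OF St_F[OF a]] by (intro StI) auto
  show "a \<star> c \<in> St \<omega>" if a: "a \<in> St \<omega>" and c: "c \<in> St \<omega>" for a c
    using \<omega> St_P[OF a] St_P[OF c] St_fix[OF a] St_fix[OF c] F.m_closed[OF St_F[OF a] St_F[OF c]]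
    by (intro StI) auto
qed

lemma S_simps [simp]:
  "carrier (S \<omega>) = St \<omega>" "x \<otimes>\<^bsub>S \<omega>\<^esub> y = x \<star> y" "\<one>\<^bsub>S \<omega>\<^esub> = idP"
  by (simp_all add: perm_group_def)

lemma S_inv [simp]: "\<omega> \<in> \<Omega> \<Longrightarrow> a \<in> St \<omega> \<Longrightarrow> inv\<^bsub>S \<omega>\<^esub> a = inv\<^bsub>P\<^esub> a"
  using P.m_inv_consistent[OF St_subgroup] by (simp add: perm_group_def)

lemma St_nontrivial: assumes "\<omega> \<in> \<Omega>" obtains a where "a \<in> St \<omega>" "a \<noteq> idP"
proof -
  interpret simple_group "S \<omega>" by (rule simple[OF assms])
  show ?thesis using that simple_not_triv one_closed by auto
qed

lemma St_centre:
  assumes "\<omega> \<in> \<Omega>" "c \<in> St \<omega>" "\<And>x. x \<in> St \<omega> \<Longrightarrow> c \<star> x = x \<star> c" shows "c = idP"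
  using simple_group.centre_trivial[OF simple nonab, of \<omega> c] assms by simp

lemma F_two_trans:
  assumes "x \<in> \<Omega>" "y \<in> \<Omega>" "x' \<in> \<Omega>" "y' \<in> \<Omega>" "x \<noteq> y" "x' \<noteq> y'"
  obtains a where "a \<in> F" "a x = x'" "a y = y'"
  using assms two_trans unfolding two_transitive_def by metis

lemma F_trans:
  assumes "x \<in> \<Omega>" "x' \<in> \<Omega>"
  obtains a where "a \<in> F" "a x = x'"
  using F_two_trans[of x _ x' _] assms exists_label by metis

lemma St_moves:
  assumes "\<omega> \<in> \<Omega>" "c \<in> \<Omega>" "c \<noteq> \<omega>"
  obtains a where "a \<in> St \<omega>" "a c \<noteq> c"
proof -
  obtain c' where "c' \<in> \<Omega>" "c' \<noteq> \<omega>" "c' \<noteq> c" using exists_label by blast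
  then obtain a where "a \<in> F" "a \<omega> = \<omega>" "a c = c'" using F_two_trans[of \<omega> c \<omega> c'] assms by metis
  then show ?thesis using that[of a] \<open>c' \<noteq> c\<close> by (simp add: StI)
qed

lemma sigma_St: "g \<in> G \<Longrightarrow> x \<in> V \<Longrightarrow> \<omega> \<in> \<Omega> \<Longrightarrow> g x = x \<Longrightarrow> g (nb x \<omega>) = nb x \<omega> \<Longrightarrow> \<sigma> g x \<in> St \<omega>"
  by (intro StI) (auto simp: fix_sigma)

text \<open>
  The kernel of the action of the stabilizer of \<open>b\<close> on the neighbours of \<open>b\<close>. Its elements act at each
  neighbour \<open>b\<^sub>\<omega>\<close> through \<open>F\<^sub>\<omega>\<close>.
\<close>

definition K where "K = {g \<in> G. g b = b \<and> \<sigma> g b = idP}"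

lemma KI: "g \<in> G \<Longrightarrow> g b = b \<Longrightarrow> \<sigma> g b = idP \<Longrightarrow> g \<in> K" by (simp add: K_def)
lemma K_G [simp]: "g \<in> K \<Longrightarrow> g \<in> G"
  and K_b [simp]: "g \<in> K \<Longrightarrow> g b = b"
  and K_sigma_b [simp]: "g \<in> K \<Longrightarrow> \<sigma> g b = idP" by (simp_all add: K_def)
lemma K_nb [simp]: "g \<in> K \<Longrightarrow> \<omega> \<in> \<Omega> \<Longrightarrow> g (nb b \<omega>) = nb b \<omega>" using aut_nb[of g b \<omega>] by simp

lemma K_sigma_St: "g \<in> K \<Longrightarrow> \<omega> \<in> \<Omega> \<Longrightarrow> \<sigma> g (nb b \<omega>) \<in> St \<omega>"
  by (rule sigma_St) auto

lemma K_closed: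
  "g \<in> K \<Longrightarrow> h \<in> K \<Longrightarrow> g \<cdot> h \<in> K" "g \<in> K \<Longrightarrow> inv\<^bsub>A\<^esub> g \<in> K" "idA \<in> K"
proof -
  show "g \<in> K \<Longrightarrow> h \<in> K \<Longrightarrow> g \<cdot> h \<in> K" by (rule KI) (simp_all add: sigma_mult)
  show "inv\<^bsub>A\<^esub> g \<in> K" if "g \<in> K"
    using that inv_base[of g b] sigma_inv[of g b] by (intro KI) simp_all
  show "idA \<in> K" by (rule KI) (simp_all add: sigma_one)
qed

lemma K_subgroup: "subgroup K A"
  by (rule A.subgroupI) (use K_closed in auto)

lemma K_conj:
  assumes "g \<in> G" "g b = b" "h \<in> K" shows "g \<cdot> h \<cdot> inv\<^bsub>A\<^esub> g \<in> K"
  using assms sigma_conj[of g h b] inv_base[of g b] by (intro KI) simp_all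

lemma nb_image: "g \<in> G \<Longrightarrow> g b = b \<Longrightarrow> \<omega> \<in> \<Omega> \<Longrightarrow> g (nb b \<omega>) = nb b (\<sigma> g b \<omega>)"
  by (simp add: aut_nb)

lemma K_conj_sigma:
  assumes "g \<in> G" "g b = b" "h \<in> K" "\<omega> \<in> \<Omega>"
  shows "\<sigma> (g \<cdot> h \<cdot> inv\<^bsub>A\<^esub> g) (nb b (\<sigma> g b \<omega>)) =
    \<sigma> g (nb b \<omega>) \<star> \<sigma> h (nb b \<omega>) \<star> inv\<^bsub>P\<^esub> (\<sigma> g (nb b \<omega>))"
  using sigma_conj[of g h "nb b \<omega>"] nb_image[of g \<omega>] assms by simp

lemma conj_eq_one: "a \<in> carrier P \<Longrightarrow> c \<in> carrier P \<Longrightarrow> a \<star> c \<star> inv\<^bsub>P\<^esub> a = idP \<longleftrightarrow> c = idP"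
  using P.inv_solve_right[of "idP" "a \<star> c" a] P.l_cancel_one[of a c] by auto

text \<open>
  Composing with the flips of an edge and of its image exchanges the local permutations at the two ends;
  this is how condition (C) appears inside the group.
\<close>

lemma flip_conj:
  assumes g: "g \<in> G" "g b = b" and \<omega>: "\<omega> \<in> \<Omega>"
  defines "f \<equiv> tr b (nb b (\<sigma> g b \<omega>)) \<cdot> (g \<cdot> tr b (nb b \<omega>))"
  shows "f \<in> G" "f b = b" "\<sigma> f b = \<sigma> g (nb b \<omega>)" "\<sigma> f (nb b \<omega>) = \<sigma> g b"
    "f (nb b \<omega>) = nb b (\<sigma> g b \<omega>)"
proof -
  have c: "\<sigma> g b \<omega> \<in> \<Omega>" using assms by simp
  show "f \<in> G" using assms c by simp
  have "tr b (nb b \<omega>) (nb b \<omega>) = b" "tr b (nb b (\<sigma> g b \<omega>)) (nb b (\<sigma> g b \<omega>)) = b"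
    using \<omega> c by simp_all
  then show "f b = b" "\<sigma> f b = \<sigma> g (nb b \<omega>)" "\<sigma> f (nb b \<omega>) = \<sigma> g b" "f (nb b \<omega>) = nb b (\<sigma> g b \<omega>)"
    using g \<omega> c nb_image[OF g \<omega>] by (auto simp del: tr_nb simp: f_def sigma_mult)
qed

lemma lift_edge:
  assumes "\<omega> \<in> \<Omega>" "a \<in> St \<omega>"
  obtains g where "g \<in> G" "g b = b" "g (nb b \<omega>) = nb b \<omega>" "\<sigma> g b \<omega> = \<omega>" "\<sigma> g (nb b \<omega>) = a"
proof -
  obtain g where g: "g \<in> G" "g b = b" "\<sigma> g b = a" using lift[of a] assms St_F by blast
  let ?f = "tr b (nb b (\<sigma> g b \<omega>)) \<cdot> (g \<cdot> tr b (nb b \<omega>))"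
  have f: "?f \<in> G" "?f b = b" "\<sigma> ?f (nb b \<omega>) = a" "?f (nb b \<omega>) = nb b \<omega>"
    using flip_conj[OF g(1,2) assms(1)] g(3) St_fix[OF assms(2)] by simp_all
  then have "\<sigma> ?f b \<omega> = \<omega>" using fix_sigma[of b \<omega> ?f] assms by simp
  then show ?thesis using that f by blast
qed

text \<open>
  The stabilizer of the edge \<open>(b, b\<^sub>\<omega>)\<close> acts at \<open>b\<^sub>\<omega>\<close> as the simple group \<open>F\<^sub>\<omega>\<close> and normalizes \<open>K\<close>, so
  the image of \<open>K\<close> in \<open>F\<^sub>\<omega>\<close> is trivial or everything. Transitivity on labels transports nontriviality from
  one neighbour to the others.
\<close>

lemma K_onto:
  assumes h: "h \<in> K" "\<omega> \<in> \<Omega>" "\<sigma> h (nb b \<omega>) \<noteq> idP" and \<omega>': "\<omega>' \<in> \<Omega>" and a: "a \<in> St \<omega>'"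
  shows "\<exists>h\<in>K. \<sigma> h (nb b \<omega>') = a"
proof -
  obtain c where c: "c \<in> F" "c \<omega> = \<omega>'" using F_trans h \<omega>' by metis
  obtain g where g: "g \<in> G" "g b = b" "\<sigma> g b = c" using lift[OF c(1)] by blast
  let ?h = "g \<cdot> h \<cdot> inv\<^bsub>A\<^esub> g"
  have h': "?h \<in> K" "\<sigma> ?h (nb b \<omega>') \<noteq> idP"
    using K_conj g h K_conj_sigma[OF g(1,2) h(1,2)] c conj_eq_one by auto
  interpret simple_group "S \<omega>'" by (rule simple[OF \<omega>'])
  let ?N = "(\<lambda>h. \<sigma> h (nb b \<omega>')) ` K"
  have "?N \<lhd> S \<omega>'"
  proof (rule normal_invI)
    show "subgroup ?N (S \<omega>')"
    proof (rule subgroupI)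
      show "?N \<subseteq> carrier (S \<omega>')" using K_sigma_St \<omega>' by auto
      show "?N \<noteq> {}" using h by blast
    next
      fix n assume "n \<in> ?N"
      then obtain m where "m \<in> K" "n = \<sigma> m (nb b \<omega>')" by blast
      moreover then have "inv\<^bsub>S \<omega>'\<^esub> n = \<sigma> (inv\<^bsub>A\<^esub> m) (nb b \<omega>')"
        using sigma_inv[of m "nb b \<omega>'"] K_sigma_St \<omega>' by simp
      ultimately show "inv\<^bsub>S \<omega>'\<^esub> n \<in> ?N" using K_closed by blast
    next
      fix n n' assume "n \<in> ?N" "n' \<in> ?N"
      then obtain m m' where m: "m \<in> K" "n = \<sigma> m (nb b \<omega>')" "m' \<in> K" "n' = \<sigma> m' (nb b \<omega>')" by blast
      then have "n \<otimes>\<^bsub>S \<omega>'\<^esub> n' = \<sigma> (m \<cdot> m') (nb b \<omega>')" using \<omega>' by (simp add: sigma_mult)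
      then show "n \<otimes>\<^bsub>S \<omega>'\<^esub> n' \<in> ?N" using K_closed m by blast
    qed
  next
    fix x n assume x: "x \<in> carrier (S \<omega>')" and "n \<in> ?N"
    then obtain m where m: "m \<in> K" "n = \<sigma> m (nb b \<omega>')" by blast
    obtain q where q: "q \<in> G" "q b = b" "\<sigma> q b \<omega>' = \<omega>'" "\<sigma> q (nb b \<omega>') = x"
      using lift_edge[OF \<omega>'] x by auto
    have "\<sigma> (q \<cdot> m \<cdot> inv\<^bsub>A\<^esub> q) (nb b \<omega>') = x \<otimes>\<^bsub>S \<omega>'\<^esub> n \<otimes>\<^bsub>S \<omega>'\<^esub> inv\<^bsub>S \<omega>'\<^esub> x"
      using K_conj_sigma[OF q(1,2) m(1) \<omega>'] q m x \<omega>' by simp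
    then show "x \<otimes>\<^bsub>S \<omega>'\<^esub> n \<otimes>\<^bsub>S \<omega>'\<^esub> inv\<^bsub>S \<omega>'\<^esub> x \<in> ?N" using K_conj[OF q(1,2) m(1)] by (metis imageI)
  qed
  then have "?N = carrier (S \<omega>')" using normal_nontrivial h' by auto
  then have "a \<in> ?N" using a by simp
  then show ?thesis by blast
qed

section \<open>Rigidity: when the kernel acts faithfully at each neighbour\<close>

text \<open>
  This covers both the trivial kernel and the one that is a diagonal subgroup of the product of the
  groups \<open>F\<^sub>\<omega>\<close>.
\<close>

definition rigid where
  "rigid \<longleftrightarrow> (\<forall>h\<in>K. (\<exists>\<omega>\<in>\<Omega>. \<sigma> h (nb b \<omega>) = idP) \<longrightarrow> (\<forall>\<omega>\<in>\<Omega>. \<sigma> h (nb b \<omega>) = idP))"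

text \<open>
  After division by an element of the group, the automorphism fixes one ball of radius two. If it fixes
  the ball of radius two around \<open>x\<close>, then around an adjacent \<open>x'\<close> it acts like an element of a conjugate
  of \<open>K\<close> that is trivial around the neighbour \<open>x\<close> of \<open>x'\<close>; by rigidity it fixes the ball of radius two
  around \<open>x'\<close>. So it is trivial.
\<close>

lemma rigid_two_closed:
  assumes rigid: "rigid" and f: "f \<in> carrier A"
    and agree: "\<And>x. x \<in> V \<Longrightarrow> \<exists>h\<in>G. \<forall>y\<in>B x 2. f y = h y"
  shows "f \<in> G"
proof -
  obtain h0 where h0: "h0 \<in> G" "\<forall>y\<in>B b 2. f y = h0 y" using agree[OF b_in] by auto
  define e where "e = inv\<^bsub>A\<^esub> h0 \<cdot> f"
  have e: "e \<in> carrier A" using h0 f by (simp add: e_def)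
  have "\<forall>y\<in>B (walk b w) 2. e y = y" if "set w \<subseteq> \<Omega>" for w
    using that
  proof (induct w rule: rev_induct)
    case Nil
    have "e y = y" if "y \<in> B b 2" for y
    proof -
      have "e y = (inv\<^bsub>A\<^esub> h0) (f y)" using that B_inV f h0 by (simp add: e_def)
      then show ?thesis using that B_inV h0 by simp
    qed
    then show ?case by simp
  next
    case (snoc \<omega> w)
    define x where "x = walk b w"
    define x' where "x' = nb x \<omega>"
    have x: "x \<in> V" "\<omega> \<in> \<Omega>" "x' \<in> V" using snoc by (auto simp: x_def x'_def)
    have e_fix: "e y = y" if "y \<in> B x 2" for y using that snoc by (auto simp: x_def)
    have e_sigma: "\<sigma> e y = idP" if "y \<in> B x (Suc 0)" for y
      using agree_sigma[OF x(1), of "Suc 0" e "idA" y] e_fix that sigma_one B_inV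
      by (auto simp: numeral_2_eq_2)
    obtain h where h: "h \<in> G" "\<forall>y\<in>B x' 2. f y = h y" using agree x by blast
    define h' where "h' = inv\<^bsub>A\<^esub> h0 \<cdot> h"
    have h': "h' \<in> G" "\<And>y. y \<in> B x' 2 \<Longrightarrow> h' y = e y"
      using h h0 f B_inV by (auto simp: h'_def e_def)
    have h'_sigma: "\<sigma> h' y = \<sigma> e y" if "y \<in> B x' (Suc 0)" for y
      using agree_sigma[OF x(3), of "Suc 0" h' e y] h'(2) that by (simp add: numeral_2_eq_2)
    define m where "m = tr x' b \<cdot> (h' \<cdot> tr b x')"
    have x'B: "x' \<in> B x (Suc 0)" "x' \<in> B x 2" "x \<in> B x' (Suc 0)" using x by (auto simp: x'_def B_def word_Cons)
    have h'x': "h' x' = x'" using h'(2)[of x'] e_fix x x'B by simp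
    have m: "m \<in> G" "m b = b" using x h' h'x' by (auto simp: m_def)
    have m_sigma: "\<sigma> m v = \<sigma> h' (tr b x' v)" if "v \<in> V" for v
      using that x h' by (simp add: m_def sigma_mult)
    have "\<sigma> m b = idP" using m_sigma[of b] x h'_sigma[of x'] e_sigma[OF x'B(1)] by simp
    then have "m \<in> K" using m by (auto intro: KI)
    moreover have "\<sigma> m (nb b \<omega>) = idP"
    proof -
      have "tr b x' (nb b \<omega>) = x" using x by (simp add: x'_def)
      then show ?thesis using m_sigma[of "nb b \<omega>"] x h'_sigma[OF x'B(3)] e_sigma[of x] by simp
    qed
    ultimately have all: "\<sigma> m (nb b \<omega>') = idP" if "\<omega>' \<in> \<Omega>" for \<omega>'
      using rigid x(2) that unfolding rigid_def by blast
    have "h' y = idA y" if y: "y \<in> B x' 2" for y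
    proof (rule agree_two[OF _ _ x(3) _ _ _ y])
      show "\<sigma> h' x' = \<sigma> idA x'" using h'_sigma[of x'] e_sigma[OF x'B(1)] x sigma_one by simp
      show "\<sigma> h' (nb x' \<omega>') = \<sigma> idA (nb x' \<omega>')" if "\<omega>' \<in> \<Omega>" for \<omega>'
        using all[OF that] m_sigma[of "nb b \<omega>'"] that x sigma_one by simp
    qed (use h' h'x' x in auto)
    then have "e y = y" if "y \<in> B x' 2" for y using h'(2)[OF that] that B_inV by auto
    then show ?case by (simp add: x'_def x_def)
  qed
  then have "e (walk b w) = walk b w" if "w \<in> words" for w
    using that words_subset walk_in'[OF b_in that] by (meson B_self)
  then have "e y = y" if "y \<in> V" for y using that walk_word[of b y] word_in[of b y] by (metis b_in)
  then have "e = idA" using e by (intro aut_eqI) auto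
  then have "f = h0" using h0 f unfolding e_def by (metis A.inv_closed A.inv_equality A.inv_inv G_A)
  then show ?thesis using h0 by simp
qed

end

section \<open>Automorphisms of the ball of radius two\<close>

context labelled_regular_tree
begin

lemma ball_iso_step:
  assumes a: "a \<in> carrier (Aut (graph_ball T b k))" and b: "b \<in> V"
    and v: "v \<in> B b k" and \<omega>: "\<omega> \<in> \<Omega>" and v\<omega>: "nb v \<omega> \<in> B b k"
  shows "a (nb v \<omega>) = nb (a v) (perm_at T l \<Omega> a v \<omega>)"
proof -
  have "(v, nb v \<omega>) \<in> parcs T" using v \<omega> nb_arc B_inV by blast
  then have "(a v, a (nb v \<omega>)) \<in> parcs T"
    using a b v v\<omega> unfolding Aut_carrier graph_isos_def by auto
  then show ?thesis using nb_label \<omega> by (simp add: perm_at_def)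
qed

text \<open>
  The centre is fixed, so the permutations of labels at the centre and its neighbours give the images of
  all walks of length at most two.
\<close>

lemma ball_two_determined:
  assumes a: "a \<in> carrier (Aut (graph_ball T b 2))" and c: "c \<in> carrier (Aut (graph_ball T b 2))"
    and b: "b \<in> V" and eq: "realization T l \<Omega> b a = realization T l \<Omega> b c"
  shows "a = c"
proof (rule extensionalityI[of _ "B b 2"])
  have pb: "perm_at T l \<Omega> a b = perm_at T l \<Omega> c b" using eq by (simp add: realization_def)
  have pn: "perm_at T l \<Omega> a (nb b \<omega>) = perm_at T l \<Omega> c (nb b \<omega>)" if "\<omega> \<in> \<Omega>" for \<omega>
  proof -
    have "(\<lambda>\<omega>\<in>\<Omega>. perm_at T l \<Omega> a (nb b \<omega>)) \<omega> = (\<lambda>\<omega>\<in>\<Omega>. perm_at T l \<Omega> c (nb b \<omega>)) \<omega>"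
      using eq by (simp add: realization_def)
    then show ?thesis using that by simp
  qed
  have one: "a (nb b \<omega>) = c (nb b \<omega>)" "nb b \<omega> \<in> B b 2" if "\<omega> \<in> \<Omega>" for \<omega>
    using that ball_iso_nb(1)[OF a b _ that] ball_iso_nb(1)[OF c b _ that] pb walk_in_B[of b "[\<omega>]" 2] b by auto
  show "a \<in> extensional (B b 2)" "c \<in> extensional (B b 2)"
    using a c b unfolding Aut_carrier graph_isos_def by auto
  fix y assume y: "y \<in> B b 2"
  then have w: "walk b (word b y) = y" "set (word b y) \<subseteq> \<Omega>" "length (word b y) \<le> 2"
    using b B_inV[OF y] word_subset by (auto simp: B_def)
  then consider "word b y = []" | \<omega> where "word b y = [\<omega>]" | \<omega> \<omega>' where "word b y = [\<omega>, \<omega>']"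
    by (cases "word b y" rule: remdups_adj.cases) auto
  then show "a y = c y"
  proof cases
    case 1
    then have "y = b" using w by simp
    then show ?thesis using ball_iso_center[OF a b] ball_iso_center[OF c b] by simp
  next
    case 2
    then have "y = nb b \<omega>" "\<omega> \<in> \<Omega>" using w by auto
    then show ?thesis using one by simp
  next
    case 3
    then have "y = nb (nb b \<omega>) \<omega>'" "\<omega> \<in> \<Omega>" "\<omega>' \<in> \<Omega>" using w by auto
    then show ?thesis
      using ball_iso_step[OF a b one(2), of \<omega> \<omega>'] ball_iso_step[OF c b one(2), of \<omega> \<omega>'] pn one y by simp
  qed
qed

lemma realization_restrict:
  assumes "b \<in> V"
  shows "realization T l \<Omega> b (restrict g (B b 2)) = (\<sigma> g b, \<lambda>\<omega>\<in>\<Omega>. \<sigma> g (nb b \<omega>))"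
proof -
  have "perm_at T l \<Omega> (restrict g (B b 2)) (nb b \<omega>) = \<sigma> g (nb b \<omega>)" if "\<omega> \<in> \<Omega>" for \<omega>
    using perm_restrict[OF assms, of "nb b \<omega>" 1 2] walk_in_B[of b "[\<omega>]" 1] that assms by simp
  moreover have "perm_at T l \<Omega> (restrict g (B b 2)) b = \<sigma> g b"
    using perm_restrict[OF assms, of b 0 2] assms by simp
  ultimately show ?thesis unfolding realization_def by (auto intro: restrict_ext)
qed

lemma univ_of_pairs_iff:
  assumes b: "b \<in> V"
  shows "g \<in> univ_group T l b 2 (of_pairs T l \<Omega> b S) \<longleftrightarrow>
    g \<in> carrier A \<and> (\<forall>x\<in>V. (\<sigma> (locaut b g x) b, \<lambda>\<omega>\<in>\<Omega>. \<sigma> (locaut b g x) (nb b \<omega>)) \<in> S)"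
proof -
  have "restrict (locaut b g x) (B b 2) \<in> of_pairs T l \<Omega> b S \<longleftrightarrow>
      (\<sigma> (locaut b g x) b, \<lambda>\<omega>\<in>\<Omega>. \<sigma> (locaut b g x) (nb b \<omega>)) \<in> S"
    if "g \<in> carrier A" "x \<in> V" for x
    using restrict_aut_ball[of "locaut b g x" b 2] that b realization_restrict[OF b]
    unfolding of_pairs_def by simp
  then show ?thesis using univ_group_iff[OF b] by blast
qed

end

context locally_closed_group
begin

lemma locaut_G: "g \<in> G \<Longrightarrow> x \<in> V \<Longrightarrow> locaut b g x \<in> G"
  by (simp add: locaut_def)

lemma agree_from_locaut:
  assumes g: "g \<in> carrier A" "x \<in> V" and h: "h \<in> G" and eq: "\<And>y. y \<in> B b n \<Longrightarrow> locaut b g x y = h y"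
  shows "\<exists>h'\<in>G. \<forall>y\<in>B x n. g y = h' y"
proof (intro bexI ballI)
  let ?h = "tr b (g x) \<cdot> (h \<cdot> tr x b)"
  show "?h \<in> G" using g h by simp
  fix y assume y: "y \<in> B x n"
  then have yV: "y \<in> V" by (rule B_inV)
  have "tr x b y \<in> B b n" using y yV g tr_B by simp
  then have "h (tr x b y) = tr (g x) b (g y)" using eq[of "tr x b y"] g yV by (simp add: locaut_apply)
  then show "g y = ?h y" using g h yV by simp
qed

text \<open>
  The group of 2-local actions of \<open>G\<close>. Those at \<open>b\<close> of elements fixing \<open>b\<close> are all of them, since \<open>G\<close>
  contains the translations.
\<close>

definition D2 where "D2 = (\<lambda>g. restrict g (B b 2)) ` {g \<in> G. g b = b}"

lemma D2_subgroup: "subgroup D2 (Aut (graph_ball T b 2))"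
proof -
  interpret Q: group "Aut (graph_ball T b 2)" by (rule group_Aut)
  show ?thesis
  proof (rule Q.subgroupI)
    show "D2 \<subseteq> carrier (Aut (graph_ball T b 2))" unfolding D2_def using restrict_aut_ball by auto
    have "idA \<in> {g \<in> G. g b = b}" by simp
    then show "D2 \<noteq> {}" unfolding D2_def by blast
  next
    fix a assume "a \<in> D2"
    then obtain g where g: "g \<in> G" "g b = b" "a = restrict g (B b 2)" unfolding D2_def by blast
    then have "inv\<^bsub>Aut (graph_ball T b 2)\<^esub> a = restrict (inv\<^bsub>A\<^esub> g) (B b 2)" using restrict_inv_ball by simp
    moreover have "inv\<^bsub>A\<^esub> g \<in> {g \<in> G. g b = b}" using g inv_base[of g b] by simp
    ultimately show "inv\<^bsub>Aut (graph_ball T b 2)\<^esub> a \<in> D2" unfolding D2_def by simp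
  next
    fix a c assume "a \<in> D2" "c \<in> D2"
    then obtain g h where g: "g \<in> G" "g b = b" "a = restrict g (B b 2)"
      and h: "h \<in> G" "h b = b" "c = restrict h (B b 2)" unfolding D2_def by blast
    then have "a \<otimes>\<^bsub>Aut (graph_ball T b 2)\<^esub> c = restrict (g \<cdot> h) (B b 2)"
      using restrict_mult_ball by simp
    moreover have "g \<cdot> h \<in> G" "(g \<cdot> h) b = b" using g h by auto
    ultimately show "a \<otimes>\<^bsub>Aut (graph_ball T b 2)\<^esub> c \<in> D2" unfolding D2_def by blast
  qed
qed

lemma D2_condition_C: "condition_C T l \<Omega> b 2 D2"
proof -
  have "\<exists>a'\<in>D2. \<forall>y\<in>E b 2 \<omega>. a' y = tr b (nb b (perm_at T l \<Omega> a b \<omega>)) (a (tr b (nb b \<omega>) y))"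
    if a: "a \<in> D2" and \<omega>: "\<omega> \<in> \<Omega>" for a \<omega>
  proof -
    obtain g where g: "g \<in> G" "g b = b" "a = restrict g (B b 2)" using a unfolding D2_def by blast
    have p: "perm_at T l \<Omega> a b = \<sigma> g b" using perm_restrict[of b b 0 2 g] g by simp
    let ?f = "tr b (nb b (\<sigma> g b \<omega>)) \<cdot> (g \<cdot> tr b (nb b \<omega>))"
    have f: "?f \<in> G" "?f b = b" using flip_conj[OF g(1,2) \<omega>] by auto
    have "restrict ?f (B b 2) y = tr b (nb b (perm_at T l \<Omega> a b \<omega>)) (a (tr b (nb b \<omega>) y))"
      if y: "y \<in> E b 2 \<omega>" for y
    proof -
      have "y \<in> V" "y \<in> B b 2" using y by (auto simp: E_def B_def)
      moreover then have "tr b (nb b \<omega>) y \<in> B b 2" using E_flip[OF b_in \<omega>, of y 2] y by (simp add: E_def)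
      ultimately show ?thesis using g \<omega> p by simp
    qed
    then show ?thesis using f unfolding D2_def by blast
  qed
  moreover have "D2 \<subseteq> carrier (Aut (graph_ball T b 2))" using D2_subgroup by (rule subgroup.subset)
  ultimately show ?thesis using condition_C_iff[of D2 b 2] by simp
qed

lemma univ_group_D2:
  assumes rigid shows "univ_group T l b 2 D2 = G"
proof (intro equalityI subsetI)
  fix g assume "g \<in> G"
  moreover then have "restrict (locaut b g x) (B b 2) \<in> D2" if "x \<in> V" for x
    unfolding D2_def using that locaut_G by auto
  ultimately show "g \<in> univ_group T l b 2 D2" by (simp add: univ_group_iff)
next
  fix g assume g: "g \<in> univ_group T l b 2 D2"
  then have gA: "g \<in> carrier A" by (simp add: univ_group_iff)
  show "g \<in> G"
  proof (rule rigid_two_closed[OF assms gA])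
    fix x assume x: "x \<in> V"
    then have "restrict (locaut b g x) (B b 2) \<in> D2" using g by (simp add: univ_group_iff)
    then obtain h where "h \<in> G" "restrict (locaut b g x) (B b 2) = restrict h (B b 2)"
      unfolding D2_def by blast
    then show "\<exists>h\<in>G. \<forall>y\<in>B x 2. g y = h y" using agree_from_locaut[OF gA x] by (metis restrict_apply')
  qed
qed

section \<open>Trivial kernel: an involutive cocycle\<close>

text \<open>
  The cocycle identities are the chain rule for local permutations, so they hold as soon as the chosen
  lifts are multiplicative around the neighbours of \<open>b\<close>.
\<close>

lemma cocycle_of_lifts:
  assumes L: "\<And>a. a \<in> F \<Longrightarrow> L a \<in> G \<and> L a b = b \<and> \<sigma> (L a) b = a"
    and mult: "\<And>a c \<omega>. a \<in> F \<Longrightarrow> c \<in> F \<Longrightarrow> \<omega> \<in> \<Omega> \<Longrightarrow>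
      \<sigma> (L (a \<star> c)) (nb b \<omega>) = \<sigma> (L a \<cdot> L c) (nb b \<omega>)"
  shows "compat_cocycle \<Omega> F (\<lambda>a \<omega>. \<sigma> (L a) (nb b \<omega>))"
  unfolding compat_cocycle_def
proof (intro conjI ballI)
  fix a \<omega> assume a: "a \<in> F" "\<omega> \<in> \<Omega>"
  show "\<sigma> (L a) (nb b \<omega>) \<in> F" using a L by simp
  show "\<sigma> (L a) (nb b \<omega>) \<omega> = a \<omega>" using a L sigma_nb[of "L a" b \<omega>] by simp
  fix c assume c: "c \<in> F"
  have "\<sigma> (L (a \<star> c)) (nb b \<omega>) = \<sigma> (L a) (L c (nb b \<omega>)) \<star> \<sigma> (L c) (nb b \<omega>)"
    using mult[OF a(1) c a(2)] L a c by (simp add: sigma_mult)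
  also have "L c (nb b \<omega>) = nb b (c \<omega>)" using nb_image[of "L c" \<omega>] L c a by simp
  finally have "\<sigma> (L (a \<star> c)) (nb b \<omega>) = \<sigma> (L a) (nb b (c \<omega>)) \<star> \<sigma> (L c) (nb b \<omega>)" .
  moreover have "\<sigma> (L a) (nb b (c \<omega>)) \<in> carrier P" "\<sigma> (L c) (nb b \<omega>) \<in> carrier P" using L a c by auto
  ultimately show "\<sigma> (L (compose \<Omega> a c)) (nb b \<omega>) =
      compose \<Omega> (\<sigma> (L a) (nb b (c \<omega>))) (\<sigma> (L c) (nb b \<omega>))"
    using a c by (simp add: P_mult_compose)
qed

text \<open>
  Two lifts of \<open>a \<in> F\<close> to the stabilizer of \<open>b\<close> differ by an element of \<open>K\<close>, so the local permutation at
  \<open>b\<^sub>\<omega>\<close> is a function of \<open>a\<close> and \<open>\<omega>\<close>. Flipping the edge to \<open>b\<^sub>\<omega>\<close> shows that it is involutive.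
\<close>

lemma trivial_kernel_Gamma1:
  assumes triv: "\<And>h \<omega>. h \<in> K \<Longrightarrow> \<omega> \<in> \<Omega> \<Longrightarrow> \<sigma> h (nb b \<omega>) = idP"
  shows "\<exists>z. involutive_cocycle \<Omega> F z \<and> univ_group T l b 2 (Gamma1 T l \<Omega> b F z) = G"
proof -
  obtain L where L: "\<And>a. a \<in> F \<Longrightarrow> L a \<in> G \<and> L a b = b \<and> \<sigma> (L a) b = a" using lift by metis
  define z where "z a \<omega> = \<sigma> (L a) (nb b \<omega>)" for a \<omega>
  have z: "z (\<sigma> g b) \<omega> = \<sigma> g (nb b \<omega>)" if g: "g \<in> G" "g b = b" "\<omega> \<in> \<Omega>" for g \<omega>
  proof -
    have L': "L (\<sigma> g b) \<in> G" "L (\<sigma> g b) b = b" "\<sigma> (L (\<sigma> g b)) b = \<sigma> g b" using L g by auto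
    let ?h = "inv\<^bsub>A\<^esub> g \<cdot> L (\<sigma> g b)"
    have h: "?h \<in> K"
      using g L' inv_base[of g b] sigma_inv[of g b] by (intro KI) (simp_all add: sigma_mult)
    have "L (\<sigma> g b) = g \<cdot> ?h" using g L' by (simp flip: A.m_assoc)
    then have "\<sigma> (L (\<sigma> g b)) (nb b \<omega>) = \<sigma> (g \<cdot> ?h) (nb b \<omega>)" by simp
    also have "\<dots> = \<sigma> g (?h (nb b \<omega>)) \<star> \<sigma> ?h (nb b \<omega>)"
      by (rule sigma_mult) (use g L' in auto)
    also have "\<dots> = \<sigma> g (nb b \<omega>)" using triv[OF h g(3)] K_nb[OF h g(3)] g by simp
    finally show ?thesis by (simp add: z_def)
  qed
  have "compat_cocycle \<Omega> F (\<lambda>a \<omega>. \<sigma> (L a) (nb b \<omega>))"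
  proof (rule cocycle_of_lifts[OF L])
    fix a c \<omega> assume a: "a \<in> F" "c \<in> F" "\<omega> \<in> \<Omega>"
    have "L a \<cdot> L c \<in> G" "(L a \<cdot> L c) b = b" "\<sigma> (L a \<cdot> L c) b = a \<star> c"
      using L a by (auto simp: sigma_mult)
    then show "\<sigma> (L (a \<star> c)) (nb b \<omega>) = \<sigma> (L a \<cdot> L c) (nb b \<omega>)"
      using z[of "L a \<cdot> L c" \<omega>] a(3) by (simp add: z_def)
  qed
  then have "compat_cocycle \<Omega> F z" by (simp add: z_def[abs_def])
  moreover have "z (z a \<omega>) \<omega> = a" if a: "a \<in> F" "\<omega> \<in> \<Omega>" for a \<omega>
  proof -
    have La: "L a \<in> G" "L a b = b" "\<sigma> (L a) b = a" using L a by auto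
    show ?thesis using flip_conj[OF La(1,2) a(2)] z a La(3) by (metis z_def)
  qed
  ultimately have "involutive_cocycle \<Omega> F z" unfolding involutive_cocycle_def by blast
  moreover have "univ_group T l b 2 (Gamma1 T l \<Omega> b F z) = G"
    unfolding Gamma1_def
  proof (intro equalityI subsetI)
    fix g assume g: "g \<in> G"
    have "(\<sigma> (locaut b g x) b, \<lambda>\<omega>\<in>\<Omega>. \<sigma> (locaut b g x) (nb b \<omega>)) \<in> {(a, \<lambda>\<omega>\<in>\<Omega>. z a \<omega>) |a. a \<in> F}"
      if x: "x \<in> V" for x
    proof -
      have h: "locaut b g x \<in> G" "locaut b g x b = b" using g x locaut_G by auto
      then have "(\<lambda>\<omega>\<in>\<Omega>. \<sigma> (locaut b g x) (nb b \<omega>)) = (\<lambda>\<omega>\<in>\<Omega>. z (\<sigma> (locaut b g x) b) \<omega>)"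
        using z by (intro restrict_ext) simp
      then show ?thesis using h by auto
    qed
    then show "g \<in> univ_group T l b 2 (of_pairs T l \<Omega> b {(a, \<lambda>\<omega>\<in>\<Omega>. z a \<omega>) |a. a \<in> F})"
      using g by (simp add: univ_of_pairs_iff)
  next
    fix g assume g: "g \<in> univ_group T l b 2 (of_pairs T l \<Omega> b {(a, \<lambda>\<omega>\<in>\<Omega>. z a \<omega>) |a. a \<in> F})"
    then have gA: "g \<in> carrier A" using univ_of_pairs_iff[OF b_in] by blast
    have rigid using triv unfolding rigid_def by blast
    then show "g \<in> G"
    proof (rule rigid_two_closed[OF _ gA])
      fix x assume x: "x \<in> V"
      let ?h = "locaut b g x"
      have h: "?h \<in> carrier A" "?h b = b" using gA x by auto
      have "(\<sigma> ?h b, \<lambda>\<omega>\<in>\<Omega>. \<sigma> ?h (nb b \<omega>)) \<in> {(a, \<lambda>\<omega>\<in>\<Omega>. z a \<omega>) |a. a \<in> F}"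
        using g[unfolded univ_of_pairs_iff[OF b_in]] x by (metis (no_types, lifting))
      then have aF: "\<sigma> ?h b \<in> F" and eq: "(\<lambda>\<omega>\<in>\<Omega>. \<sigma> ?h (nb b \<omega>)) = (\<lambda>\<omega>\<in>\<Omega>. z (\<sigma> ?h b) \<omega>)" by auto
      have L': "L (\<sigma> ?h b) \<in> G" "L (\<sigma> ?h b) b = b" "\<sigma> (L (\<sigma> ?h b)) b = \<sigma> ?h b" using L aF by auto
      have "\<sigma> ?h (nb b \<omega>) = \<sigma> (L (\<sigma> ?h b)) (nb b \<omega>)" if "\<omega> \<in> \<Omega>" for \<omega>
        using fun_cong[OF eq, of \<omega>] that by (simp add: z_def)
      then have "?h y = L (\<sigma> ?h b) y" if "y \<in> B b 2" for y
        using agree_two[OF h(1) G_A[OF L'(1)] b_in _ _ _ that] h L' by simp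
      then show "\<exists>h\<in>G. \<forall>y\<in>B x 2. g y = h y" using agree_from_locaut[OF gA x L'(1)] by blast
    qed
  qed
  ultimately show ?thesis by blast
qed

end

section \<open>Diagonal kernel\<close>

context locally_closed_group
begin

text \<open>
  The stabilizer of \<open>b\<close> normalizes \<open>K\<close> and permutes pairs of distinct labels transitively, so the
  dependence between two neighbours of \<open>b\<close> carries over to any other two.
\<close>

lemma linked_imp_rigid:
  assumes \<omega>: "\<omega>\<^sub>1 \<in> \<Omega>" "\<omega>\<^sub>2 \<in> \<Omega>" "\<omega>\<^sub>1 \<noteq> \<omega>\<^sub>2"
    and linked: "\<And>h. h \<in> K \<Longrightarrow> \<sigma> h (nb b \<omega>\<^sub>2) = idP \<Longrightarrow> \<sigma> h (nb b \<omega>\<^sub>1) = idP"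
  shows rigid
  unfolding rigid_def
proof (intro ballI impI)
  fix h \<omega> assume h: "h \<in> K" and \<omega>': "\<omega> \<in> \<Omega>" and ex: "\<exists>\<omega>\<in>\<Omega>. \<sigma> h (nb b \<omega>) = idP"
  obtain \<omega>' where o: "\<omega>' \<in> \<Omega>" "\<sigma> h (nb b \<omega>') = idP" using ex by blast
  show "\<sigma> h (nb b \<omega>) = idP"
  proof (cases "\<omega> = \<omega>'")
    case False
    obtain a where a: "a \<in> F" "a \<omega> = \<omega>\<^sub>1" "a \<omega>' = \<omega>\<^sub>2" using F_two_trans[OF \<omega>' o(1) \<omega>(1,2) False \<omega>(3)] by blast
    obtain g where g: "g \<in> G" "g b = b" "\<sigma> g b = a" using lift[OF a(1)] by blast
    let ?h = "g \<cdot> h \<cdot> inv\<^bsub>A\<^esub> g"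
    have "\<sigma> ?h (nb b \<omega>\<^sub>2) = idP" using K_conj_sigma[OF g(1,2) h o(1)] g(1,3) a o by (simp add: conj_eq_one)
    then have "\<sigma> ?h (nb b \<omega>\<^sub>1) = idP" using linked K_conj[OF g(1,2) h] by blast
    then show ?thesis
      using K_conj_sigma[OF g(1,2) h \<omega>'] conj_eq_one[of "\<sigma> g (nb b \<omega>)" "\<sigma> h (nb b \<omega>)"] g(1,3) h a \<omega>' by simp
  qed (use o in simp)
qed

lemma rigidD: "rigid \<Longrightarrow> h \<in> K \<Longrightarrow> \<omega> \<in> \<Omega> \<Longrightarrow> \<omega>' \<in> \<Omega> \<Longrightarrow> \<sigma> h (nb b \<omega>) = idP \<Longrightarrow> \<sigma> h (nb b \<omega>') = idP"
  unfolding rigid_def by blast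

lemma rigid_eqD:
  assumes rigid and h: "h \<in> K" "h' \<in> K" and \<omega>: "\<omega> \<in> \<Omega>" "\<omega>' \<in> \<Omega>" and eq: "\<sigma> h (nb b \<omega>) = \<sigma> h' (nb b \<omega>)"
  shows "\<sigma> h (nb b \<omega>') = \<sigma> h' (nb b \<omega>')"
proof -
  have s: "\<sigma> (inv\<^bsub>A\<^esub> h \<cdot> h') (nb b v) = inv\<^bsub>P\<^esub> (\<sigma> h (nb b v)) \<star> \<sigma> h' (nb b v)" if "v \<in> \<Omega>" for v
    using h that sigma_inv[of h "nb b v"] by (simp add: sigma_mult)
  have "inv\<^bsub>A\<^esub> h \<cdot> h' \<in> K" using h K_closed by blast
  then have "inv\<^bsub>P\<^esub> (\<sigma> h (nb b \<omega>')) \<star> \<sigma> h' (nb b \<omega>') = idP"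
    using rigidD[OF \<open>rigid\<close> _ \<omega>, of "inv\<^bsub>A\<^esub> h \<cdot> h'"] s \<omega> eq h by simp
  then have "\<sigma> h (nb b \<omega>') \<star> idP = \<sigma> h' (nb b \<omega>')"
    using P.inv_solve_left[of "idP" "\<sigma> h (nb b \<omega>')" "\<sigma> h' (nb b \<omega>')"] h \<omega> by simp
  then show ?thesis using h \<omega> by simp
qed

text \<open>
  The centralizer of \<open>K\<close> in the stabilizer of \<open>b\<close>, as far as the action on the ball of radius two is
  concerned. At \<open>b\<close> itself the local permutations always commute, since those of \<open>K\<close> are trivial.
\<close>

definition C where "C = {c \<in> G. c b = b \<and> (\<forall>h\<in>K. \<forall>\<omega>\<in>\<Omega>. \<sigma> (c \<cdot> h) (nb b \<omega>) = \<sigma> (h \<cdot> c) (nb b \<omega>))}"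

lemma CI: "c \<in> G \<Longrightarrow> c b = b \<Longrightarrow> (\<And>h \<omega>. h \<in> K \<Longrightarrow> \<omega> \<in> \<Omega> \<Longrightarrow> \<sigma> (c \<cdot> h) (nb b \<omega>) = \<sigma> (h \<cdot> c) (nb b \<omega>)) \<Longrightarrow> c \<in> C"
  by (simp add: C_def)
lemma C_G: "c \<in> C \<Longrightarrow> c \<in> G" and C_b: "c \<in> C \<Longrightarrow> c b = b"
  and C_commute: "c \<in> C \<Longrightarrow> h \<in> K \<Longrightarrow> \<omega> \<in> \<Omega> \<Longrightarrow> \<sigma> (c \<cdot> h) (nb b \<omega>) = \<sigma> (h \<cdot> c) (nb b \<omega>)"
  by (simp_all add: C_def)

lemma C_mult: assumes c: "c \<in> C" "c' \<in> C" shows "c \<cdot> c' \<in> C"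
proof (rule CI)
  note cs = C_G[OF c(1)] C_G[OF c(2)] C_b[OF c(1)] C_b[OF c(2)]
  show "c \<cdot> c' \<in> G" "(c \<cdot> c') b = b" using cs by auto
  fix h \<omega> assume h: "h \<in> K" and \<omega>: "\<omega> \<in> \<Omega>"
  let ?\<omega> = "\<sigma> c' b \<omega>"
  have im: "c' (nb b \<omega>) = nb b ?\<omega>" "?\<omega> \<in> \<Omega>" using nb_image[OF cs(2,4) \<omega>] cs \<omega> by auto
  have hA: "h \<in> carrier A" "c \<in> carrier A" "c' \<in> carrier A" using h cs by auto
  have "\<sigma> (c \<cdot> c' \<cdot> h) (nb b \<omega>) = \<sigma> (c \<cdot> (c' \<cdot> h)) (nb b \<omega>)" using hA by (simp add: A.m_assoc)
  also have "\<dots> = \<sigma> c (nb b ?\<omega>) \<star> \<sigma> (c' \<cdot> h) (nb b \<omega>)"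
    using sigma_mult[of c "c' \<cdot> h" "nb b \<omega>"] hA h \<omega> im by simp
  also have "\<dots> = \<sigma> c (nb b ?\<omega>) \<star> \<sigma> (h \<cdot> c') (nb b \<omega>)" using C_commute[OF c(2) h \<omega>] by simp
  also have "\<dots> = \<sigma> (c \<cdot> h) (nb b ?\<omega>) \<star> \<sigma> c' (nb b \<omega>)"
    using hA h \<omega> im by (simp add: sigma_mult P.m_assoc)
  also have "\<dots> = \<sigma> (h \<cdot> c) (nb b ?\<omega>) \<star> \<sigma> c' (nb b \<omega>)" using C_commute[OF c(1) h im(2)] by simp
  also have "\<dots> = \<sigma> (h \<cdot> c \<cdot> c') (nb b \<omega>)"
    using sigma_mult[of "h \<cdot> c" c' "nb b \<omega>"] hA \<omega> im by simp
  also have "\<dots> = \<sigma> (h \<cdot> (c \<cdot> c')) (nb b \<omega>)" using hA by (simp add: A.m_assoc)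
  finally show "\<sigma> (c \<cdot> c' \<cdot> h) (nb b \<omega>) = \<sigma> (h \<cdot> (c \<cdot> c')) (nb b \<omega>)" .
qed

context
  fixes \<omega>\<^sub>0 :: 'b
  assumes rigid: rigid and \<omega>\<^sub>0: "\<omega>\<^sub>0 \<in> \<Omega>"
    and onto: "\<And>\<omega> a. \<omega> \<in> \<Omega> \<Longrightarrow> a \<in> St \<omega> \<Longrightarrow> \<exists>h\<in>K. \<sigma> h (nb b \<omega>) = a"
begin

text \<open>
  Over a point stabilizer \<open>F\<^sub>\<omega>\<close> one can correct a lift by an element of \<open>K\<close> so that it becomes trivial
  around \<open>b\<^sub>\<omega>\<close>; by rigidity it then commutes with \<open>K\<close> around every neighbour.
\<close>

lemma C_lift_stab:
  assumes \<omega>: "\<omega> \<in> \<Omega>" and a: "a \<in> St \<omega>" shows "\<exists>c\<in>C. \<sigma> c b = a"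
proof -
  obtain g where g: "g \<in> G" "g b = b" "\<sigma> g b = a" using lift[OF St_F[OF a]] by blast
  have gnb: "g (nb b \<omega>) = nb b \<omega>" using nb_image[OF g(1,2) \<omega>] g St_fix[OF a] by simp
  then have "\<sigma> g (nb b \<omega>) \<in> St \<omega>" using sigma_St[of g "nb b \<omega>" \<omega>] g \<omega> by simp
  then obtain h0 where h0: "h0 \<in> K" "\<sigma> h0 (nb b \<omega>) = \<sigma> g (nb b \<omega>)" using onto \<omega> by blast
  define c where "c = g \<cdot> inv\<^bsub>A\<^esub> h0"
  have i: "inv\<^bsub>A\<^esub> h0 \<in> K" "\<sigma> (inv\<^bsub>A\<^esub> h0) (nb b \<omega>) = inv\<^bsub>P\<^esub> (\<sigma> g (nb b \<omega>))"
    using K_closed h0 sigma_inv[of h0 "nb b \<omega>"] \<omega> by auto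
  have c: "c \<in> G" "c b = b" "\<sigma> c b = a" using g i(1) by (auto simp: c_def sigma_mult)
  have c\<omega>: "\<sigma> c (nb b \<omega>) = idP" "\<sigma> c b \<omega> = \<omega>" using g i \<omega> St_fix[OF a] c(3) by (auto simp: c_def sigma_mult)
  have "c \<in> C"
  proof (rule CI[OF c(1,2)])
    fix h \<omega>' assume h: "h \<in> K" and \<omega>': "\<omega>' \<in> \<Omega>"
    define q where "q = c \<cdot> h \<cdot> inv\<^bsub>A\<^esub> c"
    have q: "q \<in> K" unfolding q_def by (rule K_conj[OF c(1,2) h])
    have "\<sigma> q (nb b \<omega>) = \<sigma> h (nb b \<omega>)"
      using K_conj_sigma[OF c(1,2) h \<omega>] c\<omega> h \<omega> by (simp add: q_def)
    then have q': "\<sigma> q (nb b v) = \<sigma> h (nb b v)" if "v \<in> \<Omega>" for v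
      using rigid_eqD[OF rigid q h \<omega> that] by simp
    have "c \<cdot> h = q \<cdot> c" using c h by (simp add: q_def A.m_assoc)
    moreover have "\<sigma> c b \<omega>' \<in> \<Omega>" using c(1) \<omega>' by simp
    ultimately show "\<sigma> (c \<cdot> h) (nb b \<omega>') = \<sigma> (h \<cdot> c) (nb b \<omega>')"
      using c(1) h q \<omega>' nb_image[OF c(1,2) \<omega>'] q'[of "\<sigma> c b \<omega>'"] by (simp add: sigma_mult)
  qed
  then show ?thesis using c by blast
qed

lemma C_lift: assumes a: "a \<in> F" shows "\<exists>c\<in>C. \<sigma> c b = a"
proof -
  \<comment> \<open>Three labels and 2-transitivity: \<open>F\<close> is a product of two point stabilizers.\<close>
  obtain \<omega>'' where o: "\<omega>'' \<in> \<Omega>" "\<omega>'' \<noteq> \<omega>\<^sub>0" "\<omega>'' \<noteq> a \<omega>\<^sub>0" using exists_label by blast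
  obtain e where e: "e \<in> F" "e \<omega>'' = \<omega>''" "e \<omega>\<^sub>0 = a \<omega>\<^sub>0"
    using F_two_trans[of \<omega>'' \<omega>\<^sub>0 \<omega>'' "a \<omega>\<^sub>0"] o \<omega>\<^sub>0 a by auto
  have eP: "e \<in> carrier P" "a \<in> carrier P" "inv\<^bsub>P\<^esub> e \<in> carrier P" using e a by auto
  have "inv\<^bsub>P\<^esub> e \<star> a \<in> F" using e a by auto
  moreover have "(inv\<^bsub>P\<^esub> e) (e \<omega>\<^sub>0) = \<omega>\<^sub>0" using eP \<omega>\<^sub>0 by simp
  then have "(inv\<^bsub>P\<^esub> e \<star> a) \<omega>\<^sub>0 = \<omega>\<^sub>0" using eP \<omega>\<^sub>0 e(3) by simp
  ultimately have "inv\<^bsub>P\<^esub> e \<star> a \<in> St \<omega>\<^sub>0" by (rule StI)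
  then obtain c where c: "c \<in> C" "\<sigma> c b = inv\<^bsub>P\<^esub> e \<star> a" using C_lift_stab[OF \<omega>\<^sub>0] by blast
  obtain c' where c': "c' \<in> C" "\<sigma> c' b = e" using C_lift_stab[OF o(1)] e StI by blast
  have "\<sigma> (c' \<cdot> c) b = e \<star> (inv\<^bsub>P\<^esub> e \<star> a)"
    using c(2) c'(2) C_G[OF c(1)] C_G[OF c'(1)] C_b[OF c(1)] by (simp add: sigma_mult)
  also have "\<dots> = a" using eP by (simp flip: P.m_assoc)
  finally show ?thesis using C_mult[OF c'(1) c(1)] by blast
qed

text \<open>An element of \<open>K\<close> that commutes with \<open>K\<close> is central in \<open>F\<^sub>\<omega>\<close> around \<open>b\<^sub>\<omega>\<close>, so it is trivial there.\<close>

lemma C_determined: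
  assumes c: "c \<in> C" "c' \<in> C" "\<sigma> c b = \<sigma> c' b" and \<omega>: "\<omega> \<in> \<Omega>"
  shows "\<sigma> c (nb b \<omega>) = \<sigma> c' (nb b \<omega>)"
proof -
  note cs = C_G[OF c(1)] C_G[OF c(2)] C_b[OF c(1)] C_b[OF c(2)]
  define q where "q = inv\<^bsub>A\<^esub> c \<cdot> c'"
  have q: "q \<in> K"
    using cs c(3) inv_base[of c b] sigma_inv[of c b] unfolding q_def by (intro KI) (simp_all add: sigma_mult)
  have c': "c' = c \<cdot> q" using cs by (simp add: q_def flip: A.m_assoc)
  have sc': "\<sigma> c' (nb b \<omega>) = \<sigma> c (nb b \<omega>) \<star> \<sigma> q (nb b \<omega>)" using c' cs q \<omega> by (simp add: sigma_mult)
  have "\<sigma> q (nb b \<omega>) \<star> x = x \<star> \<sigma> q (nb b \<omega>)" if x: "x \<in> St \<omega>" for x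
  proof -
    obtain h where h: "h \<in> K" "\<sigma> h (nb b \<omega>) = x" using onto[OF \<omega> x] by blast
    have P: "\<sigma> c (nb b \<omega>) \<in> carrier P" "\<sigma> q (nb b \<omega>) \<in> carrier P" "x \<in> carrier P"
      using cs q \<omega> St_P[OF x] by auto
    have cnb: "c' (nb b \<omega>) = c (nb b \<omega>)"
      using nb_image[of c \<omega>] nb_image[of c' \<omega>] cs c(3) \<omega> by simp
    have "\<sigma> c (nb b \<omega>) \<star> \<sigma> q (nb b \<omega>) \<star> x = \<sigma> (c' \<cdot> h) (nb b \<omega>)"
      using sigma_mult[of c' h "nb b \<omega>"] sc' h cs \<omega> by simp
    also have "\<dots> = \<sigma> (h \<cdot> c') (nb b \<omega>)" by (rule C_commute[OF c(2) h(1) \<omega>])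
    also have "\<dots> = \<sigma> h (c (nb b \<omega>)) \<star> (\<sigma> c (nb b \<omega>) \<star> \<sigma> q (nb b \<omega>))"
      using sigma_mult[of h c' "nb b \<omega>"] sc' cnb h cs \<omega> by simp
    also have "\<dots> = \<sigma> (h \<cdot> c) (nb b \<omega>) \<star> \<sigma> q (nb b \<omega>)"
      using sigma_mult[of h c "nb b \<omega>"] h cs \<omega> P by (simp add: P.m_assoc)
    also have "\<dots> = \<sigma> (c \<cdot> h) (nb b \<omega>) \<star> \<sigma> q (nb b \<omega>)" using C_commute[OF c(1) h(1) \<omega>] by simp
    also have "\<dots> = \<sigma> c (nb b \<omega>) \<star> x \<star> \<sigma> q (nb b \<omega>)"
      using sigma_mult[of c h "nb b \<omega>"] h cs \<omega> by simp
    finally show ?thesis using P by (simp add: P.m_assoc)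
  qed
  then have "\<sigma> q (nb b \<omega>) = idP" using St_centre[OF \<omega> K_sigma_St[OF q \<omega>]] by blast
  then show ?thesis using sc' cs \<omega> by simp
qed

text \<open>
  Hence the stabilizer of \<open>b\<close> acts on the ball of radius two as the product of \<open>K\<close>, a diagonal copy of a
  point stabilizer, and of the commuting group given by \<open>C\<close>, which defines the cocycle.
\<close>

lemma D2_is_Delta: "is_Delta T l \<Omega> b \<omega>\<^sub>0 F D2"
proof -
  obtain L where L: "\<And>a. a \<in> F \<Longrightarrow> L a \<in> C \<and> \<sigma> (L a) b = a" using C_lift by metis
  define z where "z a \<omega> = \<sigma> (L a) (nb b \<omega>)" for a \<omega>
  have z: "z (\<sigma> c b) \<omega> = \<sigma> c (nb b \<omega>)" if "c \<in> C" "\<omega> \<in> \<Omega>" for c \<omega>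
    using C_determined[of "L (\<sigma> c b)" c \<omega>] L[of "\<sigma> c b"] that C_G by (simp add: z_def)
  have LG: "L a \<in> G" "L a b = b" "\<sigma> (L a) b = a" if "a \<in> F" for a using L[OF that] C_G C_b by auto
  obtain M where M: "\<And>a. a \<in> St \<omega>\<^sub>0 \<Longrightarrow> M a \<in> K \<and> \<sigma> (M a) (nb b \<omega>\<^sub>0) = a" using onto[OF \<omega>\<^sub>0] by metis
  define \<alpha> where "\<alpha> \<omega> a = \<sigma> (M a) (nb b \<omega>)" for \<omega> a
  have \<alpha>: "\<alpha> \<omega> (\<sigma> h (nb b \<omega>\<^sub>0)) = \<sigma> h (nb b \<omega>)" if h: "h \<in> K" "\<omega> \<in> \<Omega>" for h \<omega>
    unfolding \<alpha>_def using rigid_eqD[OF rigid _ h(1) \<omega>\<^sub>0 h(2), of "M (\<sigma> h (nb b \<omega>\<^sub>0))"] M[OF K_sigma_St[OF h(1) \<omega>\<^sub>0]] by blast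
  have "compat_cocycle \<Omega> F (\<lambda>a \<omega>. \<sigma> (L a) (nb b \<omega>))"
  proof (rule cocycle_of_lifts)
    show "L a \<in> G \<and> L a b = b \<and> \<sigma> (L a) b = a" if "a \<in> F" for a using LG[OF that] by blast
    fix a c \<omega> assume a: "a \<in> F" "c \<in> F" "\<omega> \<in> \<Omega>"
    have "L a \<cdot> L c \<in> C" "\<sigma> (L a \<cdot> L c) b = a \<star> c"
      using LG L a C_mult by (auto simp: sigma_mult)
    then show "\<sigma> (L (a \<star> c)) (nb b \<omega>) = \<sigma> (L a \<cdot> L c) (nb b \<omega>)"
      using z[of "L a \<cdot> L c" \<omega>] a(3) by (simp add: z_def)
  qed
  then have cocycle: "compat_cocycle \<Omega> F z" by (simp add: z_def[abs_def])
  have iso: "\<alpha> \<omega> \<in> iso (S \<omega>\<^sub>0) (S \<omega>)" if \<omega>: "\<omega> \<in> \<Omega>" for \<omega>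
  proof -
    have "\<alpha> \<omega> \<in> hom (S \<omega>\<^sub>0) (S \<omega>)"
    proof (rule homI)
      fix x assume "x \<in> carrier (S \<omega>\<^sub>0)"
      then show "\<alpha> \<omega> x \<in> carrier (S \<omega>)" using M K_sigma_St \<omega> by (simp add: \<alpha>_def)
      fix y assume "y \<in> carrier (S \<omega>\<^sub>0)"
      then have m: "M x \<in> K" "\<sigma> (M x) (nb b \<omega>\<^sub>0) = x" "M y \<in> K" "\<sigma> (M y) (nb b \<omega>\<^sub>0) = y"
        using M \<open>x \<in> carrier (S \<omega>\<^sub>0)\<close> by auto
      then have s: "\<sigma> (M x \<cdot> M y) (nb b v) = \<sigma> (M x) (nb b v) \<star> \<sigma> (M y) (nb b v)" if "v \<in> \<Omega>" for v
        using that by (simp add: sigma_mult)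
      show "\<alpha> \<omega> (x \<otimes>\<^bsub>S \<omega>\<^sub>0\<^esub> y) = \<alpha> \<omega> x \<otimes>\<^bsub>S \<omega>\<^esub> \<alpha> \<omega> y"
        using \<alpha>[OF K_closed(1)[OF m(1,3)] \<omega>] s[OF \<omega>] s[OF \<omega>\<^sub>0] m by (simp add: \<alpha>_def)
    qed
    moreover have "bij_betw (\<alpha> \<omega>) (St \<omega>\<^sub>0) (St \<omega>)"
    proof (rule bij_betwI')
      fix x y assume x: "x \<in> St \<omega>\<^sub>0" and y: "y \<in> St \<omega>\<^sub>0"
      show "\<alpha> \<omega> x = \<alpha> \<omega> y \<longleftrightarrow> x = y"
        using rigid_eqD[OF rigid _ _ \<omega> \<omega>\<^sub>0, of "M x" "M y"] M[OF x] M[OF y] by (auto simp: \<alpha>_def)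
    next
      fix x assume "x \<in> St \<omega>\<^sub>0" then show "\<alpha> \<omega> x \<in> St \<omega>" using M K_sigma_St \<omega> by (simp add: \<alpha>_def)
    next
      fix y assume "y \<in> St \<omega>"
      then obtain h where "h \<in> K" "\<sigma> h (nb b \<omega>) = y" using onto \<omega> by blast
      then show "\<exists>x\<in>St \<omega>\<^sub>0. y = \<alpha> \<omega> x" using \<alpha>[OF _ \<omega>] K_sigma_St[OF _ \<omega>\<^sub>0] by (metis (no_types))
    qed
    ultimately show ?thesis by (simp add: iso_def)
  qed
  let ?R = "\<lambda>g. (\<sigma> g b, \<lambda>\<omega>\<in>\<Omega>. \<sigma> g (nb b \<omega>))"
  have real: "realization T l \<Omega> b (restrict g (B b 2)) = ?R g" for g
    by (rule realization_restrict) simp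
  have unique: "x = restrict g (B b 2)"
    if "x \<in> carrier (Aut (graph_ball T b 2))" "realization T l \<Omega> b x = ?R g" "g \<in> G" "g b = b" for x g
    using ball_two_determined[of x b "restrict g (B b 2)"] restrict_aut_ball[of g b 2] that real[of g] by simp
  have z\<alpha>: "compose \<Omega> (z a \<omega>) (\<alpha> \<omega> a\<^sub>0) = \<sigma> (L a \<cdot> M a\<^sub>0) (nb b \<omega>)"
    if "a \<in> F" "a\<^sub>0 \<in> St \<omega>\<^sub>0" "\<omega> \<in> \<Omega>" for a a\<^sub>0 \<omega>
  proof -
    have m: "M a\<^sub>0 \<in> K" using M that by blast
    have "z a \<omega> \<in> carrier P" "\<alpha> \<omega> a\<^sub>0 \<in> carrier P" using LG that m by (auto simp: z_def \<alpha>_def)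
    then show ?thesis using LG[OF that(1)] m that(3) by (simp add: z_def \<alpha>_def sigma_mult flip: P_mult_compose)
  qed
  have D: "D2 = of_pairs T l \<Omega> b
      {(a, \<lambda>\<omega>\<in>\<Omega>. compose \<Omega> (z a \<omega>) (\<alpha> \<omega> a\<^sub>0)) | a a\<^sub>0. a \<in> F \<and> a\<^sub>0 \<in> St \<omega>\<^sub>0}" (is "_ = of_pairs T l \<Omega> b ?X")
  proof (intro equalityI subsetI)
    fix x assume "x \<in> D2"
    then obtain g where g: "g \<in> G" "g b = b" "x = restrict g (B b 2)" unfolding D2_def by blast
    let ?a = "\<sigma> g b"
    have a: "?a \<in> F" using g by simp
    define q where "q = inv\<^bsub>A\<^esub> (L ?a) \<cdot> g"
    have q: "q \<in> K"
      using g LG[OF a] inv_base[of "L ?a" b] sigma_inv[of "L ?a" b] unfolding q_def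
      by (intro KI) (simp_all add: sigma_mult)
    have gq: "g = L ?a \<cdot> q" using g LG[OF a] by (simp add: q_def flip: A.m_assoc)
    let ?s = "\<sigma> q (nb b \<omega>\<^sub>0)"
    have a0: "?s \<in> St \<omega>\<^sub>0" by (rule K_sigma_St[OF q \<omega>\<^sub>0])
    have "\<sigma> g (nb b \<omega>) = compose \<Omega> (z ?a \<omega>) (\<alpha> \<omega> ?s)" if \<omega>: "\<omega> \<in> \<Omega>" for \<omega>
    proof -
      have "\<sigma> (L ?a \<cdot> q) (nb b \<omega>) = z ?a \<omega> \<star> \<alpha> \<omega> ?s"
        using LG[OF a] q \<omega> \<alpha>[OF q \<omega>] by (simp add: sigma_mult z_def)
      moreover have "z ?a \<omega> \<in> carrier P" "\<alpha> \<omega> ?s \<in> carrier P"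
        using LG[OF a] q \<omega> \<alpha>[OF q \<omega>] by (auto simp: z_def)
      ultimately show ?thesis using gq by (simp add: P_mult_compose)
    qed
    then have "(\<lambda>\<omega>\<in>\<Omega>. \<sigma> g (nb b \<omega>)) = (\<lambda>\<omega>\<in>\<Omega>. compose \<Omega> (z ?a \<omega>) (\<alpha> \<omega> ?s))" by (rule restrict_ext)
    then have "realization T l \<Omega> b x \<in> ?X" using real[of g] g(3) a a0 by auto
    then show "x \<in> of_pairs T l \<Omega> b ?X" using restrict_aut_ball[of g b 2] g by (simp add: of_pairs_def)
  next
    fix x assume "x \<in> of_pairs T l \<Omega> b ?X"
    then obtain a a\<^sub>0 where x: "x \<in> carrier (Aut (graph_ball T b 2))" and a: "a \<in> F" "a\<^sub>0 \<in> St \<omega>\<^sub>0"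
      and eq: "realization T l \<Omega> b x = (a, \<lambda>\<omega>\<in>\<Omega>. compose \<Omega> (z a \<omega>) (\<alpha> \<omega> a\<^sub>0))"
      unfolding of_pairs_def by blast
    let ?g = "L a \<cdot> M a\<^sub>0"
    have m: "M a\<^sub>0 \<in> K" using M a by blast
    have g: "?g \<in> G" "?g b = b" "\<sigma> ?g b = a" using LG[OF a(1)] m a(1) by (auto simp: sigma_mult)
    have "realization T l \<Omega> b x = ?R ?g" using eq g(3) z\<alpha>[OF a] by (auto intro: restrict_ext)
    then show "x \<in> D2" using unique[OF x _ g(1,2)] g unfolding D2_def by blast
  qed
  have commute: "\<beta> \<otimes>\<^bsub>Aut (graph_ball T b 2)\<^esub> \<gamma> = \<gamma> \<otimes>\<^bsub>Aut (graph_ball T b 2)\<^esub> \<beta>"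
    if \<beta>: "\<beta> \<in> of_pairs T l \<Omega> b {(a, \<lambda>\<omega>\<in>\<Omega>. z a \<omega>) | a. a \<in> F}"
    and \<gamma>: "\<gamma> \<in> of_pairs T l \<Omega> b {(\<lambda>\<omega>\<in>\<Omega>. \<omega>, \<lambda>\<omega>\<in>\<Omega>. \<alpha> \<omega> a\<^sub>0) | a\<^sub>0. a\<^sub>0 \<in> St \<omega>\<^sub>0}" for \<beta> \<gamma>
  proof -
    obtain a where a: "a \<in> F" "\<beta> \<in> carrier (Aut (graph_ball T b 2))"
      "realization T l \<Omega> b \<beta> = (a, \<lambda>\<omega>\<in>\<Omega>. z a \<omega>)" using \<beta> unfolding of_pairs_def by blast
    obtain a\<^sub>0 where a0: "a\<^sub>0 \<in> St \<omega>\<^sub>0" "\<gamma> \<in> carrier (Aut (graph_ball T b 2))"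
      "realization T l \<Omega> b \<gamma> = (\<lambda>\<omega>\<in>\<Omega>. \<omega>, \<lambda>\<omega>\<in>\<Omega>. \<alpha> \<omega> a\<^sub>0)" using \<gamma> unfolding of_pairs_def by blast
    have m: "M a\<^sub>0 \<in> K" using M a0 by blast
    have Lc: "L a \<in> C" using L a by blast
    have \<beta>': "\<beta> = restrict (L a) (B b 2)"
      using unique[OF a(2) _ LG(1,2)[OF a(1)]] a(3) LG(3)[OF a(1)] by (simp add: z_def)
    have \<gamma>': "\<gamma> = restrict (M a\<^sub>0) (B b 2)"
      using unique[OF a0(2) _ K_G[OF m] K_b[OF m]] a0(3) K_sigma_b[OF m] by (simp add: \<alpha>_def P_one)
    have "(L a \<cdot> M a\<^sub>0) y = (M a\<^sub>0 \<cdot> L a) y" if "y \<in> B b 2" for y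
      by (rule agree_two[OF _ _ b_in _ _ C_commute[OF Lc m] that])
        (use LG[OF a(1)] m a(1) in \<open>auto simp: sigma_mult\<close>)
    then have "restrict (L a \<cdot> M a\<^sub>0) (B b 2) = restrict (M a\<^sub>0 \<cdot> L a) (B b 2)" by (rule restrict_ext)
    then show ?thesis using \<beta>' \<gamma>' restrict_mult_ball LG[OF a(1)] m by simp
  qed
  show ?thesis
    unfolding is_Delta_def using D2_subgroup D2_condition_C cocycle iso D commute by blast
qed

end

end

section \<open>Full kernel\<close>

context labelled_regular_tree
begin

definition sph where "sph x n = {y \<in> V. length (word x y) = n}"

text \<open>For \<open>y \<noteq> x\<close>, the label of the edge from \<open>y\<close> towards \<open>x\<close>.\<close>

definition up where "up x y = last (word x y)"
abbreviation parent where "parent x y \<equiv> nb y (up x y)"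

lemma sph_V: "y \<in> sph x n \<Longrightarrow> y \<in> V" by (simp add: sph_def)
lemma sph_B: "y \<in> sph x n \<Longrightarrow> y \<in> B x n" by (simp add: sph_def B_def)

lemma finite_B: assumes "x \<in> V" shows "finite (B x n)"
proof -
  have "B x n \<subseteq> walk x ` {w. set w \<subseteq> \<Omega> \<and> length w \<le> n}"
  proof
    fix y assume y: "y \<in> B x n"
    then have "walk x (word x y) = y" "set (word x y) \<subseteq> \<Omega>" "length (word x y) \<le> n"
      using assms B_inV[OF y] word_subset by (auto simp: B_def)
    then show "y \<in> walk x ` {w. set w \<subseteq> \<Omega> \<and> length w \<le> n}" by (metis (mono_tags) image_eqI mem_Collect_eq)
  qed
  then show ?thesis using finite_lists_length_le[OF fin] by (meson finite_imageI finite_subset)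
qed

lemma up_in: "x \<in> V \<Longrightarrow> y \<in> V \<Longrightarrow> y \<noteq> x \<Longrightarrow> up x y \<in> \<Omega>"
  unfolding up_def using word_subset[of x y] word_Nil_iff[of x y] last_in_set by blast

lemma parent_word:
  assumes "x \<in> V" "y \<in> V" "y \<noteq> x"
  shows "word x (parent x y) = butlast (word x y)" "parent x y \<in> V" "nb (parent x y) (up x y) = y"
  using assms up_in[OF assms] word_Nil_iff[of x y] word_snoc[of x y "up x y"] by (auto simp: up_def)

lemma sph_Suc_parent:
  assumes "x \<in> V" "y \<in> sph x (Suc n)"
  shows "parent x y \<in> sph x n" "up x y \<in> \<Omega>" "nb (parent x y) (up x y) = y" "y \<in> V" "parent x y \<in> V"
    "word x y = word x (parent x y) @ [up x y]"
proof -
  have y: "y \<in> V" "y \<noteq> x" using assms by (auto simp: sph_def)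
  note p = parent_word[OF assms(1) y]
  show "parent x y \<in> sph x n" using p assms by (simp add: sph_def)
  show "up x y \<in> \<Omega>" "nb (parent x y) (up x y) = y" "y \<in> V" "parent x y \<in> V" using p y up_in assms by auto
  have "word x y \<noteq> []" using y assms word_Nil_iff by blast
  then show "word x y = word x (parent x y) @ [up x y]" using p(1) by (simp add: up_def)
qed

lemma B_Suc_cases: "y \<in> B x (Suc n) \<longleftrightarrow> y \<in> B x n \<or> y \<in> sph x (Suc n)"
  by (auto simp: B_def sph_def)

lemma sph_one: "x \<in> V \<Longrightarrow> y \<in> sph x (Suc 0) \<longleftrightarrow> (\<exists>\<omega>\<in>\<Omega>. y = nb x \<omega>)"
  using B_1[of x y] by (auto simp: sph_def B_def word_Nil_iff) (metis nb_ne)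

lemma branch_iff: "x \<in> V \<Longrightarrow> \<omega> \<in> \<Omega> \<Longrightarrow> y \<in> sph x (Suc n) \<Longrightarrow> y \<in> sph (nb x \<omega>) n \<longleftrightarrow> hd (word x y) = \<omega>"
  using word_Cons[of x y \<omega>] by (auto simp: sph_def split: if_splits)

lemma aut_sph_fix: "g \<in> carrier A \<Longrightarrow> x \<in> V \<Longrightarrow> g x = x \<Longrightarrow> y \<in> V \<Longrightarrow> g y \<in> sph x n \<longleftrightarrow> y \<in> sph x n"
  using length_word_aut[of g x y] by (simp add: sph_def)

lemma fixes_next:
  assumes "g \<in> carrier A" "x \<in> V" "y \<in> sph x (Suc n)" "g (parent x y) = parent x y" "\<sigma> g (parent x y) = idP"
  shows "g y = y"
  using aut_nb[OF assms(1) sph_Suc_parent(5,2)[OF assms(2,3)]] sph_Suc_parent[OF assms(2,3)] assms(4,5) by simp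

end

context locally_closed_group
begin

text \<open>
  Independence of the local actions at a finite set \<open>L\<close> of ends of the set \<open>Z\<close>, given independence within
  each colour class. If the local actions at \<open>i\<close> and \<open>j\<close> of different colours were not independent, the
  one at \<open>i\<close> would be determined by the one at \<open>j\<close>, and also by the one at \<open>g j\<close> whenever \<open>g\<close> fixes \<open>i\<close>;
  but those at \<open>j\<close> and \<open>g j\<close>, if they have the same colour, are independent of each other.
\<close>

lemma independence_from_colour_classes:
  assumes L: "finite L" "L \<subseteq> Z" "Z \<subseteq> V" and u: "\<And>y. y \<in> L \<Longrightarrow> u y \<in> \<Omega> \<and> nb y (u y) \<in> Z"
    and one: "\<And>i s. i \<in> L \<Longrightarrow> (\<And>y. y \<in> L \<Longrightarrow> s y \<in> St (u y)) \<Longrightarrow>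
      \<exists>h\<in>G. (\<forall>x\<in>Z. h x = x) \<and> (\<forall>y\<in>L. col y = col i \<longrightarrow> \<sigma> h y = s y)"
    and move: "\<And>i j. i \<in> L \<Longrightarrow> j \<in> L \<Longrightarrow> col i \<noteq> col j \<Longrightarrow>
      \<exists>g\<in>G. (\<forall>x\<in>V. g x \<in> Z \<longleftrightarrow> x \<in> Z) \<and> g i = i \<and> g j \<noteq> j \<and> g j \<in> L \<and> col (g j) = col j"
    and s: "\<And>y. y \<in> L \<Longrightarrow> s y \<in> St (u y)"
  shows "\<exists>h\<in>G. (\<forall>x\<in>Z. h x = x) \<and> (\<forall>y\<in>L. \<sigma> h y = s y)"
proof -
  define Fx where "Fx = {h \<in> G. \<forall>x\<in>Z. h x = x}"
  have FxD: "h \<in> G" "x \<in> Z \<Longrightarrow> h x = x" if "h \<in> Fx" for h x using that by (auto simp: Fx_def)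
  have LV: "y \<in> V" if "y \<in> L" for y using that L by blast
  have Fx_closed: "g \<cdot> h \<in> Fx" "inv\<^bsub>A\<^esub> g \<in> Fx" "idA \<in> Fx" if "g \<in> Fx" "h \<in> Fx" for g h
  proof -
    have "(inv\<^bsub>A\<^esub> g) x = x" if "x \<in> Z" for x
      using inv_base[of g x] FxD[OF \<open>g \<in> Fx\<close>] that L by auto
    then show "inv\<^bsub>A\<^esub> g \<in> Fx" using FxD[OF that(1)] by (simp add: Fx_def)
    have "(g \<cdot> h) x = x" "idA x = x" if x: "x \<in> Z" for x
    proof -
      have "x \<in> V" using x L by blast
      then show "(g \<cdot> h) x = x" "idA x = x"
        using FxD(2)[OF \<open>g \<in> Fx\<close> x] FxD(2)[OF \<open>h \<in> Fx\<close> x] FxD(1)[OF \<open>g \<in> Fx\<close>] FxD(1)[OF \<open>h \<in> Fx\<close>] by simp_all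
    qed
    then show "g \<cdot> h \<in> Fx" "idA \<in> Fx"
      using FxD(1)[OF that(1)] FxD(1)[OF that(2)] by (simp_all add: Fx_def)
  qed
  have "idA \<in> Fx" using L by (auto simp: Fx_def subset_iff)
  then have "subgroup Fx A"
  proof (intro A.subgroupI)
    show "Fx \<subseteq> carrier A" using FxD(1) G_A by blast
  qed (use Fx_closed in blast)+
  then have H: "group (A\<lparr>carrier := Fx\<rparr>)" by (rule A.subgroup_imp_group)
  have sig: "\<sigma> h y \<in> St (u y)" if "h \<in> Fx" "y \<in> L" for h y
    using that u[OF that(2)] FxD[OF that(1)] L by (intro sigma_St) (auto simp: LV)
  have sigm: "\<sigma> (g \<cdot> h) y = \<sigma> g y \<star> \<sigma> h y" if "g \<in> Fx" "h \<in> Fx" "y \<in> L" for g h y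
    using that FxD[OF that(1)] FxD[OF that(2)] L by (auto simp: sigma_mult LV)
  have one': "\<exists>h\<in>Fx. \<forall>y\<in>L. col y = col i \<longrightarrow> \<sigma> h y = t y" if "i \<in> L" "\<And>y. y \<in> L \<Longrightarrow> t y \<in> St (u y)" for i t
    using one[OF that] by (auto simp: Fx_def)
  have oneSt: "idP \<in> St v" if "v \<in> \<Omega>" for v
    using subgroup.one_closed[OF St_subgroup[OF that]] .
  have "\<exists>h\<in>carrier (A\<lparr>carrier := Fx\<rparr>). \<forall>y\<in>L. \<sigma> h y = s y"
  proof (rule onto_product_of_simple_groups[OF H L(1), where S = "\<lambda>y. S (u y)" and p = "\<lambda>y h. \<sigma> h y"])
    fix i assume i: "i \<in> L"
    show "simple_group (S (u i))" "\<not> comm_group (S (u i))" "s i \<in> carrier (S (u i))"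
      using simple nonab u[OF i] s[OF i] by auto
    show "(\<lambda>h. \<sigma> h i) \<in> hom (A\<lparr>carrier := Fx\<rparr>) (S (u i))"
      by (rule homI) (use sig sigm i in auto)
    have "a \<in> (\<lambda>h. \<sigma> h i) ` Fx" if a: "a \<in> St (u i)" for a
    proof -
      have "\<exists>h\<in>Fx. \<forall>y\<in>L. col y = col i \<longrightarrow> \<sigma> h y = (if y = i then a else idP)"
        by (rule one'[OF i]) (use a u oneSt in auto)
      then obtain h where "h \<in> Fx" "\<sigma> h i = a" using i by auto
      then show ?thesis by blast
    qed
    then show "(\<lambda>h. \<sigma> h i) ` carrier (A\<lparr>carrier := Fx\<rparr>) = carrier (S (u i))" using sig i by auto
  next
    fix i j assume i: "i \<in> L" and j: "j \<in> L" and ij: "i \<noteq> j"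
    obtain a where a: "a \<in> St (u i)" "a \<noteq> idP" using St_nontrivial u[OF i] by metis
    obtain h0 where h0: "h0 \<in> Fx" "\<forall>y\<in>L. col y = col i \<longrightarrow> \<sigma> h0 y = (if y = i then a else idP)"
    proof -
      have "\<exists>h\<in>Fx. \<forall>y\<in>L. col y = col i \<longrightarrow> \<sigma> h y = (if y = i then a else idP)"
        by (rule one'[OF i]) (use a u oneSt in auto)
      then show ?thesis using that by blast
    qed
    have "\<exists>h\<in>Fx. \<sigma> h j = idP \<and> \<sigma> h i \<noteq> idP"
    proof (cases "col i = col j")
      case True
      then show ?thesis using h0 i j ij a by (intro bexI[of _ h0]) auto
    next
      case False
      show ?thesis
      proof (rule ccontr)
        assume neg: "\<not> ?thesis"
        obtain g where g: "g \<in> G" "\<forall>x\<in>V. g x \<in> Z \<longleftrightarrow> x \<in> Z" "g i = i" "g j \<noteq> j" "g j \<in> L" "col (g j) = col j"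
          using move[OF i j False] by blast
        have linked: "\<sigma> h i = idP" if h: "h \<in> Fx" "\<sigma> h (g j) = idP" for h
        proof -
          let ?h = "inv\<^bsub>A\<^esub> g \<cdot> h \<cdot> inv\<^bsub>A\<^esub> (inv\<^bsub>A\<^esub> g)"
          have "?h x = x" if "x \<in> Z" for x
            using that L g FxD[OF h(1)] by (auto simp: subset_iff)
          then have "?h \<in> Fx" using g FxD[OF h(1)] by (simp add: Fx_def)
          moreover have "\<sigma> ?h j = inv\<^bsub>P\<^esub> (\<sigma> g j) \<star> \<sigma> h (g j) \<star> inv\<^bsub>P\<^esub> (inv\<^bsub>P\<^esub> (\<sigma> g j))"
            using sigma_conj[of "inv\<^bsub>A\<^esub> g" h "g j"] sigma_inv[of g j] g(1,5) FxD[OF h(1)] L LV[OF j] by auto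
          then have "\<sigma> ?h j = idP" using h(2) g(1) LV[OF j] by simp
          ultimately have "\<sigma> ?h i = idP" using neg by blast
          moreover have "(inv\<^bsub>A\<^esub> g) i = i" using inv_base g LV[OF i] by simp
          then have "\<sigma> ?h i = \<sigma> (inv\<^bsub>A\<^esub> g) i \<star> \<sigma> h i \<star> inv\<^bsub>P\<^esub> (\<sigma> (inv\<^bsub>A\<^esub> g) i)"
            using sigma_conj[of "inv\<^bsub>A\<^esub> g" h i] g(1) FxD[OF h(1)] i L LV[OF i] by auto
          ultimately show ?thesis
            using conj_eq_one[of "\<sigma> (inv\<^bsub>A\<^esub> g) i" "\<sigma> h i"] g(1) FxD[OF h(1)] LV[OF i] by simp
        qed
        obtain h1 where h1: "h1 \<in> Fx" "\<forall>y\<in>L. col y = col j \<longrightarrow> \<sigma> h1 y = (if y = j then \<sigma> h0 j else idP)"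
        proof -
          have "\<exists>h\<in>Fx. \<forall>y\<in>L. col y = col j \<longrightarrow> \<sigma> h y = (if y = j then \<sigma> h0 j else idP)"
            by (rule one'[OF j]) (use sig[OF h0(1) j] u oneSt in auto)
          then show ?thesis using that by blast
        qed
        have "\<sigma> h1 (g j) = idP" using h1 g by simp
        then have h1i: "\<sigma> h1 i = idP" using linked h1 by blast
        have inv: "\<sigma> (inv\<^bsub>A\<^esub> h1) y = inv\<^bsub>P\<^esub> (\<sigma> h1 y)" if "y \<in> L" for y
          using sigma_inv[of h1 y] FxD[OF h1(1)] that L LV by auto
        have "\<sigma> (h0 \<cdot> inv\<^bsub>A\<^esub> h1) j = idP"
          using sigm[OF h0(1) Fx_closed(2)[OF h1(1) h1(1)] j] inv[OF j] h1(2) j St_P[OF sig[OF h0(1) j]] by simp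
        moreover have "\<sigma> (h0 \<cdot> inv\<^bsub>A\<^esub> h1) i = a"
          using sigm[OF h0(1) Fx_closed(2)[OF h1(1) h1(1)] i] inv[OF i] h1i h0(2) i St_P[OF a(1)] by simp
        ultimately show False using neg a Fx_closed h0 h1 by blast
      qed
    qed
    then show "\<exists>h\<in>carrier (A\<lparr>carrier := Fx\<rparr>). \<sigma> h j = \<one>\<^bsub>S (u j)\<^esub> \<and> \<sigma> h i \<noteq> \<one>\<^bsub>S (u i)\<^esub>" by simp
  qed
  then show ?thesis by (auto simp: Fx_def)
qed

text \<open>
  All local actions on the sphere of radius \<open>n\<close> that are compatible with fixing the ball occur
  simultaneously.
\<close>

definition full where
  "full n \<longleftrightarrow> (\<forall>v\<in>V. \<forall>s. (\<forall>y\<in>sph v n. s y \<in> St (up v y)) \<longrightarrow>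
     (\<exists>h\<in>G. (\<forall>y\<in>B v n. h y = y) \<and> (\<forall>y\<in>sph v n. \<sigma> h y = s y)))"

lemma fullD:
  assumes "full n" "v \<in> V" "\<And>y. y \<in> sph v n \<Longrightarrow> s y \<in> St (up v y)"
  obtains h where "h \<in> G" "\<And>y. y \<in> B v n \<Longrightarrow> h y = y" "\<And>y. y \<in> sph v n \<Longrightarrow> \<sigma> h y = s y"
  using assms unfolding full_def by metis

lemma one_St: "v \<in> \<Omega> \<Longrightarrow> idP \<in> St v"
  by (rule subgroup.one_closed[OF St_subgroup])

text \<open>
  The hypothesis is the separation condition of Goursat's lemma for the action of \<open>K\<close> at the neighbours
  of \<open>b\<close>.
\<close>

lemma full_one:
  assumes unlinked: "\<And>\<omega> \<omega>'. \<omega> \<in> \<Omega> \<Longrightarrow> \<omega>' \<in> \<Omega> \<Longrightarrow> \<omega> \<noteq> \<omega>' \<Longrightarrow>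
      \<exists>h\<in>K. \<sigma> h (nb b \<omega>') = idP \<and> \<sigma> h (nb b \<omega>) \<noteq> idP"
  shows "full (Suc 0)"
  unfolding full_def
proof (intro ballI allI impI)
  fix v s assume v: "v \<in> V" and s: "\<forall>y\<in>sph v (Suc 0). s y \<in> St (up v y)"
  have "\<exists>h\<in>carrier (A\<lparr>carrier := K\<rparr>). \<forall>\<omega>\<in>\<Omega>. \<sigma> h (nb b \<omega>) = s (nb v \<omega>)"
  proof (rule onto_product_of_simple_groups[OF A.subgroup_imp_group[OF K_subgroup] fin,
        where S = S and p = "\<lambda>\<omega> h. \<sigma> h (nb b \<omega>)"])
    fix \<omega> assume \<omega>: "\<omega> \<in> \<Omega>"
    show "simple_group (S \<omega>)" "\<not> comm_group (S \<omega>)" using simple nonab \<omega> by auto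
    show "(\<lambda>h. \<sigma> h (nb b \<omega>)) \<in> hom (A\<lparr>carrier := K\<rparr>) (S \<omega>)"
      by (rule homI) (use K_sigma_St \<omega> in \<open>auto simp: sigma_mult\<close>)
    obtain \<omega>' where "\<omega>' \<in> \<Omega>" "\<omega>' \<noteq> \<omega>" using exists_label by blast
    then obtain h where "h \<in> K" "\<sigma> h (nb b \<omega>) \<noteq> idP" using unlinked[OF \<omega>] by metis
    then have "St \<omega> \<subseteq> (\<lambda>h. \<sigma> h (nb b \<omega>)) ` K" using K_onto[OF _ \<omega> _ \<omega>] by blast
    then show "(\<lambda>h. \<sigma> h (nb b \<omega>)) ` carrier (A\<lparr>carrier := K\<rparr>) = carrier (S \<omega>)" using K_sigma_St \<omega> by auto
    have "nb v \<omega> \<in> sph v (Suc 0)" "up v (nb v \<omega>) = \<omega>" using sph_one[OF v] \<omega> v by (auto simp: up_def)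
    then show "s (nb v \<omega>) \<in> carrier (S \<omega>)" using s by force
  next
    fix \<omega> \<omega>' assume "\<omega> \<in> \<Omega>" "\<omega>' \<in> \<Omega>" "\<omega> \<noteq> \<omega>'"
    then show "\<exists>h\<in>carrier (A\<lparr>carrier := K\<rparr>). \<sigma> h (nb b \<omega>') = \<one>\<^bsub>S \<omega>'\<^esub> \<and> \<sigma> h (nb b \<omega>) \<noteq> \<one>\<^bsub>S \<omega>\<^esub>"
      using unlinked by simp
  qed
  then obtain h where h: "h \<in> K" "\<forall>\<omega>\<in>\<Omega>. \<sigma> h (nb b \<omega>) = s (nb v \<omega>)" by auto
  let ?h = "tr b v \<cdot> (h \<cdot> tr v b)"
  have "?h \<in> G" using h v by simp
  moreover have "?h y = y" if "y \<in> B v (Suc 0)" for y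
  proof -
    have "h b = b" "\<And>\<omega>. \<omega> \<in> \<Omega> \<Longrightarrow> h (nb b \<omega>) = nb b \<omega>" using h(1) by simp_all
    note hb = this
    consider "y = v" | \<omega> where "\<omega> \<in> \<Omega>" "y = nb v \<omega>" using \<open>y \<in> B v (Suc 0)\<close> B_1[OF v] by blast
    then show ?thesis by cases (use h(1) v hb in simp_all)
  qed
  moreover have "\<sigma> ?h y = s y" if "y \<in> sph v (Suc 0)" for y
  proof -
    obtain \<omega> where \<omega>: "\<omega> \<in> \<Omega>" "y = nb v \<omega>" using \<open>y \<in> sph v (Suc 0)\<close> sph_one[OF v] by blast
    have "s y \<in> carrier P" by (rule St_P[OF s[rule_format, OF that]])
    moreover have "h \<in> G" by (rule K_G[OF h(1)])
    moreover have "h (nb b \<omega>) = nb b \<omega>" by (rule K_nb[OF h(1) \<omega>(1)])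
    moreover have "\<sigma> h (nb b \<omega>) = s y" unfolding \<omega>(2) by (rule bspec[OF h(2) \<omega>(1)])
    moreover have "tr v b y = nb b \<omega>" "y \<in> V" unfolding \<omega>(2) using \<omega>(1) v by simp_all
    ultimately show ?thesis using \<omega>(1) v by (simp add: sigma_mult)
  qed
  ultimately show "\<exists>h\<in>G. (\<forall>y\<in>B v (Suc 0). h y = y) \<and> (\<forall>y\<in>sph v (Suc 0). \<sigma> h y = s y)" by blast
qed

text \<open>
  The local permutation at the parent of \<open>j\<close> is chosen to fix the label towards \<open>v\<close> but not the label of
  the edge to \<open>j\<close>, and the other local permutations on the sphere to be trivial.
\<close>

lemma full_move:
  assumes full: "full (Suc n)" and v: "v \<in> V" and j: "j \<in> sph v (Suc (Suc n))"
  obtains g where "g \<in> G" "\<And>y. y \<in> B v (Suc n) \<Longrightarrow> g y = y" "g j \<noteq> j"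
    "\<And>i. i \<in> sph v (Suc (Suc n)) \<Longrightarrow> parent v i \<noteq> parent v j \<Longrightarrow> g i = i"
proof -
  let ?p = "parent v j"
  note pj = sph_Suc_parent[OF v j]
  note pp = sph_Suc_parent[OF v pj(1)]
  have up_neq: "up v j \<noteq> up v ?p"
  proof -
    have "word v j = word v (parent v ?p) @ [up v ?p, up v j]" using pj(6) pp(6) by simp
    then have "distinct_adj (word v (parent v ?p) @ [up v ?p, up v j])"
      using word_in[OF v pj(4)] by (simp add: words_def)
    then show ?thesis by (auto simp: distinct_adj_append_iff)
  qed
  obtain a where a: "a \<in> St (up v ?p)" "a (up v j) \<noteq> up v j" using St_moves[OF pp(2) pj(2) up_neq] by blast
  obtain g where g: "g \<in> G" "\<And>y. y \<in> B v (Suc n) \<Longrightarrow> g y = y"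
    "\<And>y. y \<in> sph v (Suc n) \<Longrightarrow> \<sigma> g y = (if y = ?p then a else idP)"
  proof -
    have "(if y = ?p then a else idP) \<in> St (up v y)" if "y \<in> sph v (Suc n)" for y
      using that a one_St sph_Suc_parent(2)[OF v] by auto
    then show ?thesis by (rule fullD[OF full v]) (blast intro: that)+
  qed
  have gp: "g ?p = ?p" using g(2) sph_B pj(1) by blast
  have "g j = nb ?p (a (up v j))" using aut_nb[of g ?p "up v j"] g(1) g(3)[OF pj(1)] gp pj by simp
  moreover have "a (up v j) \<in> \<Omega>" using St_P[OF a(1)] pj(2) by simp
  ultimately have "g j \<noteq> j" using nb_inj[of ?p "a (up v j)" "up v j"] a(2) pj by auto
  moreover have "g i = i" if i: "i \<in> sph v (Suc (Suc n))" "parent v i \<noteq> ?p" for i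
  proof -
    note p = sph_Suc_parent(1)[OF v i(1)]
    show ?thesis using fixes_next[of g v i "Suc n"] g(1) g(2)[OF sph_B[OF p]] g(3)[OF p] v i by simp
  qed
  ultimately show ?thesis using that g by blast
qed

text \<open>
  The set of ends of the union of two balls of equal radius around the vertices of an edge has two halves.
  Each half consists of ends of one of the balls, so that independence is known for it.
\<close>

lemma full_half:
  assumes full: "full (Suc n)" and v: "v \<in> V" and \<omega>: "\<omega> \<in> \<Omega>"
    and s: "\<And>y. y \<in> sph v (Suc n) \<inter> sph (nb v \<omega>) (Suc (Suc n)) \<Longrightarrow> s y \<in> St (up v y)"
  shows "\<exists>h\<in>G. (\<forall>y\<in>B v (Suc n) \<union> B (nb v \<omega>) (Suc n). h y = y) \<and>
    (\<forall>y\<in>sph v (Suc n) \<inter> sph (nb v \<omega>) (Suc (Suc n)). \<sigma> h y = s y)"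
proof -
  let ?L = "sph v (Suc n) \<inter> sph (nb v \<omega>) (Suc (Suc n))"
  obtain h where h: "h \<in> G" "\<And>y. y \<in> B v (Suc n) \<Longrightarrow> h y = y"
    "\<And>y. y \<in> sph v (Suc n) \<Longrightarrow> \<sigma> h y = (if y \<in> ?L then s y else idP)"
  proof -
    have "(if y \<in> ?L then s y else idP) \<in> St (up v y)" if "y \<in> sph v (Suc n)" for y
      using that s one_St sph_Suc_parent(2)[OF v] by auto
    then show ?thesis by (rule fullD[OF full v]) (blast intro: that)+
  qed
  have "h y = y" if y: "y \<in> B (nb v \<omega>) (Suc n)" for y
  proof (cases "y \<in> B v (Suc n)")
    case False
    then have y': "y \<in> sph v (Suc (Suc n))" using B_nb_center[OF v \<omega> y] B_Suc_cases by blast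
    note p = sph_Suc_parent[OF v y']
    have "word (nb v \<omega>) y = (if hd (word v y) = \<omega> then tl (word v y) else \<omega> # word v y)"
      using word_Cons[OF v p(4) \<omega>] y' by (auto simp: sph_def)
    then have "hd (word v y) = \<omega>" using y y' by (auto simp: B_def sph_def split: if_splits)
    moreover have "word v (parent v y) \<noteq> []" using p(1) by (auto simp: sph_def)
    ultimately have "hd (word v (parent v y)) = \<omega>" using p(6) by simp
    then have "parent v y \<in> sph (nb v \<omega>) n" using branch_iff[OF v \<omega> p(1)] by simp
    then have "parent v y \<notin> ?L" by (auto simp: sph_def)
    then have "\<sigma> h (parent v y) = idP" using h(3)[OF p(1)] by (simp only: if_False)
    then show ?thesis using fixes_next[of h v y "Suc n"] h(1) h(2)[OF sph_B[OF p(1)]] v y' by simp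
  qed (use h in simp)
  then show ?thesis using h by (intro bexI[of _ h]) auto
qed

lemma up_edge:
  assumes "v \<in> V" "\<omega> \<in> \<Omega>" "y \<in> sph v (Suc (Suc n))" "y \<in> sph (nb v \<omega>) (Suc n)"
  shows "up (nb v \<omega>) y = up v y"
proof -
  have "hd (word v y) = \<omega>" using branch_iff assms by blast
  then have "word v y = \<omega> # word (nb v \<omega>) y"
    using word_Cons[of v y \<omega>] assms by (cases "word v y") (auto simp: sph_def)
  moreover have "word (nb v \<omega>) y \<noteq> []" using assms by (auto simp: sph_def)
  ultimately show ?thesis by (simp add: up_def)
qed

text \<open>
  Ends on different sides of the edge are independent: an end of the union that lies on the sphere of
  radius \<open>n + 1\<close> around one vertex of the edge is fixed by the elements fixing the ball inside that
  sphere, and these can move the ends on the other side.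
\<close>

lemma full_edge:
  assumes full: "full (Suc n)" and v: "v \<in> V" and \<omega>: "\<omega> \<in> \<Omega>"
  defines "L1 \<equiv> sph v (Suc n) \<inter> sph (nb v \<omega>) (Suc (Suc n))"
    and "L2 \<equiv> sph v (Suc (Suc n)) \<inter> sph (nb v \<omega>) (Suc n)"
  assumes s: "\<And>y. y \<in> L1 \<union> L2 \<Longrightarrow> s y \<in> St (up v y)"
  shows "\<exists>h\<in>G. (\<forall>y\<in>B v (Suc n) \<union> B (nb v \<omega>) (Suc n). h y = y) \<and> (\<forall>y\<in>L1 \<union> L2. \<sigma> h y = s y)"
proof -
  let ?C = "B v (Suc n) \<union> B (nb v \<omega>) (Suc n)" and ?v = "nb v \<omega>"
  have vV: "?v \<in> V" "nb ?v \<omega> = v" using v \<omega> by auto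
  have L_disj: "y \<notin> L2" if "y \<in> L1" for y using that by (auto simp: L1_def L2_def sph_def)
  have move1: "\<exists>g\<in>G. (\<forall>x\<in>V. g x \<in> B x1 (Suc n) \<union> B (nb x1 \<omega>) (Suc n) \<longleftrightarrow> x \<in> B x1 (Suc n) \<union> B (nb x1 \<omega>) (Suc n)) \<and>
      g i = i \<and> g j \<noteq> j \<and> g j \<in> sph x1 (Suc (Suc n)) \<inter> sph (nb x1 \<omega>) (Suc n)"
    if x1: "x1 \<in> V" and i: "i \<in> sph x1 (Suc n)" and j: "j \<in> sph x1 (Suc (Suc n))" "j \<in> sph (nb x1 \<omega>) (Suc n)"
    for x1 i j
  proof -
    obtain g where g: "g \<in> G" "\<And>y. y \<in> B x1 (Suc n) \<Longrightarrow> g y = y" "g j \<noteq> j"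
      using full_move[OF full x1 j(1)] by metis
    have "nb x1 \<omega> \<in> B x1 (Suc n)" using x1 \<omega> by (simp add: B_def)
    then have gx: "g x1 = x1" "g (nb x1 \<omega>) = nb x1 \<omega>" using g x1 by auto
    have jV: "j \<in> V" using j sph_V by blast
    show ?thesis
      using g i j gx jV x1 \<omega> aut_B_fix[of g x1] aut_B_fix[of g "nb x1 \<omega>"] aut_sph_fix[of g x1] aut_sph_fix[of g "nb x1 \<omega>"]
      by (intro bexI[of _ g]) (auto simp: sph_B)
  qed
  show ?thesis
  proof (rule independence_from_colour_classes[where u = "up v" and col = "\<lambda>y. y \<in> L1"])
    show "finite (L1 \<union> L2)"
      using finite_B[OF v, of "Suc (Suc n)"] by (rule rev_finite_subset) (auto simp: L1_def L2_def sph_def B_def)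
    show "L1 \<union> L2 \<subseteq> ?C" "?C \<subseteq> V" by (auto simp: L1_def L2_def sph_def B_def)
    fix y assume "y \<in> L1 \<union> L2"
    then have y: "y \<in> sph v (Suc n) \<or> y \<in> sph v (Suc (Suc n))" by (auto simp: L1_def L2_def)
    then have "parent v y \<in> B v (Suc n)"
      using sph_Suc_parent(1)[OF v, of y n] sph_Suc_parent(1)[OF v, of y "Suc n"] by (auto simp: sph_def B_def)
    then show "up v y \<in> \<Omega> \<and> parent v y \<in> ?C" using y sph_Suc_parent(2)[OF v] by auto
  next
    fix i t assume i: "i \<in> L1 \<union> L2" and t: "\<And>y. y \<in> L1 \<union> L2 \<Longrightarrow> t y \<in> St (up v y)"
    show "\<exists>h\<in>G. (\<forall>x\<in>?C. h x = x) \<and> (\<forall>y\<in>L1 \<union> L2. (y \<in> L1) = (i \<in> L1) \<longrightarrow> \<sigma> h y = t y)"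
    proof (cases "i \<in> L1")
      case True
      then show ?thesis using full_half[OF full v \<omega>, of t] t by (auto simp: L1_def[symmetric])
    next
      case False
      have "t y \<in> St (up ?v y)" if "y \<in> sph ?v (Suc n) \<inter> sph (nb ?v \<omega>) (Suc (Suc n))" for y
        using that t[of y] up_edge[OF v \<omega>, of y n] vV(2) by (simp add: L2_def)
      then obtain h where "h\<in>G" "\<forall>y\<in>B ?v (Suc n) \<union> B v (Suc n). h y = y" "\<forall>y\<in>L2. \<sigma> h y = t y"
        using full_half[OF full vV(1) \<omega>, of t] vV(2) by (auto simp: L2_def Int_commute)
      then show ?thesis using False L_disj by auto
    qed
  next
    fix i j assume ij: "i \<in> L1 \<union> L2" "j \<in> L1 \<union> L2" "(i \<in> L1) \<noteq> (j \<in> L1)"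
    show "\<exists>g\<in>G. (\<forall>x\<in>V. g x \<in> ?C \<longleftrightarrow> x \<in> ?C) \<and> g i = i \<and> g j \<noteq> j \<and> g j \<in> L1 \<union> L2 \<and> (g j \<in> L1) = (j \<in> L1)"
    proof (cases "i \<in> L1")
      case True
      then have "j \<in> L2" using ij by blast
      then show ?thesis using move1[OF v, of i j] True L_disj by (auto simp: L1_def L2_def)
    next
      case False
      then have "i \<in> L2" "j \<in> L1" using ij by auto
      then show ?thesis using move1[OF vV(1), of i j] vV(2) by (auto simp: L1_def L2_def Un_commute)
    qed
  qed (use s in auto)
qed

text \<open>
  The ends of a ball are coloured by the branch at \<open>v\<close> that contains them. Within a branch, independence
  is obtained from the edge that leads into the branch.
\<close>

lemma full_Suc:
  assumes full: "full (Suc n)" shows "full (Suc (Suc n))"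
  unfolding full_def
proof (intro ballI allI impI)
  fix v s assume v: "v \<in> V" and s: "\<forall>y\<in>sph v (Suc (Suc n)). s y \<in> St (up v y)"
  let ?C = "B v (Suc (Suc n))" and ?L = "sph v (Suc (Suc n))"
  show "\<exists>h\<in>G. (\<forall>y\<in>?C. h y = y) \<and> (\<forall>y\<in>?L. \<sigma> h y = s y)"
  proof (rule independence_from_colour_classes[where u = "up v" and col = "\<lambda>y. hd (word v y)"])
    show "finite ?L" using finite_B[OF v, of "Suc (Suc n)"] by (rule rev_finite_subset) (auto simp: sph_def B_def)
    show "?L \<subseteq> ?C" "?C \<subseteq> V" by (auto simp: sph_def B_def)
    fix y assume y: "y \<in> ?L"
    show "up v y \<in> \<Omega> \<and> parent v y \<in> ?C"
      using sph_Suc_parent(1,2)[OF v y] by (auto simp: sph_def B_def)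
    show "s y \<in> St (up v y)" using s y by blast
  next
    fix i t assume i: "i \<in> ?L" and t: "\<And>y. y \<in> ?L \<Longrightarrow> t y \<in> St (up v y)"
    define \<omega> where "\<omega> = hd (word v i)"
    have "word v i \<noteq> []" using i by (auto simp: sph_def)
    then have \<omega>: "\<omega> \<in> \<Omega>" using word_subset[OF v sph_V[OF i]] unfolding \<omega>_def by (meson hd_in_set subsetD)
    let ?L1 = "sph v (Suc n) \<inter> sph (nb v \<omega>) (Suc (Suc n))"
      and ?L2 = "sph v (Suc (Suc n)) \<inter> sph (nb v \<omega>) (Suc n)"
    have "(if y \<in> ?L2 then t y else idP) \<in> St (up v y)" if "y \<in> ?L1 \<union> ?L2" for y
      using that t one_St sph_Suc_parent(2)[OF v] by auto
    then obtain h where h: "h \<in> G" "\<forall>y\<in>B v (Suc n) \<union> B (nb v \<omega>) (Suc n). h y = y"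
      "\<forall>y\<in>?L1 \<union> ?L2. \<sigma> h y = (if y \<in> ?L2 then t y else idP)"
      using full_edge[OF full v \<omega>, of "\<lambda>y. if y \<in> ?L2 then t y else idP"] by blast
    have "h y = y" if y: "y \<in> ?C" for y
    proof (cases "y \<in> B v (Suc n) \<union> B (nb v \<omega>) (Suc n)")
      case False
      then have y': "y \<in> ?L" using y B_Suc_cases by blast
      note p = sph_Suc_parent[OF v y']
      have ne: "word v (parent v y) \<noteq> []" using p(1) by (auto simp: sph_def)
      have "hd (word v y) \<noteq> \<omega>" using branch_iff[OF v \<omega> y'] False sph_B by blast
      then have "hd (word v (parent v y)) \<noteq> \<omega>" using p(6) ne by simp
      then have "word (nb v \<omega>) (parent v y) = \<omega> # word v (parent v y)" using word_Cons[OF v p(5) \<omega>] by simp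
      then have "parent v y \<in> ?L1" "parent v y \<notin> ?L2" using p(1,5) by (auto simp: sph_def)
      then show ?thesis using fixes_next[of h v y "Suc n"] h v y' sph_B[OF p(1)] by auto
    qed (use h in blast)
    moreover have "\<sigma> h y = t y" if "y \<in> ?L" "hd (word v y) = hd (word v i)" for y
      using that h(3) branch_iff[OF v \<omega> that(1)] \<omega>_def by simp
    ultimately show "\<exists>h\<in>G. (\<forall>x\<in>?C. h x = x) \<and> (\<forall>y\<in>?L. hd (word v y) = hd (word v i) \<longrightarrow> \<sigma> h y = t y)"
      using h(1) by blast
  next
    fix i j assume i: "i \<in> ?L" and j: "j \<in> ?L" and ij: "hd (word v i) \<noteq> hd (word v j)"
    obtain g where g: "g \<in> G" "\<And>y. y \<in> B v (Suc n) \<Longrightarrow> g y = y" "g j \<noteq> j"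
      "\<And>i. i \<in> ?L \<Longrightarrow> parent v i \<noteq> parent v j \<Longrightarrow> g i = i"
      using full_move[OF full v j] by metis
    note pi = sph_Suc_parent[OF v i] and pj = sph_Suc_parent[OF v j]
    have "word v (parent v i) \<noteq> []" "word v (parent v j) \<noteq> []" using pi(1) pj(1) by (auto simp: sph_def)
    then have "parent v i \<noteq> parent v j" using ij pi(6) pj(6) by auto
    then have gi: "g i = i" using g(4)[OF i] by blast
    have gv: "g v = v" using g(2) v by simp
    let ?\<omega> = "hd (word v j)"
    have "word v j \<noteq> []" using j by (auto simp: sph_def)
    then have \<omega>: "?\<omega> \<in> \<Omega>" using word_subset[OF v pj(4)] by (meson hd_in_set subsetD)
    have gn: "g (nb v ?\<omega>) = nb v ?\<omega>" using g(2) v \<omega> by (simp add: B_def)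
    have gj: "g j \<in> ?L" using aut_sph_fix[OF G_A[OF g(1)] v gv pj(4)] j by blast
    have "j \<in> sph (nb v ?\<omega>) (Suc n)" using branch_iff[OF v \<omega> j] by simp
    then have "g j \<in> sph (nb v ?\<omega>) (Suc n)" using aut_sph_fix[OF G_A[OF g(1)] nb_in[OF v \<omega>] gn pj(4)] by blast
    then have "hd (word v (g j)) = ?\<omega>" using branch_iff[OF v \<omega> gj] by simp
    moreover have "\<forall>x\<in>V. g x \<in> ?C \<longleftrightarrow> x \<in> ?C" using aut_B_fix[OF G_A[OF g(1)] v gv] by blast
    ultimately show "\<exists>g\<in>G. (\<forall>x\<in>V. g x \<in> ?C \<longleftrightarrow> x \<in> ?C) \<and> g i = i \<and> g j \<noteq> j \<and> g j \<in> ?L \<and>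
        hd (word v (g j)) = hd (word v j)"
      using g(1,3) gi gj by blast
  qed
qed

text \<open>
  An element of the group that agrees with the given automorphism on a ball is corrected, radius by
  radius, by an element that fixes the ball and has the missing local permutations on its sphere.
\<close>

lemma full_contains:
  assumes full: "full (Suc 0)" and g: "g \<in> carrier A" and gF: "\<And>x. x \<in> V \<Longrightarrow> \<sigma> g x \<in> F"
  shows "g \<in> G"
proof -
  have full_all: "full (Suc n)" for n by (induct n) (use full full_Suc in auto)
  have approx: "\<exists>h\<in>G. \<forall>y\<in>B b n. f y = h y"
    if f: "f \<in> carrier A" "f b = b" "\<And>x. x \<in> V \<Longrightarrow> \<sigma> f x \<in> F" for f n
  proof (induct n)
    case 0
    have "B b 0 = {b}" by (auto simp: B_def word_Nil_iff)
    then show ?case using f by (intro bexI[of _ "idA"]) auto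
  next
    case (Suc n)
    show ?case
    proof (cases n)
      case 0
      obtain h where h: "h \<in> G" "h b = b" "\<sigma> h b = \<sigma> f b" using lift f(3) b_in by metis
      have "B b 0 = {b}" by (auto simp: B_def word_Nil_iff)
      then have "f y = h y" if "y \<in> B b (Suc 0)" for y
        using agree_extend[of f h b 0 y] that f h by simp
      then show ?thesis using h 0 by blast
    next
      case m: (Suc m)
      obtain h where h: "h \<in> G" "\<forall>y\<in>B b n. f y = h y" using Suc by blast
      define e where "e = inv\<^bsub>A\<^esub> h \<cdot> f"
      have e: "e \<in> carrier A" using h f by (simp add: e_def)
      have e_fix: "e y = y" if "y \<in> B b n" for y using that h f B_inV by (simp add: e_def)
      have "\<sigma> e y \<in> F" if "y \<in> V" for y
        using that h f F.m_closed[of "\<sigma> (inv\<^bsub>A\<^esub> h) (f y)" "\<sigma> f y"] by (simp add: e_def sigma_mult)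
      then have "\<sigma> e y \<in> St (up b y)" if y: "y \<in> sph b n" for y
      proof -
        have y': "y \<in> sph b (Suc m)" using y m by simp
        note p = sph_Suc_parent[OF b_in y']
        have "parent b y \<in> B b n" using p(1) m by (auto simp: sph_def B_def)
        then have "\<sigma> e y (up b y) = up b y"
          using fix_sigma[OF p(4) p(2), of e] e_fix[OF sph_B[OF y]] e_fix[of "parent b y"] by simp
        then show ?thesis using \<open>\<And>y. y \<in> V \<Longrightarrow> \<sigma> e y \<in> F\<close> p(4) StI by blast
      qed
      then obtain q where q: "q \<in> G" "\<And>y. y \<in> B b n \<Longrightarrow> q y = y" "\<And>y. y \<in> sph b n \<Longrightarrow> \<sigma> q y = \<sigma> e y"
        using fullD[OF full_all[of m] b_in, of "\<sigma> e"] m by metis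
      have "\<sigma> q y = \<sigma> e y" if y: "y \<in> B b n" for y
      proof (cases "y \<in> sph b n")
        case False
        then have "y \<in> B b m" using y m B_Suc_cases by simp
        then show ?thesis using agree_sigma[OF b_in, of m q e y] q(2) e_fix m by simp
      qed (use q in simp)
      then have "q y = e y" if "y \<in> B b (Suc n)" for y
        using agree_extend[of q e b n y] that q(1) e q(2) e_fix by simp
      then have "f y = (h \<cdot> q) y" if "y \<in> B b (Suc n)" for y
        using that B_inV[OF that] h(1) q(1) f by (simp add: e_def)
      then show ?thesis using h q G_closed by blast
    qed
  qed
  show ?thesis
  proof (rule closed[OF g])
    fix x assume x: "x \<in> V"
    have "\<exists>h\<in>G. \<forall>y\<in>B b k. locaut b g x y = h y"
      by (rule approx) (use g x gF in \<open>auto simp: sigma_locaut\<close>)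
    then show "\<exists>h\<in>G. \<forall>y\<in>B x k. h y = g y" using agree_from_locaut[OF g x] by metis
  qed
qed

end

section \<open>The classification\<close>

context labelled_regular_tree
begin

lemma univ_Phi_iff:
  assumes b: "b \<in> V"
  shows "g \<in> univ_group T l b 2 (Phi T l \<Omega> b F) \<longleftrightarrow> g \<in> carrier A \<and> (\<forall>x\<in>V. \<sigma> g x \<in> F)"
proof -
  have "(\<sigma> (locaut b g x) b, \<lambda>\<omega>\<in>\<Omega>. \<sigma> (locaut b g x) (nb b \<omega>)) \<in>
      {(a, \<lambda>\<omega>\<in>\<Omega>. s \<omega>) | a s. a \<in> F \<and> (\<forall>\<omega>\<in>\<Omega>. s \<omega> \<in> F \<and> s \<omega> \<omega> = a \<omega>)}"
    if g: "g \<in> carrier A" and F: "\<forall>x\<in>V. \<sigma> g x \<in> F" and x: "x \<in> V" for x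
  proof -
    have "\<sigma> (locaut b g x) (nb b \<omega>) \<in> F \<and> \<sigma> (locaut b g x) (nb b \<omega>) \<omega> = \<sigma> (locaut b g x) b \<omega>"
      if "\<omega> \<in> \<Omega>" for \<omega>
      using that g F x b sigma_nb[of "locaut b g x" b \<omega>] by (simp add: sigma_locaut)
    moreover have "\<sigma> (locaut b g x) b \<in> F" using F x b g by (simp add: sigma_locaut)
    ultimately show ?thesis by blast
  qed
  moreover have "\<sigma> g x \<in> F"
    if "g \<in> carrier A" "x \<in> V" "(\<sigma> (locaut b g x) b, \<lambda>\<omega>\<in>\<Omega>. \<sigma> (locaut b g x) (nb b \<omega>)) \<in>
      {(a, \<lambda>\<omega>\<in>\<Omega>. s \<omega>) | a s. a \<in> F \<and> (\<forall>\<omega>\<in>\<Omega>. s \<omega> \<in> F \<and> s \<omega> \<omega> = a \<omega>)}" for x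
    using that b by (auto simp: sigma_locaut)
  ultimately show ?thesis unfolding Phi_def univ_of_pairs_iff[OF b] by blast
qed

lemma univ_of_perms_iff:
  assumes b: "b \<in> V"
  shows "g \<in> univ_group T l b 1 (of_perms T l \<Omega> b F) \<longleftrightarrow> g \<in> carrier A \<and> (\<forall>x\<in>V. \<sigma> g x \<in> F)"
proof -
  have "restrict (locaut b g x) (B b 1) \<in> of_perms T l \<Omega> b F \<longleftrightarrow> \<sigma> g x \<in> F"
    if "g \<in> carrier A" "x \<in> V" for x
    using that b restrict_aut_ball[of "locaut b g x" b 1] perm_restrict[of b b 0 1 "locaut b g x"]
    by (simp add: of_perms_def sigma_locaut)
  then show ?thesis using univ_group_iff[OF b] by blast
qed

text \<open>
  Condition (C) enters through the extension theorem: every element of \<open>F\<close> is the local permutation at \<open>b\<close>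
  of an element of the universal group.
\<close>

lemma univ_group_locally_closed:
  assumes b: "b \<in> V" and k: "k \<ge> 1" and F: "subgroup F P" "two_transitive \<Omega> F"
    and simple: "\<forall>\<omega>\<in>\<Omega>. simple_group (perm_group \<Omega> (point_stab F \<omega>)) \<and>
                \<not> comm_group (perm_group \<Omega> (point_stab F \<omega>))"
    and S: "subgroup S (Aut (graph_ball T b k))" and C: "condition_C T l \<Omega> b k S"
    and pi: "restr_perm T l \<Omega> b ` S = F"
  shows "locally_closed_group T l \<Omega> d b F (univ_group T l b k S) k"
proof (intro locally_closed_group.intro locally_closed_group_axioms.intro)
  let ?G = "univ_group T l b k S"
  show "labelled_regular_tree T l \<Omega> d" by (rule labelled_regular_tree_axioms)
  show "subgroup ?G A" by (rule univ_group_subgroup[OF b S])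
  show "tr u v \<in> ?G" if "u \<in> V" "v \<in> V" for u v using tr_in_univ_group[OF b S that] .
  have restr: "restr_perm T l \<Omega> b (restrict h (B b k)) = \<sigma> h b" for h
  proof -
    have "restrict (restrict h (B b k)) (B b 1) = restrict h (B b 1)"
      using B_mono[OF k, of b] by (auto simp: inf.absorb2)
    then show ?thesis unfolding restr_perm_def using b perm_restrict[of b b 0 1 h] by simp
  qed
  show "\<sigma> g x \<in> F" if "g \<in> ?G" "x \<in> V" for g x
  proof -
    have g: "g \<in> carrier A" "restrict (locaut b g x) (B b k) \<in> S" using that univ_group_iff[OF b] by auto
    then have "restr_perm T l \<Omega> b (restrict (locaut b g x) (B b k)) \<in> F" using pi by blast
    then show ?thesis using restr sigma_locaut[OF b g(1) that(2) b] b that by simp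
  qed
  show "\<exists>g\<in>?G. g b = b \<and> \<sigma> g b = a" if "a \<in> F" for a
  proof -
    obtain c where c: "c \<in> S" "restr_perm T l \<Omega> b c = a" using pi \<open>a \<in> F\<close> by blast
    obtain g where "g \<in> ?G" "g b = b" "restrict g (B b k) = c"
      using extend_local_action[OF b k subgroup.subset[OF S] C c(1)] by blast
    then show ?thesis using c restr by metis
  qed
  show "g \<in> ?G" if g: "g \<in> carrier A" and agree: "\<And>x. x \<in> V \<Longrightarrow> \<exists>h\<in>?G. \<forall>y\<in>B x k. h y = g y" for g
    unfolding univ_group_iff[OF b]
  proof (intro conjI ballI)
    fix x assume x: "x \<in> V"
    obtain h where h: "h \<in> ?G" "\<forall>y\<in>B x k. h y = g y" using agree[OF x] by blast
    have hA: "h \<in> carrier A" "restrict (locaut b h x) (B b k) \<in> S" using h x univ_group_iff[OF b] by auto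
    have "h x = g x" using h x by simp
    then have "locaut b h x y = locaut b g x y" if "y \<in> B b k" for y
      using that B_inV[OF that] h(2) hA(1) g x b tr_B[of b x y k] by (simp add: locaut_apply)
    then have "restrict (locaut b h x) (B b k) = restrict (locaut b g x) (B b k)" by (rule restrict_ext)
    then show "restrict (locaut b g x) (B b k) \<in> S" using hA by simp
  qed (rule g)
qed (use assms in auto)

end

theorem (in locally_closed_group) classification:
  assumes \<omega>\<^sub>0: "\<omega>\<^sub>0 \<in> \<Omega>"
  shows "(\<exists>z. involutive_cocycle \<Omega> F z \<and> G = univ_group T l b 2 (Gamma1 T l \<Omega> b F z)) \<or>
    (\<exists>D. is_Delta T l \<Omega> b \<omega>\<^sub>0 F D \<and> G = univ_group T l b 2 D) \<or>
    G = univ_group T l b 2 (Phi T l \<Omega> b F)"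
proof (cases "\<forall>h\<in>K. \<forall>\<omega>\<in>\<Omega>. \<sigma> h (nb b \<omega>) = idP")
  case True
  then have "\<exists>z. involutive_cocycle \<Omega> F z \<and> univ_group T l b 2 (Gamma1 T l \<Omega> b F z) = G"
    by (intro trivial_kernel_Gamma1) blast
  then show ?thesis by metis
next
  case False
  then have onto: "\<exists>h\<in>K. \<sigma> h (nb b \<omega>) = a" if "\<omega> \<in> \<Omega>" "a \<in> St \<omega>" for \<omega> a
    using K_onto[OF _ _ _ that] by blast
  show ?thesis
  proof (cases "\<exists>\<omega>\<in>\<Omega>. \<exists>\<omega>'\<in>\<Omega>. \<omega> \<noteq> \<omega>' \<and> (\<forall>h\<in>K. \<sigma> h (nb b \<omega>') = idP \<longrightarrow> \<sigma> h (nb b \<omega>) = idP)")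
    case True
    then have r: rigid using linked_imp_rigid by metis
    then show ?thesis using D2_is_Delta[OF r \<omega>\<^sub>0 onto] univ_group_D2 by metis
  next
    case False
    then have full: "full (Suc 0)" by (intro full_one) blast
    have "G = univ_group T l b 2 (Phi T l \<Omega> b F)"
      unfolding set_eq_iff univ_Phi_iff[OF b_in]
    proof (intro allI iffI conjI ballI)
      show "g \<in> G" if "g \<in> carrier A \<and> (\<forall>x\<in>V. \<sigma> g x \<in> F)" for g using full_contains[OF full] that by blast
    qed simp_all
    then show ?thesis by blast
  qed
qed

theorem theorem3p32:
  fixes T :: "'v pair_pre_digraph" and l :: "'v \<times> 'v \<Rightarrow> 'l" and \<Omega> :: "'l set"
    and b :: 'v and \<omega>\<^sub>0 :: 'l and d k :: nat
    and F :: "('l \<Rightarrow> 'l) set" and Ft :: "('v \<Rightarrow> 'v) set"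
  assumes "finite \<Omega>" and "card \<Omega> = d" and "d \<ge> 3"
    and "regular_tree d T" and "labelling T \<Omega> l" and "b \<in> pverts T"
    and "subgroup F (BijGroup \<Omega>)" and "two_transitive \<Omega> F"
    and "\<forall>\<omega>\<in>\<Omega>. simple_group (perm_group \<Omega> (point_stab F \<omega>)) \<and>
                \<not> comm_group (perm_group \<Omega> (point_stab F \<omega>))"
    and "\<omega>\<^sub>0 \<in> \<Omega>" and "k \<ge> 1"
    and "subgroup Ft (Aut (graph_ball T b k))"
    and "condition_C T l \<Omega> b k Ft"
    and "restr_perm T l \<Omega> b ` Ft = F"
  shows "((\<exists>z. involutive_cocycle \<Omega> F z \<and>
              univ_group T l b k Ft = univ_group T l b 2 (Gamma1 T l \<Omega> b F z)) \<or>
          (\<exists>D. is_Delta T l \<Omega> b \<omega>\<^sub>0 F D \<and>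
              univ_group T l b k Ft = univ_group T l b 2 D) \<or>
          univ_group T l b k Ft = univ_group T l b 2 (Phi T l \<Omega> b F)) \<and>
         univ_group T l b 2 (Phi T l \<Omega> b F) = univ_group T l b 1 (of_perms T l \<Omega> b F)"
proof -
  interpret labelled_regular_tree T l \<Omega> d
    using assms(1-5) by (rule labelled_regular_tree.intro)
  have "locally_closed_group T l \<Omega> d b F (univ_group T l b k Ft) k"
    by (rule univ_group_locally_closed[OF assms(6,11,7-9,12-14)])
  then have "(\<exists>z. involutive_cocycle \<Omega> F z \<and>
              univ_group T l b k Ft = univ_group T l b 2 (Gamma1 T l \<Omega> b F z)) \<or>
          (\<exists>D. is_Delta T l \<Omega> b \<omega>\<^sub>0 F D \<and>
              univ_group T l b k Ft = univ_group T l b 2 D) \<or>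
          univ_group T l b k Ft = univ_group T l b 2 (Phi T l \<Omega> b F)"
    using assms(10) by (rule locally_closed_group.classification)
  moreover have "univ_group T l b 2 (Phi T l \<Omega> b F) = univ_group T l b 1 (of_perms T l \<Omega> b F)"
    using univ_Phi_iff[OF assms(6)] univ_of_perms_iff[OF assms(6)] by blast
  ultimately show ?thesis by blast
qed

end
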